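(* Let $\Omega\subset\mathbb{R}^2$ be a bounded $C^2$ domain with boundary $\partial\Omega$ parameterized by a smooth $\gamma:[0,L]\to\mathbb{R}^2$, and let $k>0$. Let $\nu$ be a smooth scalar function on $\partial\Omega$ and consider the normal perturbation $\gamma_\varepsilon=\gamma+\varepsilon\,n\,\nu$. Define $$S_{\tau,k}[\sigma](x):=\mathrm{p.v.}\int_{\partial\Omega}\partial_{\tau_x}G_k(x,y)\,\sigma(y)\,ds_y .$$ Then $$\delta(S_k')[\sigma]=\nu\,S_k''[\sigma]+D_k'[\nu\sigma]-\frac{d\nu}{d\tau}\,S_{\tau,k}[\sigma]+S_k'[\kappa\,\nu\,\sigma],$$ and, for $x\in\partial\Omega$, $$\partial_kS_k'[\sigma](x)=\frac{ik}{4}\int_{\partial\Omega}H_0^{(1)}(k|x-y|)\,(x-y)\cdot n(x)\,\sigma(y)\,ds_y .$$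
   Context: $n$ is the outward unit normal, $\tau=\dot\gamma/|\dot\gamma|$ the unit tangent (with $n$ the clockwise rotation of $\tau$ by $\pi/2$), $\kappa$ the signed curvature (positive for a circle), $ds_y$ arc length, and $\frac{d\nu}{d\tau}=\dot\nu/|\dot\gamma|$ the tangential derivative. $G_k(x,y)=\frac{i}{4}H_0^{(1)}(k|x-y|)$ is the free-space Green's function, with $H_0^{(1)}$ the Hankel function of the first kind of order $0$. For a density $\sigma$ on $\partial\Omega$ and $x\in\partial\Omega$, $$S_k'[\sigma](x)=\mathrm{p.v.}\int_{\partial\Omega}\partial_{n_x}G_k(x,y)\sigma(y)\,ds_y,\quad S_k''[\sigma](x)=\mathrm{f.p.}\int_{\partial\Omega}\partial_{n_x}^2G_k(x,y)\sigma(y)\,ds_y,$$ $$D_k'[\sigma](x)=\mathrm{f.p.}\int_{\partial\Omega}\partial_{n_x}\partial_{n_y}G_k(x,y)\sigma(y)\,ds_y,$$ where p.v. is the Cauchy principal value, f.p. the Hadamard finite part, $\partial_{n_x}=n(x)\cdot\nabla_x$, $\partial_{\tau_x}=\tau(x)\cdot\nabla_x$, $\partial_{n_y}=n(y)\cdot\nabla_y$, and $\partial_{n_x}^2G_k=n(x)^T(\nabla_x^2G_k)\,n(x)$. Functions on $\partial\Omega$ are identified with functions of the parameter $s$ through $\gamma(s)$. The shape derivative is $\delta(S_k')[\sigma](t)=\partial_\varepsilon\big|_{\varepsilon=0}S'_{k,\varepsilon}[\sigma](t)$, where $$S'_{k,\varepsilon}[\sigma](t)=\mathrm{p.v.}\int_0^L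 n_\varepsilon(t)\cdot\nabla_xG_k(\gamma_\varepsilon(t),\gamma_\varepsilon(s))\,\sigma(s)\,|\dot\gamma_\varepsilon(s)|\,ds,$$ $n_\varepsilon$ is the outward unit normal to $\gamma_\varepsilon$, and $k$ and $s\mapsto\sigma(s)$ are held fixed; $\partial_kS_k'$ is the derivative with respect to the wavenumber $k$ for the fixed curve and density.
   Formalization: The printed sign in the formula for ∂_k S_k' is wrong (it fails on the unit circle with σ=1 and small k); the formal statement has −ik/4 in place of ik/4. The density σ, whose regularity is left open, is taken to be C^{1,α}. *)

theory Defs
  imports "HOL-Analysis.Analysis"
begin

section \<open>The free-space Green's function\<close>

text \<open>Bessel functions of order 0 by their power series at 0; the second one is used only for
  positive arguments. The summand of index 0 in the last series vanishes, as \<^term>\<open>harm 0 = 0\<close>.\<close>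

definition bessel_J0 :: "real \<Rightarrow> real" where
  "bessel_J0 z = (\<Sum>m. (-1) ^ m * (z\<^sup>2 / 4) ^ m / (fact m)\<^sup>2)"

definition bessel_Y0 :: "real \<Rightarrow> real" where
  "bessel_Y0 z = 2 / pi * (ln (z / 2) + euler_mascheroni) * bessel_J0 z
     - 2 / pi * (\<Sum>m. (-1) ^ m * harm m * (z\<^sup>2 / 4) ^ m / (fact m)\<^sup>2)"

definition hankel1_0 :: "real \<Rightarrow> complex" where
  "hankel1_0 z = Complex (bessel_J0 z) (bessel_Y0 z)"

definition green :: "real \<Rightarrow> real^2 \<Rightarrow> real^2 \<Rightarrow> complex" where
  "green k x y = \<i> / 4 * hankel1_0 (k * dist x y)"

text \<open>On signs: from \<open>H\<^sub>0' = -H\<^sub>1\<close> and \<open>(z H\<^sub>1(z))' = z H\<^sub>0(z)\<close> one gets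
  \<open>n \<cdot> \<nabla>\<^sub>x G\<^sub>k(x,y) = -(i k/4) H\<^sub>1(k r) (x - y) \<cdot> n / r\<close> with \<open>r = \<bar>x - y\<bar>\<close>, whose derivative in \<open>k\<close> is
  \<open>-(i k/4) H\<^sub>0(k r) (x - y) \<cdot> n\<close>.\<close>

section \<open>Derivatives in the plane\<close>

definition partial :: "2 \<Rightarrow> (real^2 \<Rightarrow> 'a::real_normed_vector) \<Rightarrow> real^2 \<Rightarrow> 'a" where
  "partial i f x = frechet_derivative f (at x) (axis i 1)"

text \<open>\<open>v \<cdot> \<nabla>f(x)\<close> and \<open>v\<^sup>T (\<nabla>\<^sup>2f(x)) v\<close>\<close>

definition dot_grad :: "real^2 \<Rightarrow> (real^2 \<Rightarrow> complex) \<Rightarrow> real^2 \<Rightarrow> complex" where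
  "dot_grad v f x = (\<Sum>i\<in>UNIV. of_real (v $ i) * partial i f x)"

definition hess_form :: "real^2 \<Rightarrow> (real^2 \<Rightarrow> complex) \<Rightarrow> real^2 \<Rightarrow> complex" where
  "hess_form v f x =
     (\<Sum>i\<in>UNIV. \<Sum>j\<in>UNIV. of_real (v $ i) * partial i (partial j f) x * of_real (v $ j))"

definition C2_on :: "(real^2 \<Rightarrow> real) \<Rightarrow> (real^2) set \<Rightarrow> bool" where
  "C2_on f U \<longleftrightarrow> open U
     \<and> (\<forall>x\<in>U. f differentiable (at x))
     \<and> (\<forall>i. \<forall>x\<in>U. partial i f differentiable (at x))
     \<and> (\<forall>i j. continuous_on U (partial i (partial j f)))"

definition bounded_C2_domain :: "(real^2) set \<Rightarrow> bool" where
  "bounded_C2_domain \<Omega> \<longleftrightarrow> open \<Omega> \<and> connected \<Omega> \<and> \<Omega> \<noteq> {} \<and> bounded \<Omega>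
     \<and> (\<forall>p\<in>frontier \<Omega>. \<exists>U \<rho>. p \<in> U \<and> C2_on \<rho> U
           \<and> (\<forall>x\<in>U. \<exists>i. partial i \<rho> x \<noteq> 0)
           \<and> \<Omega> \<inter> U = {x \<in> U. \<rho> x < 0})"

section \<open>Functions of the curve parameter\<close>

definition ddt :: "(real \<Rightarrow> 'a::real_normed_vector) \<Rightarrow> real \<Rightarrow> 'a" where
  "ddt f t = vector_derivative f (at t)"

definition smooth :: "(real \<Rightarrow> 'a::real_normed_vector) \<Rightarrow> bool" where
  "smooth f \<longleftrightarrow> (\<forall>m t. (ddt ^^ m) f differentiable (at t))"

text \<open>Differentiable with Hoelder continuous derivative: the usual regularity that makes
  Hadamard finite parts with a double pole exist.\<close>

definition C1_hoelder :: "(real \<Rightarrow> complex) \<Rightarrow> bool" where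
  "C1_hoelder f \<longleftrightarrow> (\<forall>t. f differentiable (at t))
     \<and> (\<exists>\<alpha> C. 0 < \<alpha> \<and> \<alpha> \<le> 1 \<and>
          (\<forall>s t. norm (ddt f s - ddt f t) \<le> C * \<bar>s - t\<bar> powr \<alpha>))"

definition tangent :: "(real \<Rightarrow> real^2) \<Rightarrow> real \<Rightarrow> real^2" where
  "tangent \<gamma> t = ddt \<gamma> t /\<^sub>R norm (ddt \<gamma> t)"

definition normal :: "(real \<Rightarrow> real^2) \<Rightarrow> real \<Rightarrow> real^2" where
  "normal \<gamma> t = vector [tangent \<gamma> t $ 2, - (tangent \<gamma> t $ 1)]"

definition curvature :: "(real \<Rightarrow> real^2) \<Rightarrow> real \<Rightarrow> real" where
  "curvature \<gamma> t =
     (ddt \<gamma> t $ 1 * ddt (ddt \<gamma>) t $ 2 - ddt \<gamma> t $ 2 * ddt (ddt \<gamma>) t $ 1) / norm (ddt \<gamma> t) ^ 3"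

text \<open>The boundary of \<open>\<Omega>\<close> is traversed once by \<open>\<gamma>\<close> on \<open>[0, L]\<close>, in the direction that makes
  \<^const>\<open>normal\<close> point out of \<open>\<Omega>\<close>. A smooth closed curve is represented by its
  \<open>L\<close>-periodic extension.\<close>

definition parametrizes_boundary :: "(real \<Rightarrow> real^2) \<Rightarrow> real \<Rightarrow> (real^2) set \<Rightarrow> bool" where
  "parametrizes_boundary \<gamma> L \<Omega> \<longleftrightarrow> 0 < L
     \<and> smooth \<gamma> \<and> (\<forall>t. \<gamma> (t + L) = \<gamma> t) \<and> (\<forall>t. ddt \<gamma> t \<noteq> 0)
     \<and> inj_on \<gamma> {0..<L} \<and> \<gamma> ` {0..L} = frontier \<Omega>
     \<and> (\<forall>t. \<forall>\<^sub>F h in at_right 0.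
           \<gamma> t + h *\<^sub>R normal \<gamma> t \<notin> \<Omega> \<and> \<gamma> t - h *\<^sub>R normal \<gamma> t \<in> \<Omega>)"

definition perturb :: "(real \<Rightarrow> real^2) \<Rightarrow> (real \<Rightarrow> real) \<Rightarrow> real \<Rightarrow> real \<Rightarrow> real^2" where
  "perturb \<gamma> \<nu> \<epsilon> t = \<gamma> t + (\<epsilon> * \<nu> t) *\<^sub>R normal \<gamma> t"

section \<open>Singular integrals over the curve\<close>

text \<open>The integrand \<open>f\<close> is given as a function of the parameter of \<open>y = \<gamma> s\<close>, the singularity is at
  \<open>x = \<gamma> t\<close>, and the cut-off removes the points \<open>y\<close> with \<open>\<bar>x - y\<bar> \<le> \<delta>\<close>.\<close>

definition truncated_integral ::
    "(real \<Rightarrow> real^2) \<Rightarrow> real \<Rightarrow> real \<Rightarrow> (real \<Rightarrow> complex) \<Rightarrow> real \<Rightarrow> complex" where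
  "truncated_integral \<gamma> L t f \<delta> =
     (LINT s:{s \<in> {0..L}. \<delta> < dist (\<gamma> t) (\<gamma> s)}|lborel. f s * of_real (norm (ddt \<gamma> s)))"

definition pv_integral ::
    "(real \<Rightarrow> real^2) \<Rightarrow> real \<Rightarrow> real \<Rightarrow> (real \<Rightarrow> complex) \<Rightarrow> complex" where
  "pv_integral \<gamma> L t f = Lim (at_right 0) (truncated_integral \<gamma> L t f)"

text \<open>For a double pole: the constant term \<open>v\<close> in the expansion \<open>c/\<delta> + v + o(1)\<close> of the truncated
  integral; \<open>c\<close> and \<open>v\<close> are unique if they exist.\<close>

definition fp_integral ::
    "(real \<Rightarrow> real^2) \<Rightarrow> real \<Rightarrow> real \<Rightarrow> (real \<Rightarrow> complex) \<Rightarrow> complex" where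
  "fp_integral \<gamma> L t f =
     (THE v. \<exists>c. ((\<lambda>\<delta>. truncated_integral \<gamma> L t f \<delta> - c / of_real \<delta>) \<longlongrightarrow> v) (at_right 0))"

definition S_prime ::
    "real \<Rightarrow> (real \<Rightarrow> real^2) \<Rightarrow> real \<Rightarrow> (real \<Rightarrow> complex) \<Rightarrow> real \<Rightarrow> complex" where
  "S_prime k \<gamma> L \<sigma> t =
     pv_integral \<gamma> L t (\<lambda>s. dot_grad (normal \<gamma> t) (\<lambda>x. green k x (\<gamma> s)) (\<gamma> t) * \<sigma> s)"

definition S_tau ::
    "real \<Rightarrow> (real \<Rightarrow> real^2) \<Rightarrow> real \<Rightarrow> (real \<Rightarrow> complex) \<Rightarrow> real \<Rightarrow> complex" where
  "S_tau k \<gamma> L \<sigma> t =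
     pv_integral \<gamma> L t (\<lambda>s. dot_grad (tangent \<gamma> t) (\<lambda>x. green k x (\<gamma> s)) (\<gamma> t) * \<sigma> s)"

definition S_second ::
    "real \<Rightarrow> (real \<Rightarrow> real^2) \<Rightarrow> real \<Rightarrow> (real \<Rightarrow> complex) \<Rightarrow> real \<Rightarrow> complex" where
  "S_second k \<gamma> L \<sigma> t =
     fp_integral \<gamma> L t (\<lambda>s. hess_form (normal \<gamma> t) (\<lambda>x. green k x (\<gamma> s)) (\<gamma> t) * \<sigma> s)"

definition D_prime ::
    "real \<Rightarrow> (real \<Rightarrow> real^2) \<Rightarrow> real \<Rightarrow> (real \<Rightarrow> complex) \<Rightarrow> real \<Rightarrow> complex" where
  "D_prime k \<gamma> L \<sigma> t =
     fp_integral \<gamma> L t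
       (\<lambda>s. dot_grad (normal \<gamma> t) (\<lambda>x. dot_grad (normal \<gamma> s) (\<lambda>y. green k x y) (\<gamma> s)) (\<gamma> t) * \<sigma> s)"

end

theory Submission
  imports Defs
begin

text \<open>Write \<open>G\<^sub>k(x,y) = g(\<bar>x - y\<bar>\<^sup>2)\<close>, where \<open>g'(u) = -1/(4\<pi>u) + O(u\<^bsup>-1/4\<^esup>)\<close> and \<open>g''(u) = O(u\<^bsup>-2\<^esup>)\<close>. On a smooth curve
  \<open>(x - y) \<bullet> n\<^sub>x = O(\<bar>x - y\<bar>\<^sup>2)\<close>, so the integrand of \<open>S'\<^bsub>k,\<epsilon>\<^esub>\<close> and its \<open>\<epsilon>\<close>-derivative are bounded
  uniformly in \<open>\<epsilon>\<close>; the principal value is a Lebesgue integral and may be differentiated under the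
  integral sign. At \<open>\<epsilon> = 0\<close> the differentiated integrand is, pointwise, the sum of the four kernels on the
  right-hand side. These are not separately integrable, but cutting out \<open>\<bar>x - y\<bar> \<le> \<delta>\<close> makes them so:
  the truncated integrals for \<open>S''\<close> and \<open>S\<^sub>\<tau>\<close> have the expansions \<open>c/\<delta> + v + o(1)\<close> and \<open>v + o(1)\<close>, and the one
  for \<open>D'\<close> then follows by subtraction. The wavenumber derivative is another differentiation under
  the integral sign, using Bessel's equation.\<close>

section \<open>The radial profile of the Green's function\<close>

text \<open>Two things move under the perturbation: the chord and the unnormalised normal at its
  base point. Each contributes a term of order h, the parameter distance, to the derivative of their
  inner product; the two linear terms cancel because a quarter turn is antisymmetric. The derivative
  is therefore O(h^2), which balances G1 = O(h^-2).

  The radial variable is the squared distance, since J_0 and the regular part of Y_0 are power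
  series in it: one explicit logarithm remains, no Hankel function of order one is introduced, and
  Bessel's equation supplies both the second radial derivative and the derivative in k.

  Integrals are recentred to |h| <= L/2, so that the singularity is interior also for t = 0 and t =
  L. The cut-off is by Euclidean distance, hence not symmetric in h; its two ends must be located to
  second order before the divergent part is seen to be a multiple of 1/\<delta>. The Hoelder
  exponent \<alpha> enters through a first-order expansion of the density at the pole; it leaves a
  remainder O(|h|^(\<alpha> - 1)), which is integrable.\<close>

definition power_sum :: "(nat \<Rightarrow> real) \<Rightarrow> real \<Rightarrow> real" where
  "power_sum c w = (\<Sum>m. c m * w ^ m)"

lemma summable_of_le_inverse_fact:
  fixes c :: "nat \<Rightarrow> real"
  assumes "\<And>m. \<bar>c m\<bar> \<le> 1 / fact m"
  shows "summable (\<lambda>m. c m * w ^ m)"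
proof (rule summable_norm_cancel, rule summable_comparison_test')
  show "summable (\<lambda>m. inverse (fact m) * \<bar>w\<bar> ^ m)" by (rule summable_exp)
  show "norm (norm (c m * w ^ m)) \<le> inverse (fact m) * \<bar>w\<bar> ^ m" if "m \<ge> 0" for m
    using assms[of m] by (simp add: abs_mult power_abs divide_inverse mult_right_mono)
qed

lemma power_sum_deriv:
  assumes "\<And>w. summable (\<lambda>m. c m * w ^ m)"
  shows "(power_sum c has_real_derivative power_sum (diffs c) w) (at w)"
  using termdiffs_strong_converges_everywhere[OF assms] unfolding power_sum_def[abs_def] by simp

lemma summable_diffs:
  fixes c :: "nat \<Rightarrow> real"
  assumes "\<And>w. summable (\<lambda>m. c m * w ^ m)"
  shows "summable (\<lambda>m. diffs c m * w ^ m)"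
  using termdiff_converges_all assms by blast

lemma power_sum_euler:
  fixes c :: "nat \<Rightarrow> real"
  assumes "\<And>w. summable (\<lambda>m. c m * w ^ m)"
  shows "(\<lambda>m. (of_nat m * c m) * w ^ m) sums (w * power_sum (diffs c) w)"
proof -
  have "(\<lambda>n. w * (of_nat n * c n * w ^ (n - Suc 0))) sums (w * (\<Sum>n. diffs c n * w ^ n))"
    by (intro sums_mult diffs_equiv summable_diffs assms)
  moreover have "w * (of_nat n * c n * w ^ (n - Suc 0)) = (of_nat n * c n) * w ^ n" for n
    by (cases n) auto
  ultimately show ?thesis by (simp add: power_sum_def)
qed

text \<open>The Euler operator w d/dw multiplies the m-th coefficient by m; one more derivative
  multiplies again and shifts. The result is the operator of Bessel's equation in w = z^2, so the
  equation can be read off from a two-term recursion.\<close>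

lemma power_sum_euler_deriv:
  fixes c :: "nat \<Rightarrow> real"
  assumes "\<And>w. summable (\<lambda>m. c m * w ^ m)"
  shows "((\<lambda>w. w * power_sum (diffs c) w) has_real_derivative
           power_sum (\<lambda>m. of_nat (Suc m) ^ 2 * c (Suc m)) w) (at w)"
proof -
  have s: "summable (\<lambda>m. (of_nat m * c m) * w ^ m)" for w
    using power_sum_euler[OF assms] by (rule sums_summable)
  have "(power_sum (\<lambda>m. of_nat m * c m)) = (\<lambda>w. w * power_sum (diffs c) w)"
    using sums_unique[OF power_sum_euler[OF assms]] by (simp add: power_sum_def fun_eq_iff)
  moreover have "diffs (\<lambda>m. of_nat m * c m) = (\<lambda>m. of_nat (Suc m) ^ 2 * c (Suc m))"
    by (simp add: diffs_def fun_eq_iff power2_eq_square)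
  ultimately show ?thesis
    using power_sum_deriv[OF s, of w] by simp
qed

section \<open>Bessel's equation in the variable w = z^2\<close>

definition J_coeff :: "nat \<Rightarrow> real" where
  "J_coeff m = (-1) ^ m / (4 ^ m * (fact m)\<^sup>2)"

definition Y_coeff :: "nat \<Rightarrow> real" where
  "Y_coeff m = harm m * J_coeff m"

text \<open>One of the two factorials in the denominator of \<open>J_coeff\<close> can be spent on
  the harmonic number, so the crude chain H_m <= m <= m! suffices for convergence.\<close>

lemma harm_le_fact: "harm m \<le> (fact m :: real)"
proof (cases m)
  case 0 then show ?thesis by (simp add: harm_def)
next
  case (Suc n)
  have "harm m \<le> (\<Sum>k=1..m. (1::real))"
    unfolding harm_def by (rule sum_mono) (auto simp: inverse_eq_divide)
  also have "\<dots> = of_nat m" by simp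
  also have "\<dots> \<le> of_nat (fact m)" by (rule of_nat_mono) (rule fact_ge_self)
  also have "\<dots> = (fact m :: real)" by (rule of_nat_fact)
  finally show ?thesis .
qed

lemma abs_J_coeff: "\<bar>J_coeff m\<bar> \<le> 1 / (fact m)\<^sup>2"
proof -
  have "(fact m)\<^sup>2 \<le> (4 ^ m * (fact m)\<^sup>2 :: real)"
    using mult_right_mono[of 1 "4 ^ m" "(fact m)\<^sup>2 :: real"] by simp
  then have "1 / (4 ^ m * (fact m)\<^sup>2) \<le> 1 / (fact m :: real)\<^sup>2"
    by (intro divide_left_mono) auto
  then show ?thesis by (simp add: J_coeff_def abs_mult power_abs)
qed

lemma summable_J: "summable (\<lambda>m. J_coeff m * w ^ m)"
proof (rule summable_of_le_inverse_fact)
  fix m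
  have "1 / (fact m)\<^sup>2 \<le> 1 / (fact m :: real)"
    by (rule divide_left_mono) (auto simp: power2_eq_square)
  then show "\<bar>J_coeff m\<bar> \<le> 1 / fact m" using abs_J_coeff[of m] by linarith
qed

lemma summable_Y: "summable (\<lambda>m. Y_coeff m * w ^ m)"
proof (rule summable_of_le_inverse_fact)
  fix m
  have "\<bar>Y_coeff m\<bar> \<le> fact m * (1 / (fact m)\<^sup>2)"
    unfolding Y_coeff_def abs_mult
    by (intro mult_mono abs_J_coeff) (auto simp: harm_le_fact harm_nonneg)
  then show "\<bar>Y_coeff m\<bar> \<le> 1 / fact m" by (simp add: power2_eq_square)
qed

abbreviation "J_ps \<equiv> power_sum J_coeff"
abbreviation "J_ps' \<equiv> power_sum (diffs J_coeff)"
abbreviation "Y_ps \<equiv> power_sum Y_coeff"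
abbreviation "Y_ps' \<equiv> power_sum (diffs Y_coeff)"

text \<open>This recursion is Bessel's equation on coefficients: with
  \<open>power_sum_euler_deriv\<close> it says (w J')' = -J/4.\<close>

lemma J_coeff_Suc: "of_nat (Suc m) ^ 2 * J_coeff (Suc m) = - J_coeff m / 4"
  by (simp add: J_coeff_def power2_eq_square divide_simps del: of_nat_Suc)

lemma J_ps_ode: "((\<lambda>w. w * J_ps' w) has_real_derivative - J_ps w / 4) (at w)"
proof -
  have "power_sum (\<lambda>m. of_nat (Suc m) ^ 2 * J_coeff (Suc m)) w = (\<Sum>m. (-1/4) * (J_coeff m * w ^ m))"
    unfolding J_coeff_Suc by (simp add: power_sum_def)
  also have "\<dots> = (-1/4) * J_ps w" unfolding power_sum_def by (rule suminf_mult[OF summable_J])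
  finally show ?thesis using power_sum_euler_deriv[OF summable_J, of w] by simp
qed

text \<open>The extra term J' comes from H_(m+1) = H_m + 1/(m+1); it compensates what the logarithm
  in \<open>psi_Y\<close> produces.\<close>

lemma Y_ps_ode: "((\<lambda>w. w * Y_ps' w) has_real_derivative - Y_ps w / 4 + J_ps' w) (at w)"
proof -
  have *: "of_nat (Suc m) ^ 2 * Y_coeff (Suc m) = - Y_coeff m / 4 + diffs J_coeff m" for m
  proof -
    have "of_nat (Suc m) ^ 2 * Y_coeff (Suc m) = harm (Suc m) * (- J_coeff m / 4)"
      unfolding Y_coeff_def J_coeff_Suc[symmetric] by simp
    also have "\<dots> = - Y_coeff m / 4 + inverse (of_nat (Suc m)) * (of_nat (Suc m) ^ 2 * J_coeff (Suc m))"
      unfolding J_coeff_Suc harm_Suc by (simp add: Y_coeff_def algebra_simps)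
    also have "inverse (of_nat (Suc m)) * (of_nat (Suc m) ^ 2 * J_coeff (Suc m)) = diffs J_coeff m"
      by (simp add: diffs_def power2_eq_square del: of_nat_Suc)
    finally show ?thesis .
  qed
  have "power_sum (\<lambda>m. of_nat (Suc m) ^ 2 * Y_coeff (Suc m)) w
      = (\<Sum>m. (-1/4) * (Y_coeff m * w ^ m) + diffs J_coeff m * w ^ m)"
    unfolding * by (simp add: power_sum_def algebra_simps)
  also have "\<dots> = (-1/4) * Y_ps w + J_ps' w"
    unfolding power_sum_def suminf_mult[OF summable_Y, symmetric]
    by (rule suminf_add[symmetric]) (intro summable_mult summable_Y summable_diffs summable_J)+
  finally show ?thesis using power_sum_euler_deriv[OF summable_Y, of w] by simp
qed

text \<open>Y_0 as a function of w = z^2; \<open>ln w / 2 - ln 2\<close> is ln (z/2).\<close>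

definition psi_Y :: "real \<Rightarrow> real" where
  "psi_Y w = 2 / pi * ((ln w / 2 - ln 2 + euler_mascheroni) * J_ps w - Y_ps w)"

definition psi_Y' :: "real \<Rightarrow> real" where
  "psi_Y' w = 2 / pi * (J_ps w / (2 * w) + (ln w / 2 - ln 2 + euler_mascheroni) * J_ps' w - Y_ps' w)"

text \<open>\<open>psi w = i/4 H\<^sub>0(\<surd>w)\<close>, so that \<open>G\<^sub>k(x,y) = psi (k\<^sup>2 \<bar>x - y\<bar>\<^sup>2)\<close>; Bessel's equation becomes
  \<open>(w psi'(w))' = -psi(w)/4\<close>.\<close>

definition psi :: "real \<Rightarrow> complex" where
  "psi w = \<i> / 4 * (of_real (J_ps w) + \<i> * of_real (psi_Y w))"

definition psi' :: "real \<Rightarrow> complex" where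
  "psi' w = \<i> / 4 * (of_real (J_ps' w) + \<i> * of_real (psi_Y' w))"

text \<open>Bessel's equation solved for the second derivative, so that its size follows from the
  bounds for \<open>psi\<close> and \<open>psi'\<close>.\<close>

definition psi'' :: "real \<Rightarrow> complex" where
  "psi'' w = - (psi w / 4 + psi' w) / of_real w"

lemma hankel1_0_sqrt:
  assumes "w > 0"
  shows "\<i> / 4 * hankel1_0 (sqrt w) = psi w"
proof -
  have J: "bessel_J0 (sqrt w) = J_ps w"
    using assms by (simp add: bessel_J0_def power_sum_def J_coeff_def power_divide)
  have Y: "(\<Sum>m. (-1) ^ m * harm m * (w / 4) ^ m / (fact m)\<^sup>2) = Y_ps w"
    by (simp add: power_sum_def J_coeff_def Y_coeff_def power_divide field_simps)
  have l: "ln (sqrt w / 2) = ln w / 2 - ln 2"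
    using assms by (simp add: ln_div ln_sqrt)
  have sq: "(sqrt w)\<^sup>2 = w" using assms by simp
  have "bessel_Y0 (sqrt w) = psi_Y w"
    unfolding bessel_Y0_def J psi_Y_def l sq Y by (simp add: algebra_simps)
  then show ?thesis
    unfolding hankel1_0_def psi_def J by (simp add: Complex_eq)
qed

lemma psi_Y_deriv:
  assumes "w > 0"
  shows "(psi_Y has_real_derivative psi_Y' w) (at w)"
proof -
  note [derivative_intros] = power_sum_deriv[OF summable_J] power_sum_deriv[OF summable_Y]
  show ?thesis
    unfolding psi_Y_def[abs_def] psi_Y'_def
    by (rule derivative_eq_intros refl assms | simp add: field_simps)+
qed

text \<open>J'/2 arises twice, from the summand J/2 and from differentiating the factor ln w / 2;
  together these cancel the J' of \<open>Y_ps_ode\<close>.\<close>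

lemma psi_Y_ode:
  assumes "w > 0"
  shows "((\<lambda>w. w * psi_Y' w) has_real_derivative - psi_Y w / 4) (at w)"
proof -
  have "((\<lambda>w. 2 / pi * (J_ps w / 2 + (ln w / 2 - ln 2 + euler_mascheroni) * (w * J_ps' w) - w * Y_ps' w))
     has_real_derivative - psi_Y w / 4) (at w)"
    unfolding psi_Y_def using assms
    by - (rule derivative_eq_intros power_sum_deriv[OF summable_J] J_ps_ode Y_ps_ode refl assms |
        simp add: field_simps)+
  then show ?thesis
    by (rule has_field_derivative_transform_within_open[where S="{0<..}"])
       (use assms in \<open>auto simp: psi_Y'_def field_simps\<close>)
qed

lemma psi_deriv:
  assumes "w > 0"
  shows "(psi has_vector_derivative psi' w) (at w)"
  unfolding psi_def[abs_def] psi'_def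
  by (intro has_vector_derivative_mult_right has_vector_derivative_add has_vector_derivative_of_real
      power_sum_deriv[OF summable_J] psi_Y_deriv[OF assms])

lemma psi'_euler:
  assumes "w > 0"
  shows "((\<lambda>w. of_real w * psi' w) has_vector_derivative - psi w / 4) (at w)"
proof -
  have "((\<lambda>w. \<i> / 4 * (of_real (w * J_ps' w) + \<i> * of_real (w * psi_Y' w))) has_vector_derivative
     \<i> / 4 * (of_real (- J_ps w / 4) + \<i> * of_real (- psi_Y w / 4))) (at w)"
    by (intro has_vector_derivative_mult_right has_vector_derivative_add has_vector_derivative_of_real
        J_ps_ode psi_Y_ode[OF assms])
  moreover have "\<i> / 4 * (of_real (- J_ps w / 4) + \<i> * of_real (- psi_Y w / 4)) = - psi w / 4"
    by (simp add: psi_def field_simps)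
  moreover have "\<i> / 4 * (of_real (w * J_ps' w) + \<i> * of_real (w * psi_Y' w)) = of_real w * psi' w" for w
    by (simp add: psi'_def algebra_simps)
  ultimately show ?thesis by (simp only:)
qed

lemma psi'_deriv:
  assumes "w > 0"
  shows "(psi' has_vector_derivative psi'' w) (at w)"
proof -
  have "((\<lambda>w. (1 / w) *\<^sub>R (of_real w * psi' w)) has_vector_derivative
      (1 / w) *\<^sub>R (- psi w / 4) + (- (1 / w\<^sup>2)) *\<^sub>R (of_real w * psi' w)) (at w)"
    by (rule derivative_eq_intros psi'_euler[OF assms] refl | use assms in \<open>simp add: power2_eq_square\<close>)+
  moreover have "(1 / w) *\<^sub>R (- psi w / 4) + (- (1 / w\<^sup>2)) *\<^sub>R (of_real w * psi' w) = psi'' w"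
    using assms by (simp add: psi''_def scaleR_conv_of_real field_simps power2_eq_square)
  ultimately have "((\<lambda>w. (1 / w) *\<^sub>R (of_real w * psi' w)) has_vector_derivative psi'' w) (at w)"
    by simp
  then show ?thesis
    using assms
    by (elim has_vector_derivative_transform_within_open[where S="{0<..}"])
       (auto simp: scaleR_conv_of_real)
qed

section \<open>Behaviour of the radial profile at the singularity\<close>

text \<open>Near 0 only the logarithm and the term J/(2w) are unbounded. As J equals 1 at 0, the
  latter contributes (i/4) i (2/pi) / (2w) = -1/(4 pi w), the pole that is split off. The logarithm
  is absorbed in w^(-1/4): with w of order h^2 this is of order |h|^(-1/2), which is
  integrable.\<close>

lemma psi_bounds:
  assumes "W > 0"
  obtains C where "\<And>w. 0 < w \<Longrightarrow> w \<le> W \<Longrightarrow> norm (psi w) \<le> C * w powr (-1/4)"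
    and "\<And>w. 0 < w \<Longrightarrow> w \<le> W \<Longrightarrow> norm (psi' w + of_real (1 / (4 * pi * w))) \<le> C * w powr (-1/4)"
proof -
  have dJ': "power_sum (diffs J_coeff) field_differentiable (at w)"
    and dY': "power_sum (diffs Y_coeff) field_differentiable (at w)" for w
    using power_sum_deriv[OF summable_diffs[OF summable_J]] power_sum_deriv[OF summable_diffs[OF summable_Y]]
    by (auto simp: field_differentiable_def)
  have dJ: "J_ps field_differentiable (at w)" and dY: "Y_ps field_differentiable (at w)" for w
    using power_sum_deriv[OF summable_J] power_sum_deriv[OF summable_Y]
    by (auto simp: field_differentiable_def)
  have bdd: "\<exists>B. \<forall>w\<in>{0..W}. \<bar>f w\<bar> \<le> B" if "\<And>w. f field_differentiable (at w)" for f :: "real \<Rightarrow> real"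
  proof -
    have "continuous_on {0..W} f"
      using that by (intro continuous_at_imp_continuous_on ballI field_differentiable_imp_continuous_at)
    then have "bounded (f ` {0..W})" by (intro compact_imp_bounded compact_continuous_image) auto
    then show ?thesis by (auto simp: bounded_iff)
  qed
  from bdd[OF dJ] bdd[OF dJ'] bdd[OF dY] bdd[OF dY'] obtain B1 B2 B3 B4 where
    B: "\<forall>w\<in>{0..W}. \<bar>J_ps w\<bar> \<le> B1" "\<forall>w\<in>{0..W}. \<bar>J_ps' w\<bar> \<le> B2"
       "\<forall>w\<in>{0..W}. \<bar>Y_ps w\<bar> \<le> B3" "\<forall>w\<in>{0..W}. \<bar>Y_ps' w\<bar> \<le> B4" by blast
  define M where "M = B1 + B2 + B3 + B4"
  have nn: "0 \<le> B1" "0 \<le> B2" "0 \<le> B3" "0 \<le> B4"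
    using B assms by (auto dest!: bspec[where x=0])
  have M: "\<bar>J_ps w\<bar> \<le> M" "\<bar>J_ps' w\<bar> \<le> M" "\<bar>Y_ps w\<bar> \<le> M" "\<bar>Y_ps' w\<bar> \<le> M"
    if "0 \<le> w" "w \<le> W" for w
    using that B nn unfolding M_def by (auto dest!: bspec[where x=w])
  have "M \<ge> 0" using nn by (simp add: M_def)
  have J0: "\<bar>(J_ps w - 1) / w\<bar> \<le> M" if w: "0 < w" "w \<le> W" for w
  proof -
    have "J_ps 0 = 1" unfolding power_sum_def powser_zero by (simp add: J_coeff_def)
    moreover have "norm (J_ps w - J_ps 0) \<le> M * norm (w - 0)"
    proof (rule field_differentiable_bound[of "{0..W}"])
      show "(J_ps has_field_derivative J_ps' z) (at z within {0..W})" for z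
        using power_sum_deriv[OF summable_J] by (rule has_field_derivative_at_within)
    qed (use w M in auto)
    ultimately show ?thesis using w by (simp add: abs_mult divide_simps)
  qed
  define c where "c = \<bar>euler_mascheroni - ln (2::real)\<bar>"
  have "c \<ge> 0" by (simp add: c_def)
  define e where "e w = w powr (-1/4)" for w :: real
  \<comment> \<open>The 4 comes from ln x <= x^(1/4) / (1/4) with x = 1/w, used for w <= 1; the
    second summand covers 1 < w <= W, where ln w <= w <= W and \<open>one_le\<close>
    applies.\<close>
  define K where "K = 4 + W * W powr (1/4)"
  have one_le: "1 \<le> W powr (1/4) * e w" if w: "0 < w" "w \<le> W" for w
  proof -
    have "1 = w powr (1/4) * e w" using w by (simp add: e_def flip: powr_add)
    also have "\<dots> \<le> W powr (1/4) * e w"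
      using w by (intro mult_right_mono powr_mono2) (auto simp: e_def)
    finally show ?thesis .
  qed
  have ln_le: "\<bar>ln w\<bar> \<le> K * e w" if w: "0 < w" "w \<le> W" for w
  proof (cases "w \<le> 1")
    case True
    have "ln (1 / w) \<le> (1 / w) powr (1/4) / (1/4)" by (rule ln_powr_bound) (use True w in auto)
    also have "\<dots> = 4 * e w" using w by (simp add: e_def powr_divide powr_minus_divide)
    also have "\<dots> \<le> K * e w" using assms by (intro mult_right_mono) (auto simp: K_def e_def)
    finally show ?thesis using True w by (simp add: ln_div)
  next
    case False
    have "\<bar>ln w\<bar> \<le> w" using False ln_le_minus_one[of w] by simp
    also have "w \<le> W * 1" using w by simp
    also have "\<dots> \<le> W * (W powr (1/4) * e w)"
      using one_le[OF w] assms by (intro mult_left_mono) auto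
    also have "\<dots> \<le> K * e w" by (simp add: K_def e_def algebra_simps)
    finally show ?thesis .
  qed
  \<comment> \<open>Both estimates reduce to (|ln w| + c) M plus at most 3 M; the 5 leaves room, and
    \<open>one_le\<close> turns constants into multiples of w^(-1/4).\<close>
  define C where "C = (5 + c) * M * W powr (1/4) + M * K"
  have pi: "2 / pi * x \<le> x" if "x \<ge> 0" for x :: real
    using that pi_gt3 mult_right_mono[of "2/pi" 1 x] by simp
  have L: "\<bar>(ln w / 2 - ln 2 + euler_mascheroni) * x\<bar> \<le> (\<bar>ln w\<bar> + c) * M" if "\<bar>x\<bar> \<le> M" for w x :: real
    unfolding abs_mult using that by (intro mult_mono) (auto simp: c_def)
  have fin: "(\<bar>ln w\<bar> + c) * M + 5 * M \<le> C * e w" if w: "0 < w" "w \<le> W" for w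
  proof -
    have "(\<bar>ln w\<bar> + c) * M + 5 * M = (5 + c) * M * 1 + M * \<bar>ln w\<bar>" by (simp add: algebra_simps)
    also have "\<dots> \<le> (5 + c) * M * (W powr (1/4) * e w) + M * (K * e w)"
      using \<open>M \<ge> 0\<close> \<open>c \<ge> 0\<close> one_le[OF w] ln_le[OF w] by (intro add_mono mult_left_mono) auto
    also have "\<dots> = C * e w" by (simp add: C_def algebra_simps)
    finally show ?thesis .
  qed
  have tri: "\<bar>a / 2 + b - d\<bar> \<le> x + y + z" if "\<bar>a\<bar> \<le> x" "\<bar>b\<bar> \<le> y" "\<bar>d\<bar> \<le> z" for a b d x y z :: real
    using that by linarith
  have n: "norm (\<i> / 4 * (of_real a + \<i> * of_real b)) \<le> \<bar>a\<bar> + \<bar>b\<bar>" for a b :: real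
  proof -
    have "norm (\<i> / 4 * (of_real a + \<i> * of_real b)) = norm (of_real a + \<i> * of_real b) / 4"
      by (simp add: norm_mult norm_divide)
    also have "\<dots> \<le> (\<bar>a\<bar> + \<bar>b\<bar>) / 4"
      by (intro divide_right_mono order_trans[OF norm_triangle_ineq]) (auto simp: norm_mult)
    finally show ?thesis by simp
  qed
  show ?thesis
  proof
    fix w :: real assume w: "0 < w" "w \<le> W"
    note Mw = M[of w, OF less_imp_le[OF w(1)] w(2)]
    have "\<bar>psi_Y w\<bar> = 2 / pi * \<bar>(ln w / 2 - ln 2 + euler_mascheroni) * J_ps w - Y_ps w\<bar>"
      by (subst psi_Y_def, subst abs_mult) simp
    also have "\<dots> \<le> (\<bar>ln w\<bar> + c) * M + M"
      using L[OF Mw(1), of w] Mw(3) by (intro order_trans[OF pi]) auto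
    finally have "norm (psi w) \<le> M + ((\<bar>ln w\<bar> + c) * M + M)"
      unfolding psi_def using Mw by (intro order_trans[OF n]) auto
    then show "norm (psi w) \<le> C * w powr (-1/4)"
      using fin[OF w] \<open>M \<ge> 0\<close> by (simp add: e_def)
    \<comment> \<open>This is \<open>psi_Y'\<close> without its pole: J/(2w) is replaced by (J -
      1)/(2w), which is bounded by the mean value estimate \<open>J0\<close>.\<close>
    define y where "y = 2 / pi * ((J_ps w - 1) / w / 2 + (ln w / 2 - ln 2 + euler_mascheroni) * J_ps' w - Y_ps' w)"
    have "psi' w + of_real (1 / (4 * pi * w)) = \<i> / 4 * (of_real (J_ps' w) + \<i> * of_real y)"
      using w by (simp add: psi'_def psi_Y'_def y_def field_simps)
    moreover have "\<bar>y\<bar> \<le> M + (\<bar>ln w\<bar> + c) * M + M"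
    proof -
      have "\<bar>y\<bar> = 2 / pi * \<bar>(J_ps w - 1) / w / 2 + (ln w / 2 - ln 2 + euler_mascheroni) * J_ps' w - Y_ps' w\<bar>"
        by (subst y_def, subst abs_mult) simp
      also have "\<dots> \<le> M + (\<bar>ln w\<bar> + c) * M + M"
        using tri[OF J0[OF w] L[OF Mw(2), of w] Mw(4)] by (intro order_trans[OF pi]) auto
      finally show ?thesis .
    qed
    ultimately have "norm (psi' w + of_real (1 / (4 * pi * w))) \<le> M + (M + (\<bar>ln w\<bar> + c) * M + M)"
      using Mw by (simp only:) (intro order_trans[OF n], auto)
    then show "norm (psi' w + of_real (1 / (4 * pi * w))) \<le> C * w powr (-1/4)"
      using fin[OF w] \<open>M \<ge> 0\<close> by (simp add: e_def)
  qed
qed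

text \<open>The first two derivatives of \<open>u \<mapsto> psi (k\<^sup>2 u)\<close>.\<close>

definition G1 :: "real \<Rightarrow> real \<Rightarrow> complex" where
  "G1 k u = of_real (k\<^sup>2) * psi' (k\<^sup>2 * u)"

definition G2 :: "real \<Rightarrow> real \<Rightarrow> complex" where
  "G2 k u = of_real (k ^ 4) * psi'' (k\<^sup>2 * u)"

lemma psi_radial_deriv:
  assumes "k > 0" "u > 0"
  shows "((\<lambda>u. psi (k\<^sup>2 * u)) has_vector_derivative G1 k u) (at u)"
proof -
  have "(psi \<circ> (\<lambda>u. k\<^sup>2 * u) has_vector_derivative k\<^sup>2 *\<^sub>R psi' (k\<^sup>2 * u)) (at u)"
    by (rule vector_diff_chain_at) (use assms in \<open>auto intro!: derivative_eq_intros psi_deriv\<close>)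
  then show ?thesis by (simp add: o_def G1_def scaleR_conv_of_real)
qed

lemma G1_deriv:
  assumes "k > 0" "u > 0"
  shows "(G1 k has_vector_derivative G2 k u) (at u)"
proof -
  have "(psi' \<circ> (\<lambda>u. k\<^sup>2 * u) has_vector_derivative k\<^sup>2 *\<^sub>R psi'' (k\<^sup>2 * u)) (at u)"
    by (rule vector_diff_chain_at) (use assms in \<open>auto intro!: derivative_eq_intros psi'_deriv\<close>)
  then have "((\<lambda>u. of_real (k\<^sup>2) * psi' (k\<^sup>2 * u)) has_vector_derivative of_real (k\<^sup>2) * (k\<^sup>2 *\<^sub>R psi'' (k\<^sup>2 * u))) (at u)"
    unfolding o_def by (rule has_vector_derivative_mult_right)
  then show ?thesis by (simp add: G1_def[abs_def] G2_def scaleR_conv_of_real power_numeral_reduce mult_ac)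
qed

text \<open>With w = k^2 u, \<open>G1 k u\<close> is w psi'(w) divided by u, so Bessel's equation
  differentiates it in closed form and only \<open>psi\<close> itself remains.\<close>

lemma G1_wavenumber_deriv:
  assumes "k > 0" "u > 0"
  shows "((\<lambda>k. G1 k u) has_vector_derivative - (of_real (k / 2) * psi (k\<^sup>2 * u))) (at k)"
proof -
  have "((\<lambda>w. of_real w * psi' w) \<circ> (\<lambda>k. k\<^sup>2 * u) has_vector_derivative (2 * k * u) *\<^sub>R (- psi (k\<^sup>2 * u) / 4)) (at k)"
  proof (rule vector_diff_chain_at)
    show "((\<lambda>k. k\<^sup>2 * u) has_vector_derivative 2 * k * u) (at k)"
      by (auto intro!: derivative_eq_intros simp flip: has_real_derivative_iff_has_vector_derivative)
    show "((\<lambda>w. of_real w * psi' w) has_vector_derivative - psi (k\<^sup>2 * u) / 4) (at (k\<^sup>2 * u))"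
      by (rule psi'_euler) (use assms in simp)
  qed
  then have "((\<lambda>k. of_real (1 / u) * (of_real (k\<^sup>2 * u) * psi' (k\<^sup>2 * u))) has_vector_derivative
     of_real (1 / u) * ((2 * k * u) *\<^sub>R (- psi (k\<^sup>2 * u) / 4))) (at k)"
    unfolding o_def by (rule has_vector_derivative_mult_right)
  moreover have "of_real (1 / u) * ((2 * k * u) *\<^sub>R (- psi (k\<^sup>2 * u) / 4)) = - (of_real (k / 2) * psi (k\<^sup>2 * u))"
    using assms by (simp add: scaleR_conv_of_real field_simps)
  moreover have "(\<lambda>k. of_real (1 / u) * (of_real (k\<^sup>2 * u) * psi' (k\<^sup>2 * u))) = (\<lambda>k. G1 k u)"
    using assms by (simp add: G1_def fun_eq_iff field_simps)
  ultimately show ?thesis by (simp only:)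
qed

lemma powr_quarter_le:
  fixes w :: real
  assumes "0 < w" "w \<le> W"
  shows "w powr (-1/4) \<le> W powr (3/4) / w"
proof -
  have "w powr (-1/4) = w powr (3/4) / w"
    using assms powr_diff[of w "3/4" 1] by simp
  also have "\<dots> \<le> W powr (3/4) / w" using assms by (intro divide_right_mono powr_mono2) auto
  finally show ?thesis .
qed

text \<open>The weak bound 1/w is enough wherever \<open>psi\<close> is multiplied by a factor of
  order h^2, and it is easier to combine with lower bounds on the chord.\<close>

lemma psi_inverse_bound:
  assumes "W > 0"
  obtains C where "C \<ge> 0" "\<And>w. 0 < w \<Longrightarrow> w \<le> W \<Longrightarrow> norm (psi w) \<le> C / w"
proof -
  from psi_bounds[OF assms] obtain C where
    C: "\<And>w. 0 < w \<Longrightarrow> w \<le> W \<Longrightarrow> norm (psi w) \<le> C * w powr (-1/4)" by blast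
  have "0 \<le> C * W powr (-1/4)" using norm_ge_zero C[of W] assms by (meson order.trans order_refl)
  then have "C \<ge> 0" using assms by (simp add: zero_le_mult_iff)
  show ?thesis
  proof
    show "C * W powr (3/4) \<ge> 0" using \<open>C \<ge> 0\<close> by simp
    fix w assume w: "0 < w" "w \<le> W"
    have "norm (psi w) \<le> C * (W powr (3/4) / w)"
      using C[OF w] mult_left_mono[OF powr_quarter_le[OF w] \<open>C \<ge> 0\<close>] by linarith
    then show "norm (psi w) \<le> C * W powr (3/4) / w" by simp
  qed
qed

text \<open>The first bound keeps the exact coefficient of the pole and feeds the finite-part
  expansions; the two cruder ones serve the boundedness estimates, where only the order in h
  counts.\<close>

lemma G_bounds:
  assumes "k > 0" "U > 0"
  obtains C where "C \<ge> 0"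
    and "\<And>u. 0 < u \<Longrightarrow> u \<le> U \<Longrightarrow> norm (G1 k u + of_real (1 / (4 * pi * u))) \<le> C * u powr (-1/4)"
    and "\<And>u. 0 < u \<Longrightarrow> u \<le> U \<Longrightarrow> norm (G1 k u) \<le> C / u"
    and "\<And>u. 0 < u \<Longrightarrow> u \<le> U \<Longrightarrow> norm (G2 k u) \<le> C / u\<^sup>2"
proof -
  define W where "W = k\<^sup>2 * U"
  have "W > 0" using assms by (simp add: W_def)
  from psi_bounds[OF this] obtain C where
    C: "\<And>w. 0 < w \<Longrightarrow> w \<le> W \<Longrightarrow> norm (psi w) \<le> C * w powr (-1/4)"
       "\<And>w. 0 < w \<Longrightarrow> w \<le> W \<Longrightarrow> norm (psi' w + of_real (1 / (4 * pi * w))) \<le> C * w powr (-1/4)" by blast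
  have "0 \<le> C * W powr (-1/4)" using norm_ge_zero C(1)[of W] \<open>W > 0\<close> by (meson order.trans order_refl)
  then have "C \<ge> 0" using \<open>W > 0\<close> by (simp add: zero_le_mult_iff)
  define D where "D = C * W powr (3/4)"
  have "D \<ge> 0" using \<open>C \<ge> 0\<close> by (simp add: D_def)
  have D: "C * w powr (-1/4) \<le> D / w" if w: "0 < w" "w \<le> W" for w
    using mult_left_mono[OF powr_quarter_le[OF w] \<open>C \<ge> 0\<close>] by (simp add: D_def)
  have p': "norm (psi' w) \<le> (D + 1) / w" if w: "0 < w" "w \<le> W" for w
  proof -
    have "norm (psi' w) \<le> norm (psi' w + of_real (1 / (4 * pi * w))) + norm (of_real (1 / (4 * pi * w)) :: complex)"
      using norm_triangle_ineq4[of "psi' w + of_real (1 / (4 * pi * w))" "of_real (1 / (4 * pi * w))"] by simp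
    also have "\<dots> \<le> D / w + 1 / (4 * pi * w)"
      using C(2)[OF w] D[OF w] w by (intro add_mono) (auto simp: norm_divide norm_mult)
    also have "1 / (4 * pi * w) \<le> 1 / w"
      using w pi_gt3 by (intro divide_left_mono) auto
    finally show ?thesis by (simp add: add_divide_distrib)
  qed
  have p'': "norm (psi'' w) \<le> (2 * D + 1) / w\<^sup>2" if w: "0 < w" "w \<le> W" for w
  proof -
    have "norm (psi w / 4 + psi' w) \<le> D / w + (D + 1) / w"
      using norm_triangle_ineq[of "psi w / 4" "psi' w"] p'[OF w] C(1)[OF w] D[OF w]
        norm_divide[of "psi w" 4] by simp (use norm_ge_zero[of "psi w"] in linarith)
    then have "norm (psi'' w) \<le> (D / w + (D + 1) / w) / w"
      unfolding psi''_def norm_divide norm_minus_cancel using w by (simp add: divide_right_mono)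
    also have "\<dots> = (2 * D + 1) / w\<^sup>2" using w by (simp add: field_simps power2_eq_square)
    finally show ?thesis .
  qed
  have kk: "0 < k\<^sup>2 * u" "k\<^sup>2 * u \<le> W" if "0 < u" "u \<le> U" for u
    using that assms by (auto simp: W_def mult_left_mono)
  define E where "E = k\<^sup>2 * (k\<^sup>2) powr (-1/4) * C + (2 * D + 1)"
  have E0: "k\<^sup>2 * (k\<^sup>2) powr (-1/4) * C \<ge> 0" using \<open>C \<ge> 0\<close> by simp
  show ?thesis
  proof
    show "E \<ge> 0" using \<open>D \<ge> 0\<close> E0 by (simp add: E_def)
    fix u :: real assume u: "0 < u" "u \<le> U"
    have "G1 k u + of_real (1 / (4 * pi * u)) = of_real (k\<^sup>2) * (psi' (k\<^sup>2 * u) + of_real (1 / (4 * pi * (k\<^sup>2 * u))))"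
      using assms u by (simp add: G1_def field_simps)
    then have "norm (G1 k u + of_real (1 / (4 * pi * u))) \<le> k\<^sup>2 * (C * (k\<^sup>2 * u) powr (-1/4))"
      using C(2)[OF kk[OF u]] by (simp only: norm_mult) (auto intro: mult_left_mono simp: norm_power)
    also have "\<dots> = (k\<^sup>2 * (k\<^sup>2) powr (-1/4) * C) * u powr (-1/4)"
      using u by (simp add: powr_mult)
    also have "\<dots> \<le> E * u powr (-1/4)" using \<open>D \<ge> 0\<close> by (intro mult_right_mono) (auto simp: E_def)
    finally show "norm (G1 k u + of_real (1 / (4 * pi * u))) \<le> E * u powr (-1/4)" .
    have "norm (G1 k u) \<le> k\<^sup>2 * ((D + 1) / (k\<^sup>2 * u))"
      unfolding G1_def norm_mult norm_of_real abs_power2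
      by (rule mult_left_mono[OF p'[OF kk[OF u]]]) simp
    also have "\<dots> = (D + 1) / u" using assms by simp
    also have "\<dots> \<le> E / u" using u E0 \<open>D \<ge> 0\<close> by (intro divide_right_mono) (auto simp: E_def)
    finally show "norm (G1 k u) \<le> E / u" .
    have "norm (G2 k u) \<le> k ^ 4 * ((2 * D + 1) / (k\<^sup>2 * u)\<^sup>2)"
    proof -
      have "norm (of_real (k ^ 4) :: complex) = k ^ 4" by (simp add: norm_power)
      then show ?thesis
        unfolding G2_def norm_mult by (simp only:) (rule mult_left_mono[OF p''[OF kk[OF u]]], simp)
    qed
    also have "\<dots> = (2 * D + 1) / u\<^sup>2" using assms by (simp add: power_mult_distrib flip: power_mult)
    also have "\<dots> \<le> E / u\<^sup>2" using u E0 \<open>D \<ge> 0\<close> by (intro divide_right_mono) (auto simp: E_def)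
    finally show "norm (G2 k u) \<le> E / u\<^sup>2" .
  qed
qed

section \<open>First and second derivatives of the Green's function\<close>

lemma green_eq_psi:
  assumes "k > 0" "x \<noteq> y"
  shows "green k x y = psi (k\<^sup>2 * ((x - y) \<bullet> (x - y)))"
proof -
  have "k * dist x y = sqrt (k\<^sup>2 * ((x - y) \<bullet> (x - y)))"
    using assms by (simp add: real_sqrt_mult dist_norm norm_eq_sqrt_inner)
  then show ?thesis
    unfolding green_def using assms by (simp only:) (intro hankel1_0_sqrt, simp)
qed

lemma has_derivative_radial:
  fixes x y :: "real^2" and f :: "real \<Rightarrow> complex"
  assumes "(f has_vector_derivative f') (at ((x - y) \<bullet> (x - y)))"
  shows "((\<lambda>x. f ((x - y) \<bullet> (x - y))) has_derivative (\<lambda>h. of_real (2 * ((x - y) \<bullet> h)) * f')) (at x)"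
proof -
  have "((\<lambda>x. (x - y) \<bullet> (x - y)) has_derivative (\<lambda>h. 2 * ((x - y) \<bullet> h))) (at x)"
    by (auto intro!: derivative_eq_intros simp: inner_commute)
  from diff_chain_at[OF this assms[unfolded has_vector_derivative_def]]
  show ?thesis by (simp add: o_def scaleR_conv_of_real)
qed

lemma green_has_derivative:
  assumes "k > 0" "x \<noteq> y"
  shows "((\<lambda>x. green k x y) has_derivative
      (\<lambda>h. of_real (2 * ((x - y) \<bullet> h)) * G1 k ((x - y) \<bullet> (x - y)))) (at x)"
proof (rule has_derivative_transform_within_open[where s="- {y}"])
  show "((\<lambda>x. psi (k\<^sup>2 * ((x - y) \<bullet> (x - y)))) has_derivative
      (\<lambda>h. of_real (2 * ((x - y) \<bullet> h)) * G1 k ((x - y) \<bullet> (x - y)))) (at x)"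
    by (rule has_derivative_radial, rule psi_radial_deriv) (use assms in auto)
qed (use assms in \<open>auto simp: green_eq_psi\<close>)

lemma partial_eq:
  "(f has_derivative f') (at x) \<Longrightarrow> partial i f x = f' (axis i 1)"
  unfolding partial_def by (metis frechet_derivative_at)

lemma dot_grad_eq:
  assumes "(f has_derivative f') (at x)"
  shows "dot_grad v f x = f' v"
proof -
  interpret bounded_linear f' using assms by (rule has_derivative_bounded_linear)
  have "f' v = f' (\<Sum>i\<in>UNIV. v $ i *\<^sub>R axis i 1)"
    by (simp add: basis_expansion flip: scalar_mult_eq_scaleR)
  also have "\<dots> = dot_grad v f x"
    unfolding dot_grad_def partial_eq[OF assms] sum scaleR
    by (simp add: scaleR_conv_of_real)
  finally show ?thesis by simp
qed

lemma dot_grad_green: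
  assumes "k > 0" "x \<noteq> y"
  shows "dot_grad v (\<lambda>x. green k x y) x = of_real (2 * ((x - y) \<bullet> v)) * G1 k ((x - y) \<bullet> (x - y))"
  by (rule dot_grad_eq[OF green_has_derivative[OF assms]])

text \<open>The differentiated function is the derivative of the Green's function in direction v.
  Taking v as an axis vector gives the Hessian; taking v = -w gives the mixed derivative in x and
  y.\<close>

lemma weighted_G1_has_derivative:
  fixes x y v :: "real^2"
  assumes "k > 0" "x \<noteq> y"
  shows "((\<lambda>x. of_real (2 * ((x - y) \<bullet> v)) * G1 k ((x - y) \<bullet> (x - y))) has_derivative
    (\<lambda>h. of_real (2 * (h \<bullet> v)) * G1 k ((x - y) \<bullet> (x - y))
      + of_real (4 * ((x - y) \<bullet> v) * ((x - y) \<bullet> h)) * G2 k ((x - y) \<bullet> (x - y)))) (at x)"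
proof -
  have "((\<lambda>x. G1 k ((x - y) \<bullet> (x - y))) has_derivative
      (\<lambda>h. of_real (2 * ((x - y) \<bullet> h)) * G2 k ((x - y) \<bullet> (x - y)))) (at x)"
    by (rule has_derivative_radial[where f="G1 k"], rule G1_deriv) (use assms in auto)
  from has_derivative_mult[OF _ this, of "\<lambda>x. of_real (2 * ((x - y) \<bullet> v))" "\<lambda>h. of_real (2 * (h \<bullet> v))"]
  show ?thesis
  proof (rule has_derivative_eq_rhs)
    show "((\<lambda>x. of_real (2 * ((x - y) \<bullet> v)) :: complex) has_derivative (\<lambda>h. of_real (2 * (h \<bullet> v)))) (at x)"
    by (auto intro!: derivative_eq_intros)
  qed (auto simp: fun_eq_iff algebra_simps)
qed

text \<open>After exchanging the two sums the Hessian form is a sum of directional derivatives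
  \<open>dot_grad v\<close> of the partial derivatives, and each partial derivative is given off y
  by the first-order formula.\<close>

lemma hess_form_green:
  assumes "k > 0" "x \<noteq> y"
  shows "hess_form v (\<lambda>x. green k x y) x = of_real (2 * (v \<bullet> v)) * G1 k ((x - y) \<bullet> (x - y))
     + of_real (4 * ((x - y) \<bullet> v)\<^sup>2) * G2 k ((x - y) \<bullet> (x - y))"
proof -
  let ?u = "(x - y) \<bullet> (x - y)"
  define A B c d where "A = G1 k ?u" and "B = G2 k ?u" and "c = (x - y) \<bullet> v" and "d = x - y"
  have "dot_grad v (partial j (\<lambda>x. green k x y)) x =
     of_real (2 * v $ j) * G1 k ?u + of_real (4 * (x - y) $ j * ((x - y) \<bullet> v)) * G2 k ?u" for j
  proof -
    have "(partial j (\<lambda>x. green k x y) has_derivative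
      (\<lambda>h. of_real (2 * (h \<bullet> axis j 1)) * G1 k ?u
        + of_real (4 * ((x - y) \<bullet> axis j 1) * ((x - y) \<bullet> h)) * G2 k ?u)) (at x)"
      by (rule has_derivative_transform_within_open[OF weighted_G1_has_derivative[OF assms], where s="- {y}"])
         (use assms in \<open>auto simp: partial_eq[OF green_has_derivative]\<close>)
    from dot_grad_eq[OF this, of v] show ?thesis by (simp add: inner_axis)
  qed
  moreover have "hess_form v (\<lambda>x. green k x y) x
      = (\<Sum>j\<in>UNIV. dot_grad v (partial j (\<lambda>x. green k x y)) x * of_real (v $ j))"
    unfolding hess_form_def dot_grad_def sum_distrib_right by (rule sum.swap)
  ultimately have *: "hess_form v (\<lambda>x. green k x y) x
      = (\<Sum>j\<in>UNIV. (of_real (2 * v $ j) * A + of_real (4 * d $ j * c) * B) * of_real (v $ j))"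
    unfolding A_def B_def c_def d_def by simp
  also have "\<dots> = of_real (2 * (\<Sum>j\<in>UNIV. v $ j * v $ j)) * A + of_real (4 * c * (\<Sum>j\<in>UNIV. d $ j * v $ j)) * B"
    by (simp add: sum_2 algebra_simps)
  also have "\<dots> = of_real (2 * (v \<bullet> v)) * A + of_real (4 * c\<^sup>2) * B"
    by (simp add: inner_vec_def c_def d_def power2_eq_square)
  finally show ?thesis by (simp add: A_def B_def c_def d_def)
qed

text \<open>The Green's function is symmetric, so its derivative in y along w is the formula for x
  with direction -w; this accounts for both minus signs.\<close>

lemma dot_grad_dot_grad_green:
  assumes "k > 0" "x \<noteq> y"
  shows "dot_grad v (\<lambda>x. dot_grad w (\<lambda>y. green k x y) y) x = - of_real (2 * (v \<bullet> w)) * G1 k ((x - y) \<bullet> (x - y))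
     - of_real (4 * ((x - y) \<bullet> w) * ((x - y) \<bullet> v)) * G2 k ((x - y) \<bullet> (x - y))"
proof -
  have sym: "(\<lambda>y. green k x y) = (\<lambda>y. green k y x)" for x
    by (simp add: green_def dist_commute fun_eq_iff)
  have "dot_grad w (\<lambda>y. green k z y) y = of_real (2 * ((z - y) \<bullet> (- w))) * G1 k ((z - y) \<bullet> (z - y))"
    if "z \<noteq> y" for z
    using that assms unfolding sym[of z]
    by (subst dot_grad_green) (auto simp: inner_diff_left inner_diff_right inner_commute algebra_simps)
  then have "((\<lambda>x. dot_grad w (\<lambda>y. green k x y) y) has_derivative
    (\<lambda>h. of_real (2 * (h \<bullet> (- w))) * G1 k ((x - y) \<bullet> (x - y))
      + of_real (4 * ((x - y) \<bullet> (- w)) * ((x - y) \<bullet> h)) * G2 k ((x - y) \<bullet> (x - y)))) (at x)"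
    by (intro has_derivative_transform_within_open[OF weighted_G1_has_derivative[OF assms], where s="- {y}"])
       (use assms in auto)
  from dot_grad_eq[OF this, of v] show ?thesis by simp
qed

section \<open>Integration\<close>

lemma set_integrable_abs_powr:
  fixes b l :: real
  assumes "b > 0" "l \<ge> 0"
  shows "set_integrable lborel {-l..l} (\<lambda>h. \<bar>h\<bar> powr (b - 1))"
proof -
  have "(\<lambda>x. x powr (b - 1)) absolutely_integrable_on {0..l}"
    by (intro nonnegative_absolutely_integrable_1 integrable_on_powr_from_0) (use assms in auto)
  then have i: "integrable lborel (\<lambda>x. indicator {0..l} x *\<^sub>R (x powr (b - 1)))"
    unfolding set_integrable_def by (subst (asm) integrable_completion) auto
  \<comment> \<open>The reflected half is added to the right half. At h = 0 both indicators are 1,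
    which does no harm because \<open>0 powr x = 0\<close>.\<close>
  from lborel_integrable_real_affine[OF i, of "-1" 0] i
  have "integrable lborel (\<lambda>x. indicator {0..l} x *\<^sub>R (x powr (b - 1))
      + indicator {0..l} (-x) *\<^sub>R ((-x) powr (b - 1)))"
    by (intro Bochner_Integration.integrable_add) auto
  then show ?thesis
    unfolding set_integrable_def
    by (rule Bochner_Integration.integrable_cong[THEN iffD1, OF refl, rotated])
       (auto split: split_indicator simp: abs_if)
qed

text \<open>The kernels have a meaningless value at h = 0; a case distinction at that point keeps
  the function Borel measurable whatever the value is.\<close>

lemma set_measurable_of_continuous_off_zero:
  fixes g :: "real \<Rightarrow> 'a::{banach, second_countable_topology}"
  assumes "continuous_on ({-l..l} - {0}) g"
  shows "set_borel_measurable lborel {-l..l} g"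
proof -
  have "(\<lambda>h. indicator ({-l..l} - {0}) h *\<^sub>R g h) \<in> borel_measurable borel"
    by (rule borel_measurable_continuous_on_indicator[OF _ assms]) auto
  then have "(\<lambda>h. if h = 0 then indicator {-l..l} (0::real) *\<^sub>R g 0
      else indicator ({-l..l} - {0}) h *\<^sub>R g h) \<in> borel_measurable borel"
    by measurable
  also have "(\<lambda>h. if h = 0 then indicator {-l..l} (0::real) *\<^sub>R g 0
      else indicator ({-l..l} - {0}) h *\<^sub>R g h) = (\<lambda>h. indicator {-l..l} h *\<^sub>R g h)"
    by (auto simp: fun_eq_iff split: split_indicator)
  finally show ?thesis by (simp add: set_borel_measurable_def)
qed

lemma set_integrable_of_powr_bound:
  fixes g :: "real \<Rightarrow> complex"
  assumes "continuous_on ({-l..l} - {0}) g" "b > 0" "l \<ge> 0"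
    and "\<And>h. h \<in> {-l..l} - {0} \<Longrightarrow> norm (g h) \<le> C * \<bar>h\<bar> powr (b - 1)"
  shows "set_integrable lborel {-l..l} g"
proof (rule set_integrable_bound)
  show "set_integrable lborel {-l..l} (\<lambda>h. C * \<bar>h\<bar> powr (b - 1))"
    using set_integrable_abs_powr[OF assms(2,3)] by simp
  show "set_borel_measurable lborel {-l..l} g"
    by (rule set_measurable_of_continuous_off_zero) fact
  have "AE x in lborel. x \<noteq> (0::real)" by (rule AE_lborel_singleton)
  then show "AE x in lborel. x \<in> {-l..l} \<longrightarrow> norm (g x) \<le> norm (C * \<bar>x\<bar> powr (b - 1))"
  proof eventually_elim
    case (elim x)
    then show ?case using assms(4)[of x] by (auto intro: order_trans)
  qed
qed

lemma set_integrable_of_bounded: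
  fixes g :: "real \<Rightarrow> complex"
  assumes "continuous_on ({-l..l} - {0}) g" "l \<ge> 0"
    and "\<And>h. h \<in> {-l..l} - {0} \<Longrightarrow> norm (g h) \<le> C"
  shows "set_integrable lborel {-l..l} g"
  by (rule set_integrable_of_powr_bound[where b=1 and C=C]) (use assms in auto)

lemma truncated_set_measurable [measurable]:
  fixes r :: "real \<Rightarrow> real"
  assumes "r \<in> borel_measurable borel"
  shows "{h \<in> {-l..l}. \<delta> < r h} \<in> sets borel"
proof -
  note [measurable] = assms
  have "{h \<in> space borel. h \<in> {-l..l} \<and> \<delta> < r h} \<in> sets borel" by measurable
  then show ?thesis by simp
qed

text \<open>Dominated convergence with |g| as majorant: every h other than 0 lies in the truncated
  set as soon as \<delta> < r h.\<close>

lemma truncated_tendsto: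
  fixes g :: "real \<Rightarrow> complex" and r :: "real \<Rightarrow> real"
  assumes g: "set_integrable lborel {-l..l} g" and r: "r \<in> borel_measurable borel"
    and pos: "\<And>h. h \<in> {-l..l} - {0} \<Longrightarrow> r h > 0"
  shows "((\<lambda>\<delta>. LINT h:{h\<in>{-l..l}. \<delta> < r h}|lborel. g h) \<longlongrightarrow> (LINT h:{-l..l}|lborel. g h)) (at_right 0)"
  unfolding tendsto_at_iff_sequentially
proof (intro allI impI)
  fix X :: "nat \<Rightarrow> real"
  assume X: "\<forall>i. X i \<in> {0<..} - {0}" "X \<longlonglongrightarrow> 0"
  have sub: "indicator {h\<in>{-l..l}. \<delta> < r h} h *\<^sub>R g h = indicator {h\<in>{-l..l}. \<delta> < r h} h *\<^sub>R (indicator {-l..l} h *\<^sub>R g h)" for h \<delta>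
    by (auto split: split_indicator)
  show "((\<lambda>\<delta>. LINT h:{h\<in>{-l..l}. \<delta> < r h}|lborel. g h) \<circ> X) \<longlonglongrightarrow> (LINT h:{-l..l}|lborel. g h)"
    unfolding set_lebesgue_integral_def o_def
  proof (rule integral_dominated_convergence)
    show gm: "(\<lambda>h. indicator {-l..l} h *\<^sub>R g h) \<in> borel_measurable lborel"
      using g unfolding set_integrable_def by (rule borel_measurable_integrable)
    show "integrable lborel (\<lambda>h. norm (indicator {-l..l} h *\<^sub>R g h))"
      using g unfolding set_integrable_def by (rule integrable_norm)
    show "(\<lambda>h. indicator {h \<in> {-l..l}. X i < r h} h *\<^sub>R g h) \<in> borel_measurable lborel" for i
      unfolding sub using truncated_set_measurable[OF r, of l "X i"]
      by (intro borel_measurable_scaleR[OF borel_measurable_indicator gm]) simp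
    show "AE h in lborel. norm (indicator {h \<in> {-l..l}. X i < r h} h *\<^sub>R g h) \<le> norm (indicator {-l..l} h *\<^sub>R g h)" for i
      by (auto split: split_indicator)
    have "AE x in lborel. x \<noteq> (0::real)" by (rule AE_lborel_singleton)
    then show "AE h in lborel. (\<lambda>i. indicator {h \<in> {-l..l}. X i < r h} h *\<^sub>R g h) \<longlonglongrightarrow> indicator {-l..l} h *\<^sub>R g h"
    proof eventually_elim
      case (elim h)
      show ?case
      proof (cases "h \<in> {-l..l}")
        case True
        then have "r h > 0" using elim pos by auto
        with X(2) have "eventually (\<lambda>i. X i < r h) sequentially" by (rule order_tendstoD)
        then have "eventually (\<lambda>i. indicator {h \<in> {-l..l}. X i < r h} h *\<^sub>R g h = indicator {-l..l} h *\<^sub>R g h) sequentially"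
          by eventually_elim (use True in auto)
        then show ?thesis by (rule tendsto_eventually)
      qed auto
    qed
  qed
qed

text \<open>The set where r is at least \<delta> is compact and misses 0, because r vanishes there;
  g is continuous on it, and the strict truncation is a subset.\<close>

lemma truncated_integrable:
  fixes g :: "real \<Rightarrow> complex" and r :: "real \<Rightarrow> real"
  assumes g: "continuous_on ({-l..l} - {0}) g" and r: "continuous_on UNIV r" "r 0 = 0" and "\<delta> > 0"
  shows "set_integrable lborel {h\<in>{-l..l}. \<delta> < r h} g"
proof (rule set_integrable_subset)
  have "{h \<in> {-l..l}. \<delta> \<le> r h} = {-l..l} \<inter> r -` {\<delta>..}" by auto
  moreover have "closed (r -` {\<delta>..})" by (intro closed_vimage r closed_atLeast)
  ultimately have "compact {h \<in> {-l..l}. \<delta> \<le> r h}" by (simp add: compact_Int_closed)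
  moreover have "continuous_on {h \<in> {-l..l}. \<delta> \<le> r h} g"
    using assms by (auto intro: continuous_on_subset[OF g])
  ultimately show "set_integrable lborel {h \<in> {-l..l}. \<delta> \<le> r h} g"
    unfolding set_integrable_def by (rule borel_integrable_compact)
  show "{h\<in>{-l..l}. \<delta> < r h} \<in> sets lborel"
    using truncated_set_measurable borel_measurable_continuous_onI[OF r(1)] by simp
qed auto

section \<open>Differentiation under the integral sign\<close>

text \<open>Dominated convergence is applied to the normalised remainder Q of the first-order
  expansion, in the shape in which \<open>has_derivative_within\<close> asks for it. The mean value
  inequality in y bounds Q by 2 C, uniformly in h off 0.\<close>

lemma has_vector_derivative_set_integral:
  fixes F F' :: "real \<Rightarrow> real \<Rightarrow> complex"
  assumes e: "e > 0" and l: "l \<ge> 0"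
    and int: "\<And>y. \<bar>y - x\<bar> < e \<Longrightarrow> set_integrable lborel {-l..l} (F y)"
    and int': "set_integrable lborel {-l..l} (F' x)"
    and der: "\<And>y h. \<bar>y - x\<bar> < e \<Longrightarrow> h \<in> {-l..l} - {0} \<Longrightarrow> ((\<lambda>y. F y h) has_vector_derivative F' y h) (at y)"
    and bd: "\<And>y h. \<bar>y - x\<bar> < e \<Longrightarrow> h \<in> {-l..l} - {0} \<Longrightarrow> norm (F' y h) \<le> C"
  shows "((\<lambda>y. LINT h:{-l..l}|lborel. F y h) has_vector_derivative (LINT h:{-l..l}|lborel. F' x h)) (at x)"
proof -
  let ?I = "\<lambda>f. LINT h:{-l..l}|lborel. f h"
  define Q where "Q y h = (1 / \<bar>y - x\<bar>) *\<^sub>R (F y h - (F x h + (y - x) *\<^sub>R F' x h))" for y h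
  have Qint: "set_integrable lborel {-l..l} (Q y)" if "\<bar>y - x\<bar> < e" for y
    unfolding Q_def using int[OF that] int[of x] int' e
    by (intro set_integrable_scaleR_right set_integral_diff set_integral_add) auto
  have Qval: "?I (Q y) = (1 / \<bar>y - x\<bar>) *\<^sub>R (?I (F y) - (?I (F x) + (y - x) *\<^sub>R ?I (F' x)))" if "\<bar>y - x\<bar> < e" for y
  proof -
    have "?I (Q y) = (1 / \<bar>y - x\<bar>) *\<^sub>R ?I (\<lambda>h. F y h - (F x h + (y - x) *\<^sub>R F' x h))"
      unfolding Q_def by (rule set_integral_scaleR_right)
    also have "?I (\<lambda>h. F y h - (F x h + (y - x) *\<^sub>R F' x h)) = ?I (F y) - ?I (\<lambda>h. F x h + (y - x) *\<^sub>R F' x h)"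
      using int[OF that] int[of x] int' e by (intro set_integral_diff set_integral_add set_integrable_scaleR_right) auto
    also have "?I (\<lambda>h. F x h + (y - x) *\<^sub>R F' x h) = ?I (F x) + ?I (\<lambda>h. (y - x) *\<^sub>R F' x h)"
      using int[of x] int' e by (intro set_integral_add set_integrable_scaleR_right) auto
    also have "?I (\<lambda>h. (y - x) *\<^sub>R F' x h) = (y - x) *\<^sub>R ?I (F' x)"
      by (rule set_integral_scaleR_right)
    finally show ?thesis .
  qed
  have Qbd: "norm (Q y h) \<le> 2 * C" if y: "\<bar>y - x\<bar> < e" and h: "h \<in> {-l..l} - {0}" for y h
  proof -
    have "norm (F y h - F x h) \<le> C * norm (y - x)"
    proof (rule differentiable_bound[where S="{x - \<bar>y - x\<bar>..x + \<bar>y - x\<bar>}" and f'="\<lambda>z a. a *\<^sub>R F' z h"])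
      show "((\<lambda>z. F z h) has_derivative (\<lambda>a. a *\<^sub>R F' z h)) (at z within {x - \<bar>y - x\<bar>..x + \<bar>y - x\<bar>})"
        if "z \<in> {x - \<bar>y - x\<bar>..x + \<bar>y - x\<bar>}" for z
        using der[of z h] that y h unfolding has_vector_derivative_def by (auto intro: has_derivative_at_withinI)
      show "onorm (\<lambda>a. a *\<^sub>R F' z h) \<le> C" if "z \<in> {x - \<bar>y - x\<bar>..x + \<bar>y - x\<bar>}" for z
      proof (rule onorm_le)
        have "norm (F' z h) \<le> C" using that y h by (intro bd) auto
        then show "norm (a *\<^sub>R F' z h) \<le> C * norm a" for a
          using mult_right_mono[of "norm (F' z h)" C "norm a"] by (simp add: mult.commute)
      qed
    qed auto
    moreover have "norm ((y - x) *\<^sub>R F' x h) \<le> C * \<bar>y - x\<bar>"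
      using mult_right_mono[OF bd[of x h], of "\<bar>y - x\<bar>"] h e by (simp add: mult.commute)
    ultimately have "norm (F y h - F x h - (y - x) *\<^sub>R F' x h) \<le> 2 * C * \<bar>y - x\<bar>"
      by (intro order_trans[OF norm_triangle_ineq4]) auto
    moreover have "C \<ge> 0" using order_trans[OF norm_ge_zero bd[of x h]] h e by simp
    ultimately show ?thesis
      unfolding Q_def norm_scaleR diff_diff_eq[symmetric] by (cases "y = x") (auto simp: divide_simps mult_ac)
  qed
  have Qlim: "((\<lambda>y. Q y h) \<longlongrightarrow> 0) (at x)" if "h \<in> {-l..l} - {0}" for h
    using der[of x h] that e unfolding has_vector_derivative_def has_derivative_within Q_def by simp
  have "((\<lambda>y. ?I (Q y)) \<longlongrightarrow> 0) (at x)"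
    unfolding tendsto_at_iff_sequentially
  proof (intro allI impI)
    fix X :: "nat \<Rightarrow> real"
    assume X: "\<forall>i. X i \<in> UNIV - {x}" "X \<longlonglongrightarrow> x"
    \<comment> \<open>The bound on Q holds only within e of x, so the first N terms of the sequence
      are skipped.\<close>
    from X(2) e obtain N where N: "\<And>n. n \<ge> N \<Longrightarrow> \<bar>X n - x\<bar> < e"
      unfolding LIMSEQ_def dist_real_def by blast
    have "(\<lambda>n. ?I (Q (X (n + N)))) \<longlonglongrightarrow> integral\<^sup>L (lborel :: real measure) (\<lambda>_. 0)"
      unfolding set_lebesgue_integral_def
    proof (rule integral_dominated_convergence)
      show "(\<lambda>_. 0) \<in> borel_measurable lborel" by simp
      show "(\<lambda>h. indicator {-l..l} h *\<^sub>R Q (X (n + N)) h) \<in> borel_measurable lborel" for n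
        using Qint[OF N, of "n + N"] unfolding set_integrable_def by auto
      show "integrable lborel (\<lambda>h. indicator {-l..l} h *\<^sub>R (2 * C))"
        using borel_integrable_compact[of "{-l..l}" "\<lambda>_. 2 * C"] by simp
      have AE: "AE x in lborel. x \<noteq> (0::real)" by (rule AE_lborel_singleton)
      then show "AE h in lborel. norm (indicator {-l..l} h *\<^sub>R Q (X (n + N)) h) \<le> indicator {-l..l} h *\<^sub>R (2 * C)" for n
        by eventually_elim (use Qbd[OF N, of "n + N"] in \<open>auto split: split_indicator\<close>)
      from AE show "AE h in lborel. (\<lambda>n. indicator {-l..l} h *\<^sub>R Q (X (n + N)) h) \<longlonglongrightarrow> 0"
      proof eventually_elim
        case (elim h)
        show ?case
        proof (cases "h \<in> {-l..l}")
          case True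
          with Qlim[of h] elim X have "((\<lambda>y. Q y h) \<circ> X) \<longlonglongrightarrow> 0"
            unfolding tendsto_at_iff_sequentially by auto
          then show ?thesis using True by (auto simp: o_def dest: LIMSEQ_ignore_initial_segment)
        qed auto
      qed
    qed
    then show "((\<lambda>y. ?I (Q y)) \<circ> X) \<longlonglongrightarrow> 0"
      using LIMSEQ_offset[of "\<lambda>n. ?I (Q (X n))" N 0] by (simp add: o_def)
  qed
  moreover have "eventually (\<lambda>y. ?I (Q y) = (1 / \<bar>y - x\<bar>) *\<^sub>R (?I (F y) - (?I (F x) + (y - x) *\<^sub>R ?I (F' x)))) (at x)"
    unfolding eventually_at using e Qval by (auto simp: dist_real_def intro!: exI[of _ e])
  ultimately have "((\<lambda>y. (1 / \<bar>y - x\<bar>) *\<^sub>R (?I (F y) - (?I (F x) + (y - x) *\<^sub>R ?I (F' x)))) \<longlongrightarrow> 0) (at x)"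
    by (rule Lim_transform_eventually)
  then show ?thesis
    unfolding has_vector_derivative_def has_derivative_within by (auto intro: bounded_linear_scaleR_left)
qed

section \<open>Periodic integrands on a window centred at the singularity\<close>

lemma set_integral_shift:
  fixes g :: "real \<Rightarrow> complex"
  shows "(LINT s:{a..b}|lborel. g s) = (LINT h:{a - t..b - t}|lborel. g (t + h))"
    and "set_integrable lborel {a..b} g \<longleftrightarrow> set_integrable lborel {a - t..b - t} (\<lambda>h. g (t + h))"
proof -
  have "indicator {a..b} (t + h) = (indicator {a - t..b - t} h :: real)" for h
    by (auto split: split_indicator)
  then show "(LINT s:{a..b}|lborel. g s) = (LINT h:{a - t..b - t}|lborel. g (t + h))"
    and "set_integrable lborel {a..b} g \<longleftrightarrow> set_integrable lborel {a - t..b - t} (\<lambda>h. g (t + h))"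
    unfolding set_lebesgue_integral_def set_integrable_def
    using lborel_integral_real_affine[of 1 "\<lambda>s. indicator {a..b} s *\<^sub>R g s" t]
      lborel_integrable_real_affine_iff[of 1 "\<lambda>s. indicator {a..b} s *\<^sub>R g s" t]
    by auto
qed

lemma set_integral_split:
  fixes g :: "real \<Rightarrow> complex"
  assumes "set_integrable lborel {a..b} g" "a \<le> c" "c \<le> b"
  shows "(LINT s:{a..b}|lborel. g s) = (LINT s:{a..c}|lborel. g s) + (LINT s:{c..b}|lborel. g s)"
proof -
  have "{a..b} = {a..c} \<union> {c..b}" using assms by auto
  moreover have "(LINT s:{a..c} \<union> {c..b}|lborel. g s) = (LINT s:{a..c}|lborel. g s) + (LINT s:{c..b}|lborel. g s)"
  proof (rule set_integral_Un_AE)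
    have "AE x in lborel. x \<noteq> c" by (rule AE_lborel_singleton)
    then show "AE x in lborel. \<not> (x \<in> {a..c} \<and> x \<in> {c..b})" by eventually_elim auto
  qed (use assms(2,3) in \<open>auto intro!: set_integrable_subset[OF assms(1)]\<close>)
  ultimately show ?thesis by simp
qed

text \<open>The window contains 0; its part [a, 0], moved to the right by one period, becomes
  [a + L, L] and completes [0, a + L] to [0, L].\<close>

lemma set_integral_period_aux:
  fixes g :: "real \<Rightarrow> complex"
  assumes per: "\<And>s. g (s + L) = g s" and int: "set_integrable lborel {a..a + L} g" and a: "a \<le> 0" "0 \<le> a + L"
  shows "(LINT s:{0..L}|lborel. g s) = (LINT s:{a..a + L}|lborel. g s)"
    and "set_integrable lborel {0..L} g"
proof -
  have per': "g (L + h) = g h" for h using per[of h] by (simp add: add.commute)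
  have sh: "(LINT s:{a + L..L}|lborel. g s) = (LINT s:{a..0}|lborel. g s)"
    using set_integral_shift(1)[of "a + L" L g L] by (simp add: per')
  have i1: "set_integrable lborel {a..0} g" and i2: "set_integrable lborel {0..a + L} g"
    by (rule set_integrable_subset[OF int]; use a in auto)+
  have i3: "set_integrable lborel {a + L..L} g"
    using set_integral_shift(2)[of "a + L" L g L] i1 by (simp add: per')
  have "{0..L} = {0..a + L} \<union> {a + L..L}" using a by auto
  then show i: "set_integrable lborel {0..L} g" using i2 i3 by (auto intro: set_integrable_Un)
  show "(LINT s:{0..L}|lborel. g s) = (LINT s:{a..a + L}|lborel. g s)"
    using set_integral_split[OF i, of "a + L"] set_integral_split[OF int, of 0] sh a by simp
qed

text \<open>For t <= L/2 the window around t contains 0 and the auxiliary lemma applies; otherwise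
  the window is first moved back by one period, after which it contains 0.\<close>

lemma set_integral_period:
  fixes g :: "real \<Rightarrow> complex"
  assumes per: "\<And>s. g (s + L) = g s" and t: "t \<in> {0..L}"
    and int: "set_integrable lborel {-(L/2)..L/2} (\<lambda>h. g (t + h))"
  shows "(LINT s:{0..L}|lborel. g s) = (LINT h:{-(L/2)..L/2}|lborel. g (t + h))"
proof -
  have *: "(LINT s:{t - L/2..t + L/2}|lborel. g s) = (LINT h:{-(L/2)..L/2}|lborel. g (t + h))"
    "set_integrable lborel {t - L/2..t + L/2} g"
    using set_integral_shift[of "t - L/2" "t + L/2" g t] int by auto
  show ?thesis
  proof (cases "t \<le> L / 2")
    case True
    then show ?thesis
      using set_integral_period_aux(1)[of g L "t - L/2"] per * t by (simp add: algebra_simps)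
  next
    case False
    have per': "g (L + h) = g h" for h using per[of h] by (simp add: add.commute)
    have sh: "(LINT s:{t - L/2..t + L/2}|lborel. g s) = (LINT s:{t - L/2 - L..t + L/2 - L}|lborel. g s)"
      "set_integrable lborel {t - L/2 - L..t + L/2 - L} g"
      using set_integral_shift[of "t - L/2" "t + L/2" g L] *(2) by (simp_all add: per')
    show ?thesis
      using set_integral_period_aux(1)[of g L "t - L/2 - L"] sh * per t False by (simp add: algebra_simps)
  qed
qed

section \<open>Location of the cut-off and the finite part of a pole\<close>

text \<open>b is the solution of u b = \<delta>^2 near 0. From \<delta>^2 - v^2 b^2 = m b^3 +
  O(b^4), factoring the left side as (\<delta> - v b)(\<delta> + v b) and using \<delta>/b -> v, the
  difference 1/b - v/\<delta> = (\<delta> - v b)/(b \<delta>) tends to m/(v (v + v)). The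
  logarithmic limit needs only \<delta>/b -> v.\<close>

lemma cutoff_asymptotics:
  fixes u :: "real \<Rightarrow> real"
  assumes l: "0 < \<eta>" "\<eta> \<le> l" and v: "v > 0" and c: "c > 0"
    and mono: "\<And>x y. 0 \<le> x \<Longrightarrow> x < y \<Longrightarrow> y \<le> \<eta> \<Longrightarrow> u x < u y"
    and cont: "continuous_on {0..l} u" and u0: "u 0 = 0"
    and low: "\<And>h. 0 \<le> h \<Longrightarrow> h \<le> l \<Longrightarrow> c * h\<^sup>2 \<le> u h"
    and exp: "\<And>h. 0 \<le> h \<Longrightarrow> h \<le> l \<Longrightarrow> \<bar>u h - v\<^sup>2 * h\<^sup>2 - m * h ^ 3\<bar> \<le> C * h ^ 4"
  obtains b where "\<forall>\<^sub>F \<delta> in at_right 0. 0 < b \<delta> \<and> b \<delta> \<le> l \<and> (\<forall>h\<in>{0<..l}. \<delta>\<^sup>2 < u h \<longleftrightarrow> b \<delta> < h)"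
    and "((\<lambda>\<delta>. 1 / b \<delta> - v / \<delta>) \<longlongrightarrow> m / (2 * v\<^sup>2)) (at_right 0)"
    and "((\<lambda>\<delta>. ln (b \<delta>) - ln \<delta>) \<longlongrightarrow> - ln v) (at_right 0)"
proof -
  define b where "b \<delta> = (SOME b. 0 < b \<and> b \<le> \<eta> \<and> u b = \<delta>\<^sup>2)" for \<delta>
  have u_eta: "u \<eta> > 0" using mono[of 0 \<eta>] l u0 by simp
  have bex: "0 < b \<delta> \<and> b \<delta> \<le> \<eta> \<and> u (b \<delta>) = \<delta>\<^sup>2" if "0 < \<delta>" "\<delta>\<^sup>2 < u \<eta>" for \<delta>
    unfolding b_def
  proof (rule someI_ex)
    have "continuous_on {0..\<eta>} u" by (rule continuous_on_subset[OF cont]) (use l in auto)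
    moreover have "u 0 \<le> \<delta>\<^sup>2" "\<delta>\<^sup>2 \<le> u \<eta>" "0 \<le> \<eta>" using that l u0 by simp_all
    ultimately have "\<exists>x\<ge>0. x \<le> \<eta> \<and> u x = \<delta>\<^sup>2" by (intro IVT')
    then obtain x where x: "x \<ge> 0" "x \<le> \<eta>" "u x = \<delta>\<^sup>2" by blast
    have "x \<noteq> 0"
    proof
      assume "x = 0"
      then have "\<delta>\<^sup>2 = 0" using x(3) u0 by simp
      then show False using that(1) by simp
    qed
    then show "\<exists>x>0. x \<le> \<eta> \<and> u x = \<delta>\<^sup>2" using x by (intro exI[of _ x]) linarith
  qed
  have pos: "\<forall>\<^sub>F \<delta> in at_right (0::real). 0 < \<delta>" by (rule eventually_at_right_less)
  have "((\<lambda>\<delta>. \<delta>\<^sup>2) \<longlongrightarrow> (0::real)\<^sup>2) (at_right 0)" by (intro tendsto_intros)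
  then have sq: "((\<lambda>\<delta>. \<delta>\<^sup>2) \<longlongrightarrow> (0::real)) (at_right 0)" by simp
  \<comment> \<open>The first bound makes the equation solvable on [0, \<eta>]. The second excludes
    further crossings beyond \<eta>, where u is not known to be monotone: there u h >= c h^2 >= c
    \<eta>^2 > \<delta>^2.\<close>
  have small: "\<forall>\<^sub>F \<delta> in at_right 0. \<delta>\<^sup>2 < u \<eta> \<and> \<delta>\<^sup>2 < c * \<eta>\<^sup>2"
    using order_tendstoD(2)[OF sq u_eta] order_tendstoD(2)[OF sq, of "c * \<eta>\<^sup>2"] c l
    by (auto intro: eventually_conj)
  have ev: "\<forall>\<^sub>F \<delta> in at_right 0. 0 < \<delta> \<and> 0 < b \<delta> \<and> b \<delta> \<le> \<eta> \<and> u (b \<delta>) = \<delta>\<^sup>2"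
    using pos small by eventually_elim (use bex in auto)
  have 1: "\<forall>\<^sub>F \<delta> in at_right 0. 0 < b \<delta> \<and> b \<delta> \<le> l \<and> (\<forall>h\<in>{0<..l}. \<delta>\<^sup>2 < u h \<longleftrightarrow> b \<delta> < h)"
    using ev small
  proof eventually_elim
    case (elim \<delta>)
    have "\<delta>\<^sup>2 < u h \<longleftrightarrow> b \<delta> < h" if "h \<in> {0<..l}" for h
    proof (cases "h \<le> \<eta>")
      case True
      then show ?thesis
        using mono[of "b \<delta>" h] mono[of h "b \<delta>"] elim that by (cases "b \<delta>" h rule: linorder_cases) auto
    next
      case False
      then have "c * \<eta>\<^sup>2 \<le> c * h\<^sup>2" using l c by (intro mult_left_mono power_mono) auto
      then show ?thesis using low[of h] that elim False by auto
    qed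
    then show ?case using elim l by auto
  qed
  have b0: "(b \<longlongrightarrow> 0) (at_right 0)"
  proof (rule tendsto_sandwich)
    show "\<forall>\<^sub>F \<delta> in at_right 0. 0 \<le> b \<delta>" using ev by eventually_elim auto
    show "\<forall>\<^sub>F \<delta> in at_right 0. b \<delta> \<le> \<delta> / sqrt c" using ev
    proof eventually_elim
      case (elim \<delta>)
      then have bl: "0 < \<delta>" "0 \<le> b \<delta>" "b \<delta> \<le> l" "u (b \<delta>) = \<delta>\<^sup>2" using l by linarith+
      have "(sqrt c * b \<delta>)\<^sup>2 = c * (b \<delta>)\<^sup>2" using c by (simp add: power_mult_distrib)
      also have "\<dots> \<le> u (b \<delta>)" using bl(2,3) by (rule low)
      finally have "(sqrt c * b \<delta>)\<^sup>2 \<le> \<delta>\<^sup>2" unfolding bl(4) .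
      then have "sqrt c * b \<delta> \<le> \<delta>" using bl(1) by (rule power2_le_imp_le[OF _ less_imp_le])
      then have "b \<delta> * sqrt c \<le> \<delta>" by (simp only: mult.commute)
      then show ?case using c by (intro mult_imp_le_div_pos) simp_all
    qed
    have "((\<lambda>\<delta>. \<delta> / sqrt c) \<longlongrightarrow> 0 / sqrt c) (at_right 0)"
      by (rule tendsto_divide[OF tendsto_ident_at tendsto_const]) (use c in simp)
    then show "((\<lambda>\<delta>. \<delta> / sqrt c) \<longlongrightarrow> 0) (at_right 0)" by simp
  qed (rule tendsto_const)
  have cub: "((\<lambda>\<delta>. (u (b \<delta>) - v\<^sup>2 * (b \<delta>)\<^sup>2) / b \<delta> ^ 3) \<longlongrightarrow> m) (at_right 0)"
  proof (rule LIM_zero_cancel, rule Lim_null_comparison)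
    show "((\<lambda>\<delta>. C * b \<delta>) \<longlongrightarrow> 0) (at_right 0)" using tendsto_mult_left[OF b0, of C] by simp
    show "\<forall>\<^sub>F \<delta> in at_right 0. norm ((u (b \<delta>) - v\<^sup>2 * (b \<delta>)\<^sup>2) / b \<delta> ^ 3 - m) \<le> C * b \<delta>" using ev
    proof eventually_elim
      case (elim \<delta>)
      have "(u (b \<delta>) - v\<^sup>2 * (b \<delta>)\<^sup>2) / b \<delta> ^ 3 - m = (u (b \<delta>) - v\<^sup>2 * (b \<delta>)\<^sup>2 - m * b \<delta> ^ 3) / b \<delta> ^ 3"
        using elim by (simp add: diff_divide_distrib)
      also have "norm \<dots> \<le> C * b \<delta> ^ 4 / b \<delta> ^ 3"
        using exp[of "b \<delta>"] elim l by (simp add: divide_right_mono)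
      also have "\<dots> = C * b \<delta>" using elim by (simp add: power_numeral_reduce)
      finally show ?case .
    qed
  qed
  have "((\<lambda>\<delta>. (\<delta> / b \<delta>)\<^sup>2) \<longlongrightarrow> v\<^sup>2) (at_right 0)"
  proof (rule Lim_transform_eventually)
    show "((\<lambda>\<delta>. v\<^sup>2 + (u (b \<delta>) - v\<^sup>2 * (b \<delta>)\<^sup>2) / b \<delta> ^ 3 * b \<delta>) \<longlongrightarrow> v\<^sup>2) (at_right 0)"
      using tendsto_add[OF tendsto_const[of "v\<^sup>2"] tendsto_mult[OF cub b0]] by simp
    show "\<forall>\<^sub>F \<delta> in at_right 0. v\<^sup>2 + (u (b \<delta>) - v\<^sup>2 * (b \<delta>)\<^sup>2) / b \<delta> ^ 3 * b \<delta> = (\<delta> / b \<delta>)\<^sup>2"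
      using ev
    proof eventually_elim
      case (elim \<delta>)
      then have bp: "b \<delta> > 0" "u (b \<delta>) = \<delta>\<^sup>2" by simp_all
      have "x / z ^ 3 * z = x / z\<^sup>2" if "z > 0" for x z :: real
        using that by (simp add: power2_eq_square power3_eq_cube)
      then have "v\<^sup>2 + (u (b \<delta>) - v\<^sup>2 * (b \<delta>)\<^sup>2) / b \<delta> ^ 3 * b \<delta>
          = v\<^sup>2 + (\<delta>\<^sup>2 - v\<^sup>2 * (b \<delta>)\<^sup>2) / (b \<delta>)\<^sup>2"
        using bp by (simp only:)
      also have "\<dots> = (\<delta> / b \<delta>)\<^sup>2" using bp(1) by (simp add: power_divide diff_divide_distrib)
      finally show ?case .
    qed
  qed
  then have "((\<lambda>\<delta>. sqrt ((\<delta> / b \<delta>)\<^sup>2)) \<longlongrightarrow> sqrt (v\<^sup>2)) (at_right 0)" by (rule tendsto_real_sqrt)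
  then have sqv: "((\<lambda>\<delta>. sqrt ((\<delta> / b \<delta>)\<^sup>2)) \<longlongrightarrow> v) (at_right 0)" using v by simp
  have "\<forall>\<^sub>F \<delta> in at_right 0. sqrt ((\<delta> / b \<delta>)\<^sup>2) = \<delta> / b \<delta>"
    using ev by eventually_elim auto
  with sqv have rat: "((\<lambda>\<delta>. \<delta> / b \<delta>) \<longlongrightarrow> v) (at_right 0)" by (rule Lim_transform_eventually)
  have 2: "((\<lambda>\<delta>. 1 / b \<delta> - v / \<delta>) \<longlongrightarrow> m / (2 * v\<^sup>2)) (at_right 0)"
  proof (rule Lim_transform_eventually)
    show "((\<lambda>\<delta>. (u (b \<delta>) - v\<^sup>2 * (b \<delta>)\<^sup>2) / b \<delta> ^ 3 / (\<delta> / b \<delta> * (\<delta> / b \<delta> + v))) \<longlongrightarrow> m / (2 * v\<^sup>2)) (at_right 0)"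
    proof -
      have "((\<lambda>\<delta>. (u (b \<delta>) - v\<^sup>2 * (b \<delta>)\<^sup>2) / b \<delta> ^ 3 / (\<delta> / b \<delta> * (\<delta> / b \<delta> + v))) \<longlongrightarrow> m / (v * (v + v))) (at_right 0)"
        using v by (intro tendsto_divide tendsto_mult tendsto_add tendsto_const cub rat) auto
      then show ?thesis by (simp add: power2_eq_square algebra_simps)
    qed
    show "\<forall>\<^sub>F \<delta> in at_right 0. (u (b \<delta>) - v\<^sup>2 * (b \<delta>)\<^sup>2) / b \<delta> ^ 3 / (\<delta> / b \<delta> * (\<delta> / b \<delta> + v)) = 1 / b \<delta> - v / \<delta>"
      using ev
    proof eventually_elim
      case (elim \<delta>)
      then have p: "\<delta> + v * b \<delta> > 0" "\<delta> > 0" "b \<delta> > 0" using v by (auto intro: add_pos_pos)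
      have "(u (b \<delta>) - v\<^sup>2 * (b \<delta>)\<^sup>2) = (\<delta> - v * b \<delta>) * (\<delta> + v * b \<delta>)"
        using elim by (simp add: algebra_simps power2_eq_square)
      moreover have "\<delta> / b \<delta> * (\<delta> / b \<delta> + v) = \<delta> * (\<delta> + v * b \<delta>) / (b \<delta>)\<^sup>2"
        using p by (simp add: field_simps power2_eq_square)
      ultimately have "(u (b \<delta>) - v\<^sup>2 * (b \<delta>)\<^sup>2) / b \<delta> ^ 3 / (\<delta> / b \<delta> * (\<delta> / b \<delta> + v))
          = ((\<delta> - v * b \<delta>) * (\<delta> + v * b \<delta>)) / b \<delta> ^ 3 / (\<delta> * (\<delta> + v * b \<delta>) / (b \<delta>)\<^sup>2)"
        by (simp only:)
      also have "\<dots> = (\<delta> - v * b \<delta>) / (b \<delta> * \<delta>)"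
      proof -
        have "X * Y / z ^ 3 / (d * Y / z\<^sup>2) = X / (z * d)" if "Y > 0" "z > 0" "d > 0" for X Y z d :: real
          using that by (simp add: power2_eq_square power3_eq_cube)
        from this[OF p(1,3,2)] show ?thesis .
      qed
      also have "\<dots> = 1 / b \<delta> - v / \<delta>" using p by (simp add: diff_divide_distrib)
      finally show ?case .
    qed
  qed
  have 3: "((\<lambda>\<delta>. ln (b \<delta>) - ln \<delta>) \<longlongrightarrow> - ln v) (at_right 0)"
  proof (rule Lim_transform_eventually)
    show "((\<lambda>\<delta>. - ln (\<delta> / b \<delta>)) \<longlongrightarrow> - ln v) (at_right 0)"
      using v by (intro tendsto_minus tendsto_ln rat) auto
    show "\<forall>\<^sub>F \<delta> in at_right 0. - ln (\<delta> / b \<delta>) = ln (b \<delta>) - ln \<delta>"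
      using ev by eventually_elim (auto simp: ln_div)
  qed
  from 1 2 3 show ?thesis by (rule that)
qed

lemma integral_pole_right:
  fixes A B :: complex
  assumes "0 < b" "b \<le> l"
  shows "set_integrable lborel {b..l} (\<lambda>h. A / of_real (h\<^sup>2) + B / of_real h)"
    and "(LINT h:{b..l}|lborel. A / of_real (h\<^sup>2) + B / of_real h)
      = A * of_real (1 / b - 1 / l) + B * of_real (ln l - ln b)"
proof -
  have cont: "continuous_on {b..l} (\<lambda>h. A / of_real (h\<^sup>2) + B / of_real h)"
    using assms by (intro continuous_intros) auto
  then show "set_integrable lborel {b..l} (\<lambda>h. A / of_real (h\<^sup>2) + B / of_real h)"
    unfolding set_integrable_def by (rule borel_integrable_compact[rotated]) simp
  have "(\<integral>x. indicator {b..l} x *\<^sub>R (A / of_real (x\<^sup>2) + B / of_real x) \<partial>lborel)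
     = (A * of_real (- 1 / l) + B * of_real (ln l)) - (A * of_real (- 1 / b) + B * of_real (ln b))"
  proof (rule integral_FTC_Icc[OF assms(2) _ cont])
    fix x assume x: "b \<le> x" "x \<le> l"
    have "((\<lambda>x. - 1 / x) has_real_derivative 1 / x\<^sup>2) (at x)" "(ln has_real_derivative 1 / x) (at x)"
      using x assms by (auto intro!: derivative_eq_intros simp: power2_eq_square)
    then have "((\<lambda>x. A * of_real (- 1 / x) + B * of_real (ln x)) has_vector_derivative
        A * of_real (1 / x\<^sup>2) + B * of_real (1 / x)) (at x)"
      by (intro has_vector_derivative_add has_vector_derivative_mult_right has_vector_derivative_of_real)
    then show "((\<lambda>x. A * of_real (- 1 / x) + B * of_real (ln x)) has_vector_derivative
        (A / of_real (x\<^sup>2) + B / of_real x)) (at x within {b..l})"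
      by (auto intro: has_vector_derivative_at_within)
  qed
  then show "(LINT h:{b..l}|lborel. A / of_real (h\<^sup>2) + B / of_real h)
      = A * of_real (1 / b - 1 / l) + B * of_real (ln l - ln b)"
    unfolding set_lebesgue_integral_def by (simp add: algebra_simps)
qed

text \<open>Reflection turns B into -B, so the logarithms of the two sides enter with opposite
  signs; this is why a simple pole has a principal value.\<close>

lemma integral_pole_left:
  fixes A B :: complex
  assumes "0 < a" "a \<le> l"
  shows "set_integrable lborel {-l..-a} (\<lambda>h. A / of_real (h\<^sup>2) + B / of_real h)"
    and "(LINT h:{-l..-a}|lborel. A / of_real (h\<^sup>2) + B / of_real h)
      = A * of_real (1 / a - 1 / l) - B * of_real (ln l - ln a)"
proof -
  have ind: "indicator {-l..-a} (0 + - 1 * h) = (indicator {a..l} h :: real)" for h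
    by (auto split: split_indicator)
  let ?f = "\<lambda>h. indicator {-l..-a} h *\<^sub>R (A / of_real (h\<^sup>2) + B / of_real h)"
  have eq: "?f (0 + - 1 * h) = indicator {a..l} h *\<^sub>R (A / of_real (h\<^sup>2) + (- B) / of_real h)" for h
    unfolding ind by simp
  show "set_integrable lborel {-l..-a} (\<lambda>h. A / of_real (h\<^sup>2) + B / of_real h)"
    using lborel_integrable_real_affine_iff[of "-1" ?f 0] integral_pole_right(1)[OF assms, of A "-B"]
    unfolding eq set_integrable_def by simp
  show "(LINT h:{-l..-a}|lborel. A / of_real (h\<^sup>2) + B / of_real h)
      = A * of_real (1 / a - 1 / l) - B * of_real (ln l - ln a)"
    using lborel_integral_real_affine[of "-1" ?f 0] integral_pole_right(2)[OF assms, of A "-B"]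
    unfolding eq set_lebesgue_integral_def by simp
qed

text \<open>The integral of the pole \<open>A / h\<^sup>2 + B / h\<close> is explicit. The cubic term of \<open>r\<^sup>2\<close> shifts the two
  ends of the excised interval in opposite directions, so that only \<open>2 A v / \<delta>\<close> survives.\<close>

lemma finite_part_expansion:
  fixes r :: "real \<Rightarrow> real" and f :: "real \<Rightarrow> complex"
  assumes l: "0 < \<eta>" "\<eta> \<le> l" and v: "v > 0" and c: "c > 0"
    and mono: "\<And>x y. 0 \<le> x \<Longrightarrow> x < y \<Longrightarrow> y \<le> \<eta> \<Longrightarrow> (r x)\<^sup>2 < (r y)\<^sup>2 \<and> (r (-x))\<^sup>2 < (r (-y))\<^sup>2"
    and cont: "continuous_on UNIV r" and r0: "r 0 = 0" and rpos: "\<And>h. r h \<ge> 0"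
    and low: "\<And>h. \<bar>h\<bar> \<le> l \<Longrightarrow> c * h\<^sup>2 \<le> (r h)\<^sup>2"
    and exp: "\<And>h. \<bar>h\<bar> \<le> l \<Longrightarrow> \<bar>(r h)\<^sup>2 - v\<^sup>2 * h\<^sup>2 - m * h ^ 3\<bar> \<le> C * h ^ 4"
    and rem: "set_integrable lborel {-l..l} (\<lambda>h. f h - (A / of_real (h\<^sup>2) + B / of_real h))"
  obtains w where "((\<lambda>\<delta>. (LINT h:{h\<in>{-l..l}. \<delta> < r h}|lborel. f h) - (2 * A * of_real v) / of_real \<delta>) \<longlongrightarrow> w) (at_right 0)"
proof -
  let ?u = "\<lambda>h. (r h)\<^sup>2" and ?p = "\<lambda>h. A / of_real (h\<^sup>2) + B / of_real h"
  have cu: "continuous_on S ?u" for S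
    by (intro continuous_intros continuous_on_subset[OF cont]) auto
  obtain b where b: "\<forall>\<^sub>F \<delta> in at_right 0. 0 < b \<delta> \<and> b \<delta> \<le> l \<and> (\<forall>h\<in>{0<..l}. \<delta>\<^sup>2 < ?u h \<longleftrightarrow> b \<delta> < h)"
    and b1: "((\<lambda>\<delta>. 1 / b \<delta> - v / \<delta>) \<longlongrightarrow> m / (2 * v\<^sup>2)) (at_right 0)"
    and b2: "((\<lambda>\<delta>. ln (b \<delta>) - ln \<delta>) \<longlongrightarrow> - ln v) (at_right 0)"
    by (rule cutoff_asymptotics[where u="?u" and m=m and C=C, OF l v c])
       (use mono r0 low exp cu in auto)
  have cu': "continuous_on S (\<lambda>h. ?u (-h))" for S
    by (intro continuous_intros continuous_on_compose2[OF cont]) auto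
  obtain a where a: "\<forall>\<^sub>F \<delta> in at_right 0. 0 < a \<delta> \<and> a \<delta> \<le> l \<and> (\<forall>h\<in>{0<..l}. \<delta>\<^sup>2 < ?u (-h) \<longleftrightarrow> a \<delta> < h)"
    and a1: "((\<lambda>\<delta>. 1 / a \<delta> - v / \<delta>) \<longlongrightarrow> - m / (2 * v\<^sup>2)) (at_right 0)"
    and a2: "((\<lambda>\<delta>. ln (a \<delta>) - ln \<delta>) \<longlongrightarrow> - ln v) (at_right 0)"
  proof (rule cutoff_asymptotics[where u="\<lambda>h. ?u (-h)" and m="-m" and C=C, OF l v c])
    show "c * h\<^sup>2 \<le> ?u (-h)" if "0 \<le> h" "h \<le> l" for h using low[of "-h"] that by simp
    show "\<bar>?u (-h) - v\<^sup>2 * h\<^sup>2 - - m * h ^ 3\<bar> \<le> C * h ^ 4" if "0 \<le> h" "h \<le> l" for h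
      using exp[of "-h"] that by simp
  qed (use mono r0 cu' in auto)
  define e where "e h = f h - ?p h" for h
  define S where "S \<delta> = {h\<in>{-l..l}. \<delta> < r h}" for \<delta>
  have lim_e: "((\<lambda>\<delta>. LINT h:S \<delta>|lborel. e h) \<longlongrightarrow> (LINT h:{-l..l}|lborel. e h)) (at_right 0)"
    unfolding S_def
  proof (rule truncated_tendsto)
    show "set_integrable lborel {-l..l} e" using rem by (simp add: e_def[abs_def])
    show "r \<in> borel_measurable borel" using cont by (rule borel_measurable_continuous_onI)
    show "r h > 0" if "h \<in> {-l..l} - {0}" for h
    proof -
      have "0 < c * h\<^sup>2" using c that by simp
      also have "\<dots> \<le> (r h)\<^sup>2" using that by (intro low) auto
      finally show ?thesis using rpos[of h] by (simp add: less_le)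
    qed
  qed
  have Sm: "S \<delta> \<in> sets lborel" for \<delta>
    using truncated_set_measurable borel_measurable_continuous_onI[OF cont] by (simp add: S_def)
  \<comment> \<open>Inserting v/\<delta> and ln \<delta> turns the explicit integral of the pole
    into terms with known limits; the two copies of ln \<delta> have opposite signs and drop
    out.\<close>
  have main: "\<forall>\<^sub>F \<delta> in at_right 0. (LINT h:S \<delta>|lborel. e h)
        + (A * of_real ((1 / a \<delta> - v / \<delta>) + (1 / b \<delta> - v / \<delta>) - 2 / l)
         + B * of_real ((ln (a \<delta>) - ln \<delta>) - (ln (b \<delta>) - ln \<delta>)))
      = (LINT h:S \<delta>|lborel. f h) - (2 * A * of_real v) / of_real \<delta>"
    using a b eventually_at_right_less[of "0::real"]
  proof eventually_elim
    case (elim \<delta>)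
    have dr: "\<delta> < r h \<longleftrightarrow> \<delta>\<^sup>2 < (r h)\<^sup>2" for h
      using elim(3) rpos[of h] by (auto intro: power_strict_mono power2_less_imp_less)
    have eq: "S \<delta> = {-l..<- a \<delta>} \<union> {b \<delta><..l}"
    proof (intro set_eqI iffI)
      fix h assume h: "h \<in> S \<delta>"
      then have "h \<noteq> 0" using r0 elim by (auto simp: S_def)
      then consider "h > 0" | "- h > 0" by linarith
      then show "h \<in> {-l..<- a \<delta>} \<union> {b \<delta><..l}"
      proof cases
        case 1 then show ?thesis using elim(2) h by (auto simp: S_def dr)
      next
        case 2 then show ?thesis using elim(1) h by (auto simp: S_def dr dest!: bspec[where x="-h"])
      qed
    next
      fix h assume "h \<in> {-l..<- a \<delta>} \<union> {b \<delta><..l}"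
      then show "h \<in> S \<delta>"
        using elim by (auto simp: S_def dr dest: bspec[where x="-h"] bspec[where x=h])
    qed
    have AE: "AE x in lborel. x \<noteq> - a \<delta>" "AE x in lborel. x \<noteq> b \<delta>" by (rule AE_lborel_singleton)+
    let ?T = "{-l..- a \<delta>} \<union> {b \<delta>..l}"
    have iT: "set_integrable lborel ?T ?p"
      using integral_pole_left(1) integral_pole_right(1) elim by (intro set_integrable_Un) auto
    have pS: "set_integrable lborel (S \<delta>) ?p"
      by (rule set_integrable_subset[OF iT Sm]) (auto simp: eq)
    have eS: "set_integrable lborel (S \<delta>) e"
      by (rule set_integrable_subset[OF _ Sm]) (use rem in \<open>auto simp: e_def[abs_def] S_def\<close>)
    have "(LINT h:S \<delta>|lborel. ?p h) = (LINT h:?T|lborel. ?p h)"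
    proof (rule set_integral_cong_set)
      show "set_borel_measurable lborel ?T ?p" "set_borel_measurable lborel (S \<delta>) ?p"
        using iT pS unfolding set_integrable_def set_borel_measurable_def by auto
      show "AE x in lborel. x \<in> ?T \<longleftrightarrow> x \<in> S \<delta>"
        using AE unfolding eq by eventually_elim auto
    qed
    also have "\<dots> = (A * of_real (1 / a \<delta> - 1 / l) - B * of_real (ln l - ln (a \<delta>)))
        + (A * of_real (1 / b \<delta> - 1 / l) + B * of_real (ln l - ln (b \<delta>)))"
      using integral_pole_left[of "a \<delta>" l A B] integral_pole_right[of "b \<delta>" l A B] elim
      by (subst set_integral_Un) auto
    also have "\<dots> = (A * of_real ((1 / a \<delta> - v / \<delta>) + (1 / b \<delta> - v / \<delta>) - 2 / l)
         + B * of_real ((ln (a \<delta>) - ln \<delta>) - (ln (b \<delta>) - ln \<delta>))) + (2 * A * of_real v) / of_real \<delta>"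
      by (simp add: algebra_simps)
    finally have P: "(LINT h:S \<delta>|lborel. ?p h) = \<dots>" .
    have "(LINT h:S \<delta>|lborel. f h) = (LINT h:S \<delta>|lborel. e h + ?p h)" by (simp add: e_def)
    also have "\<dots> = (LINT h:S \<delta>|lborel. e h) + (LINT h:S \<delta>|lborel. ?p h)"
      using eS pS by (rule set_integral_add)
    finally show ?case unfolding P by simp
  qed
  have "((\<lambda>\<delta>. (LINT h:S \<delta>|lborel. e h)
        + (A * of_real ((1 / a \<delta> - v / \<delta>) + (1 / b \<delta> - v / \<delta>) - 2 / l)
         + B * of_real ((ln (a \<delta>) - ln \<delta>) - (ln (b \<delta>) - ln \<delta>)))) \<longlongrightarrow>
      (LINT h:{-l..l}|lborel. e h) + (A * of_real (- m / (2 * v\<^sup>2) + m / (2 * v\<^sup>2) - 2 / l)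
        + B * of_real (- ln v - - ln v))) (at_right 0)"
    by (intro tendsto_intros lim_e a1 b1 a2 b2)
  from Lim_transform_eventually[OF this main] show ?thesis
    unfolding S_def by (rule that)
qed

section \<open>Closed curves\<close>

text \<open>The clockwise quarter turn. Being linear, it makes the unnormalised normal of the
  perturbed curve affine in \<epsilon>.\<close>

definition rot :: "real^2 \<Rightarrow> real^2" where
  "rot x = vector [x $ 2, - (x $ 1)]"

lemma rot_nth [simp]: "rot x $ 1 = x $ 2" "rot x $ 2 = - (x $ 1)"
  by (simp_all add: rot_def)

lemma bounded_linear_rot: "bounded_linear rot"
  by (intro linear_conv_bounded_linear[THEN iffD1] linearI) (simp_all add: vec_eq_iff forall_2)

lemma inner_real2: "(x :: real^2) \<bullet> y = x $ 1 * y $ 1 + x $ 2 * y $ 2"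
  by (simp add: inner_vec_def sum_2)

lemma rot_rot [simp]: "rot (rot x) = - x"
  by (simp add: vec_eq_iff forall_2)

lemma rot_inner_rot [simp]: "rot x \<bullet> rot y = x \<bullet> y"
  by (simp add: inner_real2)

lemma norm_rot [simp]: "norm (rot x) = norm x"
  by (simp add: norm_eq_sqrt_inner)

lemma inner_rot_self [simp]: "x \<bullet> rot x = 0" "rot x \<bullet> x = 0"
  by (simp_all add: inner_real2)

lemma normal_eq_rot: "normal \<gamma> t = (1 / norm (ddt \<gamma> t)) *\<^sub>R rot (ddt \<gamma> t)"
  by (simp add: vec_eq_iff forall_2 normal_def tangent_def inverse_eq_divide)

text \<open>The first derivative is a parameter, so that it can be given in geometric form; of the
  second derivative only continuity is used, hence the existential quantifier.\<close>

definition C2_with_deriv :: "(real \<Rightarrow> 'a::real_normed_vector) \<Rightarrow> (real \<Rightarrow> 'a) \<Rightarrow> bool" where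
  "C2_with_deriv f f1 \<longleftrightarrow> (\<forall>t. (f has_vector_derivative f1 t) (at t))
     \<and> (\<exists>f2. (\<forall>t. (f1 has_vector_derivative f2 t) (at t)) \<and> continuous_on UNIV f2)"

lemma C2_with_derivI:
  assumes "\<And>t. (f has_vector_derivative f1 t) (at t)" "\<And>t. (f1 has_vector_derivative f2 t) (at t)"
    and "continuous_on UNIV f2"
  shows "C2_with_deriv f f1"
  using assms unfolding C2_with_deriv_def by blast

lemma continuous_on_of_vector_derivative:
  assumes "\<And>t. (f has_vector_derivative f' t) (at t)"
  shows "continuous_on S f"
  using assms by (meson continuous_at_imp_continuous_on has_vector_derivative_continuous)

lemma C2_with_derivD:
  assumes "C2_with_deriv f f1"
  shows "(f has_vector_derivative f1 t) (at t)" "continuous_on S f" "continuous_on S f1"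
  using assms unfolding C2_with_deriv_def by (auto intro: continuous_on_of_vector_derivative)

lemma C2_with_deriv_scaleR:
  assumes "C2_with_deriv f f1" "C2_with_deriv g g1"
  shows "C2_with_deriv (\<lambda>t. f t *\<^sub>R g t) (\<lambda>t. f t *\<^sub>R g1 t + f1 t *\<^sub>R g t)"
proof -
  obtain f2 g2 where f: "\<And>t. (f has_vector_derivative f1 t) (at t)" "\<And>t. (f1 has_vector_derivative f2 t) (at t)" "continuous_on UNIV f2"
    and g: "\<And>t. (g has_vector_derivative g1 t) (at t)" "\<And>t. (g1 has_vector_derivative g2 t) (at t)" "continuous_on UNIV g2"
    using assms unfolding C2_with_deriv_def by blast
  note r = f(1,2)[folded has_real_derivative_iff_has_vector_derivative]
  show ?thesis
  proof (rule C2_with_derivI)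
    show "((\<lambda>t. f t *\<^sub>R g t) has_vector_derivative f t *\<^sub>R g1 t + f1 t *\<^sub>R g t) (at t)" for t
      by (rule has_vector_derivative_scaleR[OF r(1) g(1)])
    show "((\<lambda>t. f t *\<^sub>R g1 t + f1 t *\<^sub>R g t) has_vector_derivative
        (f t *\<^sub>R g2 t + f1 t *\<^sub>R g1 t) + (f1 t *\<^sub>R g1 t + f2 t *\<^sub>R g t)) (at t)" for t
      by (intro has_vector_derivative_add has_vector_derivative_scaleR r g)
    show "continuous_on UNIV (\<lambda>t. (f t *\<^sub>R g2 t + f1 t *\<^sub>R g1 t) + (f1 t *\<^sub>R g1 t + f2 t *\<^sub>R g t))"
      by (intro continuous_intros f g continuous_on_of_vector_derivative[OF f(1)]
          continuous_on_of_vector_derivative[OF f(2)] continuous_on_of_vector_derivative[OF g(1)]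
          continuous_on_of_vector_derivative[OF g(2)])
  qed
qed

lemma continuous_bound_interval:
  fixes f :: "real \<Rightarrow> 'a::real_normed_vector"
  assumes "continuous_on UNIV f"
  obtains C where "C \<ge> 0" "\<And>h. \<bar>h\<bar> \<le> l \<Longrightarrow> norm (f (t + h)) \<le> C"
proof -
  have "compact ((\<lambda>h. f (t + h)) ` {-l..l})"
    by (intro compact_continuous_image continuous_on_compose2[OF assms] continuous_intros) auto
  then obtain C where "\<forall>x\<in>(\<lambda>h. f (t + h)) ` {-l..l}. norm x \<le> C"
    using compact_imp_bounded bounded_iff by metis
  then show ?thesis by (intro that[of "max C 0"]) (auto simp: le_max_iff_disj abs_le_iff)
qed

lemma mvt_bound:
  fixes f :: "real \<Rightarrow> 'a::real_normed_vector"
  assumes "\<And>z. \<bar>z\<bar> \<le> \<bar>h\<bar> \<Longrightarrow> (f has_vector_derivative f' z) (at z)"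
    and "\<And>z. \<bar>z\<bar> \<le> \<bar>h\<bar> \<Longrightarrow> norm (f' z) \<le> B"
  shows "norm (f h - f 0) \<le> B * \<bar>h\<bar>"
proof -
  have "norm (f h - f 0) \<le> B * norm (h - 0)"
  proof (rule differentiable_bound[where S="{-\<bar>h\<bar>..\<bar>h\<bar>}" and f'="\<lambda>z x. x *\<^sub>R f' z"])
    show "(f has_derivative (\<lambda>x. x *\<^sub>R f' z)) (at z within {- \<bar>h\<bar>..\<bar>h\<bar>})" if "z \<in> {- \<bar>h\<bar>..\<bar>h\<bar>}" for z
      using assms(1)[of z] that unfolding has_vector_derivative_def by (auto intro: has_derivative_at_withinI)
    show "onorm (\<lambda>x. x *\<^sub>R f' z) \<le> B" if "z \<in> {- \<bar>h\<bar>..\<bar>h\<bar>}" for z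
    proof (rule onorm_le)
      have "norm (f' z) \<le> B" using that by (intro assms(2)) auto
      then show "norm (x *\<^sub>R f' z) \<le> B * norm x" for x
        using mult_right_mono[of "norm (f' z)" B "norm x"] by (simp add: mult.commute)
    qed
  qed auto
  then show ?thesis by simp
qed

lemma shifted_vector_derivative:
  assumes "(f has_vector_derivative f') (at (t + z))"
  shows "((\<lambda>h. f (t + h)) has_vector_derivative f') (at z)"
proof -
  have "((\<lambda>h. t + h) has_vector_derivative 1) (at z)" by (auto intro!: derivative_eq_intros)
  from vector_diff_chain_at[OF this assms] show ?thesis by (simp add: o_def)
qed

lemma C2_taylor:
  fixes f :: "real \<Rightarrow> 'a::real_normed_vector"
  assumes "C2_with_deriv f f1"
  obtains C where "C \<ge> 0" "\<And>h. \<bar>h\<bar> \<le> l \<Longrightarrow> norm (f1 (t + h)) \<le> C"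
    "\<And>h. \<bar>h\<bar> \<le> l \<Longrightarrow> norm (f1 (t + h) - f1 t) \<le> C * \<bar>h\<bar>"
    "\<And>h. \<bar>h\<bar> \<le> l \<Longrightarrow> norm (f (t + h) - f t) \<le> C * \<bar>h\<bar>"
    "\<And>h. \<bar>h\<bar> \<le> l \<Longrightarrow> norm (f (t + h) - f t - h *\<^sub>R f1 t) \<le> C * h\<^sup>2"
proof -
  obtain f2 where f: "\<And>t. (f has_vector_derivative f1 t) (at t)" "\<And>t. (f1 has_vector_derivative f2 t) (at t)" "continuous_on UNIV f2"
    using assms unfolding C2_with_deriv_def by blast
  obtain C2 where C2: "C2 \<ge> 0" "\<And>h. \<bar>h\<bar> \<le> l \<Longrightarrow> norm (f2 (t + h)) \<le> C2"
    using continuous_bound_interval[OF f(3)] by metis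
  obtain C1 where C1: "C1 \<ge> 0" "\<And>h. \<bar>h\<bar> \<le> l \<Longrightarrow> norm (f1 (t + h)) \<le> C1"
    using continuous_bound_interval[OF continuous_on_of_vector_derivative[OF f(2)]] by metis
  have b1: "norm (f1 (t + h) - f1 t) \<le> C2 * \<bar>h\<bar>" if "\<bar>h\<bar> \<le> l" for h
    using mvt_bound[of h "\<lambda>h. f1 (t + h)" "\<lambda>h. f2 (t + h)" C2] that C2 f(2) by (auto intro: shifted_vector_derivative)
  have b0: "norm (f (t + h) - f t) \<le> C1 * \<bar>h\<bar>" if "\<bar>h\<bar> \<le> l" for h
    using mvt_bound[of h "\<lambda>h. f (t + h)" "\<lambda>h. f1 (t + h)" C1] that C1 f(1) by (auto intro: shifted_vector_derivative)
  have b2: "norm (f (t + h) - f t - h *\<^sub>R f1 t) \<le> C2 * h\<^sup>2" if h: "\<bar>h\<bar> \<le> l" for h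
  proof -
    have "norm ((f (t + h) - h *\<^sub>R f1 t) - (f (t + 0) - 0 *\<^sub>R f1 t)) \<le> (C2 * \<bar>h\<bar>) * \<bar>h\<bar>"
    proof (rule mvt_bound[where f'="\<lambda>h. f1 (t + h) - f1 t"])
      show "((\<lambda>a. f (t + a) - a *\<^sub>R f1 t) has_vector_derivative f1 (t + z) - f1 t) (at z)" for z
      proof (rule has_vector_derivative_diff)
        show "((\<lambda>a. a *\<^sub>R f1 t) has_vector_derivative f1 t) (at z)"
          using has_vector_derivative_scaleR[OF DERIV_ident has_vector_derivative_const[of "f1 t" "at z"]] by simp
      qed (rule shifted_vector_derivative[OF f(1)])
      show "norm (f1 (t + z) - f1 t) \<le> C2 * \<bar>h\<bar>" if "\<bar>z\<bar> \<le> \<bar>h\<bar>" for z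
        using b1[of z] that h C2(1) mult_left_mono[OF that C2(1)] by linarith
    qed
    then show ?thesis by (simp add: power2_eq_square algebra_simps)
  qed
  show ?thesis
  proof (rule that[of "C1 + C2"])
    show "norm (f1 (t + h)) \<le> C1 + C2" if "\<bar>h\<bar> \<le> l" for h using C1(2)[OF that] C2(1) by simp
    show "norm (f1 (t + h) - f1 t) \<le> (C1 + C2) * \<bar>h\<bar>" if "\<bar>h\<bar> \<le> l" for h
      using b1[OF that] mult_nonneg_nonneg[OF C1(1) abs_ge_zero[of h]] by (simp add: distrib_right)
    show "norm (f (t + h) - f t) \<le> (C1 + C2) * \<bar>h\<bar>" if "\<bar>h\<bar> \<le> l" for h
      using b0[OF that] mult_nonneg_nonneg[OF C2(1) abs_ge_zero[of h]] by (simp add: distrib_right)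
    show "norm (f (t + h) - f t - h *\<^sub>R f1 t) \<le> (C1 + C2) * h\<^sup>2" if "\<bar>h\<bar> \<le> l" for h
      using b2[OF that] mult_nonneg_nonneg[OF C1(1) zero_le_power2[of h]] by (simp add: distrib_right)
  qed (use C1 C2 in auto)
qed

lemma smooth_deriv:
  assumes "smooth f"
  shows "(f has_vector_derivative ddt f t) (at t)" and "smooth (ddt f)"
proof -
  have "f differentiable (at t)" using assms[unfolded smooth_def, rule_format, of 0 t] by simp
  then show "(f has_vector_derivative ddt f t) (at t)" unfolding ddt_def by (simp add: vector_derivative_works)
  show "smooth (ddt f)"
    using assms unfolding smooth_def by (metis comp_apply funpow_Suc_right)
qed

lemma smooth_continuous: "smooth f \<Longrightarrow> continuous_on S f"
  by (rule continuous_on_of_vector_derivative, rule smooth_deriv)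

lemma smooth_C2: "smooth f \<Longrightarrow> C2_with_deriv f (ddt f)"
  by (rule C2_with_derivI[where ?f2.0="ddt (ddt f)"]) (intro smooth_deriv smooth_continuous; assumption)+

lemma ddt_periodic:
  fixes f :: "real \<Rightarrow> 'a::real_normed_vector"
  assumes "\<And>s. f (s + L) = f s" "\<And>s. (f has_vector_derivative f' s) (at s)"
  shows "ddt f (s + L) = ddt f s"
proof -
  have "((\<lambda>h. f (L + h)) has_vector_derivative f' (L + s)) (at s)"
    by (rule shifted_vector_derivative) (rule assms)
  moreover have "(\<lambda>h. f (L + h)) = f" using assms(1) by (simp add: add.commute)
  ultimately have "ddt f s = f' (L + s)" unfolding ddt_def by (simp add: vector_derivative_at)
  moreover have "ddt f (s + L) = f' (s + L)" unfolding ddt_def by (intro vector_derivative_at assms)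
  ultimately show ?thesis by (simp add: add.commute)
qed

lemma ddt_eqI: "(f has_vector_derivative f') (at t) \<Longrightarrow> ddt f t = f'"
  unfolding ddt_def by (rule vector_derivative_at)

section \<open>Frenet formula and chord-arc bound for a closed curve\<close>

locale closed_curve =
  fixes \<gamma> :: "real \<Rightarrow> real^2" and L :: real
  assumes L_pos: "0 < L" and smooth_curve: "smooth \<gamma>"
    and periodic: "\<And>t. \<gamma> (t + L) = \<gamma> t" and regular: "\<And>t. ddt \<gamma> t \<noteq> 0"
    and inj: "inj_on \<gamma> {0..<L}"
begin

definition "speed t = norm (ddt \<gamma> t)"
definition "speed1 t = (ddt \<gamma> t \<bullet> ddt (ddt \<gamma>) t) / speed t"
text \<open>Using the reciprocal speed and writing its derivative as a polynomial in it reduces the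
  second derivatives of speed and normal to the product rule.\<close>

definition "inv_speed t = 1 / speed t"
definition "inv_speed1 t = - (ddt \<gamma> t \<bullet> ddt (ddt \<gamma>) t) * inv_speed t ^ 3"

lemma speed_pos: "speed t > 0"
  using regular by (simp add: speed_def)

lemma curve_derivs:
  shows "(\<gamma> has_vector_derivative ddt \<gamma> t) (at t)"
    and "(ddt \<gamma> has_vector_derivative ddt (ddt \<gamma>) t) (at t)"
    and "(ddt (ddt \<gamma>) has_vector_derivative ddt (ddt (ddt \<gamma>)) t) (at t)"
    and "continuous_on S \<gamma>" "continuous_on S (ddt \<gamma>)" "continuous_on S (ddt (ddt \<gamma>))"
      "continuous_on S (ddt (ddt (ddt \<gamma>)))"
  by (intro smooth_deriv smooth_continuous smooth_curve)+

lemma inner_vector_derivative: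
  fixes f g :: "real \<Rightarrow> real^2"
  assumes "(f has_vector_derivative f') (at t)" "(g has_vector_derivative g') (at t)"
  shows "((\<lambda>t. f t \<bullet> g t) has_real_derivative f t \<bullet> g' + f' \<bullet> g t) (at t)"
  using has_derivative_inner[OF assms[unfolded has_vector_derivative_def]]
  unfolding has_field_derivative_def by (rule has_derivative_eq_rhs) (auto simp: fun_eq_iff algebra_simps)

lemma norm_vector_derivative:
  fixes f :: "real \<Rightarrow> real^2"
  assumes "(f has_vector_derivative f') (at t)" "f t \<noteq> 0"
  shows "((\<lambda>t. norm (f t)) has_real_derivative (f t \<bullet> f') / norm (f t)) (at t)"
proof -
  have "((\<lambda>t. sqrt (f t \<bullet> f t)) has_real_derivative (inverse (sqrt (f t \<bullet> f t)) / 2) * (f t \<bullet> f' + f' \<bullet> f t)) (at t)"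
    by (rule DERIV_chain2[OF DERIV_real_sqrt inner_vector_derivative[OF assms(1) assms(1)]]) (use assms(2) in simp)
  moreover have "inverse (sqrt (f t \<bullet> f t)) / 2 * (f t \<bullet> f' + f' \<bullet> f t) = (f t \<bullet> f') / norm (f t)"
    unfolding norm_eq_sqrt_inner[of "f t"] inner_commute[of f'] by (simp add: inverse_eq_divide)
  ultimately show ?thesis by (simp only: norm_eq_sqrt_inner[abs_def])
qed

lemma speed_deriv: "(speed has_real_derivative speed1 t) (at t)"
  unfolding speed_def[abs_def] speed1_def by (rule norm_vector_derivative[OF curve_derivs(2) regular])

lemma inv_speed_deriv: "(inv_speed has_real_derivative inv_speed1 t) (at t)"
proof -
  have "((\<lambda>t. 1 / speed t) has_real_derivative - speed1 t / (speed t)\<^sup>2) (at t)"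
    using DERIV_divide[OF DERIV_const[of 1] speed_deriv[of t]] speed_pos[of t] by (simp add: power2_eq_square)
  moreover have "- speed1 t / (speed t)\<^sup>2 = inv_speed1 t"
    using speed_pos[of t] unfolding speed1_def inv_speed1_def inv_speed_def
    by (simp add: power_divide power2_eq_square power3_eq_cube del: divide_eq_eq)
  ultimately show ?thesis unfolding inv_speed_def[abs_def] by simp
qed

lemmas speed_deriv_vec = speed_deriv[unfolded has_real_derivative_iff_has_vector_derivative]
lemmas inv_speed_deriv_vec = inv_speed_deriv[unfolded has_real_derivative_iff_has_vector_derivative]

lemma cont_speed_inv_speed: "continuous_on S speed" "continuous_on S inv_speed"
  by (rule continuous_on_of_vector_derivative, rule speed_deriv_vec inv_speed_deriv_vec)+

lemma inv_speed_C2: "C2_with_deriv inv_speed inv_speed1"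
proof (rule C2_with_derivI)
  let ?w = "\<lambda>t. ddt \<gamma> t \<bullet> ddt (ddt \<gamma>) t"
  let ?w' = "\<lambda>t. ddt \<gamma> t \<bullet> ddt (ddt (ddt \<gamma>)) t + ddt (ddt \<gamma>) t \<bullet> ddt (ddt \<gamma>) t"
  show "(inv_speed has_vector_derivative inv_speed1 t) (at t)" for t by (rule inv_speed_deriv_vec)
  have "(inv_speed1 has_real_derivative - ?w' t * inv_speed t ^ 3 - ?w t * (3 * inv_speed t ^ 2 * inv_speed1 t)) (at t)" for t
    unfolding inv_speed1_def[abs_def]
    by (rule derivative_eq_intros inner_vector_derivative curve_derivs inv_speed_deriv refl | simp add: inv_speed1_def)+
  then show "(inv_speed1 has_vector_derivative - ?w' t * inv_speed t ^ 3 - ?w t * (3 * inv_speed t ^ 2 * inv_speed1 t)) (at t)" for t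
    by (simp add: has_real_derivative_iff_has_vector_derivative)
  show "continuous_on UNIV (\<lambda>t. - ?w' t * inv_speed t ^ 3 - ?w t * (3 * inv_speed t ^ 2 * inv_speed1 t))"
    unfolding inv_speed1_def by (intro continuous_intros curve_derivs cont_speed_inv_speed)
qed

lemma speed_C2: "C2_with_deriv speed speed1"
proof (rule C2_with_derivI)
  let ?w = "\<lambda>t. ddt \<gamma> t \<bullet> ddt (ddt \<gamma>) t"
  let ?w' = "\<lambda>t. ddt \<gamma> t \<bullet> ddt (ddt (ddt \<gamma>)) t + ddt (ddt \<gamma>) t \<bullet> ddt (ddt \<gamma>) t"
  show "(speed has_vector_derivative speed1 t) (at t)" for t by (rule speed_deriv_vec)
  have "speed1 = (\<lambda>t. ?w t * inv_speed t)" by (simp add: speed1_def inv_speed_def fun_eq_iff)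
  then have "(speed1 has_real_derivative ?w' t * inv_speed t + ?w t * inv_speed1 t) (at t)" for t
    by (simp only:) (rule derivative_eq_intros inner_vector_derivative curve_derivs inv_speed_deriv refl | simp)+
  then show "(speed1 has_vector_derivative ?w' t * inv_speed t + ?w t * inv_speed1 t) (at t)" for t
    by (simp add: has_real_derivative_iff_has_vector_derivative)
  show "continuous_on UNIV (\<lambda>t. ?w' t * inv_speed t + ?w t * inv_speed1 t)"
    unfolding inv_speed1_def by (intro continuous_intros curve_derivs cont_speed_inv_speed)
qed

lemma rot_ddt_C2: "C2_with_deriv (\<lambda>t. rot (ddt \<gamma> t)) (\<lambda>t. rot (ddt (ddt \<gamma>) t))"
proof (rule C2_with_derivI)
  interpret bounded_linear rot by (rule bounded_linear_rot)
  show "((\<lambda>t. rot (ddt \<gamma> t)) has_vector_derivative rot (ddt (ddt \<gamma>) t)) (at t)" for t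
    by (rule has_vector_derivative[OF curve_derivs(2)])
  show "((\<lambda>t. rot (ddt (ddt \<gamma>) t)) has_vector_derivative rot (ddt (ddt (ddt \<gamma>)) t)) (at t)" for t
    by (rule has_vector_derivative[OF curve_derivs(3)])
  show "continuous_on UNIV (\<lambda>t. rot (ddt (ddt (ddt \<gamma>)) t))"
    by (intro continuous_on curve_derivs)
qed

text \<open>The Frenet formula dn/ds = \<kappa> \<tau> for an arbitrary parameter: the factor
  |\<gamma>'| from the chain rule turns \<tau> into \<gamma>'. The sign is positive because n is the
  clockwise rotation of \<tau>.\<close>

lemma normal_C2: "C2_with_deriv (normal \<gamma>) (\<lambda>t. curvature \<gamma> t *\<^sub>R ddt \<gamma> t)"
proof -
  have 1: "(\<lambda>t. inv_speed t *\<^sub>R rot (ddt \<gamma> t)) = normal \<gamma>"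
    by (simp add: fun_eq_iff normal_eq_rot inv_speed_def speed_def)
  have 2: "inv_speed t *\<^sub>R rot (ddt (ddt \<gamma>) t) + inv_speed1 t *\<^sub>R rot (ddt \<gamma> t) = curvature \<gamma> t *\<^sub>R ddt \<gamma> t" for t
  proof -
    define a b where "a = ddt \<gamma> t" and "b = ddt (ddt \<gamma>) t"
    have s: "speed t > 0" "speed t ^ 2 = a $ 1 * a $ 1 + a $ 2 * a $ 2"
      using speed_pos by (simp_all add: speed_def a_def power2_norm_eq_inner inner_real2)
    have c: "curvature \<gamma> t = (a $ 1 * b $ 2 - a $ 2 * b $ 1) / speed t ^ 3"
      by (simp add: curvature_def a_def b_def speed_def)
    have w: "inv_speed t = (a $ 1 * a $ 1 + a $ 2 * a $ 2) / speed t ^ 3"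
      using s(1) unfolding s(2)[symmetric] by (simp add: inv_speed_def power2_eq_square power3_eq_cube)
    have w1: "inv_speed1 t = - (a $ 1 * b $ 1 + a $ 2 * b $ 2) / speed t ^ 3"
      by (simp add: inv_speed1_def inv_speed_def a_def b_def inner_real2 power_divide)
    show ?thesis
      unfolding c w w1 a_def[symmetric] b_def[symmetric]
      by (simp add: vec_eq_iff forall_2 diff_divide_distrib[symmetric] add_divide_distrib[symmetric]
          minus_divide_left del: divide_eq_eq) (simp add: algebra_simps)
  qed
  show ?thesis using C2_with_deriv_scaleR[OF inv_speed_C2 rot_ddt_C2] by (simp add: 1 2)
qed

lemma curve_C2: "C2_with_deriv \<gamma> (ddt \<gamma>)" and tangent_C2: "C2_with_deriv (ddt \<gamma>) (ddt (ddt \<gamma>))"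
  by (intro smooth_C2 smooth_curve smooth_deriv)+

lemma ddt_curve_periodic: "ddt \<gamma> (s + L) = ddt \<gamma> s"
  by (rule ddt_periodic[OF periodic curve_derivs(1)])

lemma normal_periodic: "normal \<gamma> (s + L) = normal \<gamma> s"
  by (simp add: normal_eq_rot ddt_curve_periodic)

text \<open>Injectivity is given on [0, L), while t + h ranges over [-L/2, 3L/2]. Moving each
  parameter by at most one period brings it into [0, L); equal points then force h = 0 or |h| to be
  L or 2 L, and |h| <= L/2.\<close>

lemma chord_nonzero:
  assumes "t \<in> {0..L}" "h \<in> {-(L/2)..L/2} - {0}"
  shows "\<gamma> (t + h) \<noteq> \<gamma> t"
proof
  assume eq: "\<gamma> (t + h) = \<gamma> t"
  have red: "\<exists>x'\<in>{0..<L}. \<gamma> x' = \<gamma> x \<and> (x' = x \<or> x' = x + L \<or> x' = x - L)" if "-L \<le> x" "x < 2 * L" for x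
  proof -
    consider "x < 0" | "0 \<le> x" "x < L" | "L \<le> x" by linarith
    then show ?thesis
    proof cases
      case 1 then show ?thesis using that periodic[of x] by (intro bexI[of _ "x + L"]) auto
    next
      case 2 then show ?thesis by (intro bexI[of _ x]) auto
    next
      case 3 then show ?thesis using that periodic[of "x - L"] by (intro bexI[of _ "x - L"]) auto
    qed
  qed
  obtain x where x: "x \<in> {0..<L}" "\<gamma> x = \<gamma> t" "x = t \<or> x = t + L \<or> x = t - L"
    using red[of t] assms L_pos by auto
  obtain y where y: "y \<in> {0..<L}" "\<gamma> y = \<gamma> (t + h)" "y = t + h \<or> y = t + h + L \<or> y = t + h - L"
    using red[of "t + h"] assms L_pos by auto
  have "x = y" using inj_onD[OF inj, of x y] x y eq by simp
  then have "h = 0 \<or> \<bar>h\<bar> = L \<or> \<bar>h\<bar> = 2 * L" using x(3) y(3) L_pos by auto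
  then show False using assms(2) L_pos by auto
qed

text \<open>The quotient of chord length and |h|, completed by the speed at h = 0, is continuous and
  positive on a compact interval; c is its minimum.\<close>

lemma chord_lower_bound:
  assumes "t \<in> {0..L}"
  obtains c where "c > 0" "\<And>h. \<bar>h\<bar> \<le> L/2 \<Longrightarrow> c * \<bar>h\<bar> \<le> norm (\<gamma> (t + h) - \<gamma> t)"
proof -
  define g where "g h = (if h = 0 then speed t else norm (\<gamma> (t + h) - \<gamma> t) / \<bar>h\<bar>)" for h
  have d: "((\<lambda>h. (\<gamma> (t + h) - \<gamma> t) /\<^sub>R h) \<longlongrightarrow> ddt \<gamma> t) (at 0)"
  proof -
    have "((\<lambda>h. norm (\<gamma> (t + h) - \<gamma> t - h *\<^sub>R ddt \<gamma> t) / norm h) \<longlongrightarrow> 0) (at 0)"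
      using curve_derivs(1)[of t] unfolding has_vector_derivative_def has_derivative_at by simp
    then have "((\<lambda>h. norm ((\<gamma> (t + h) - \<gamma> t) /\<^sub>R h - ddt \<gamma> t)) \<longlongrightarrow> 0) (at 0)"
    proof (rule Lim_transform_eventually)
      show "\<forall>\<^sub>F h in at 0. norm (\<gamma> (t + h) - \<gamma> t - h *\<^sub>R ddt \<gamma> t) / norm h = norm ((\<gamma> (t + h) - \<gamma> t) /\<^sub>R h - ddt \<gamma> t)"
      proof (rule eventually_at_filter[THEN iffD2], rule always_eventually, intro allI impI)
        fix h :: real assume "h \<noteq> 0"
        then have "\<gamma> (t + h) - \<gamma> t - h *\<^sub>R ddt \<gamma> t = h *\<^sub>R ((\<gamma> (t + h) - \<gamma> t) /\<^sub>R h - ddt \<gamma> t)"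
          by (simp add: algebra_simps)
        then show "norm (\<gamma> (t + h) - \<gamma> t - h *\<^sub>R ddt \<gamma> t) / norm h = norm ((\<gamma> (t + h) - \<gamma> t) /\<^sub>R h - ddt \<gamma> t)"
          using \<open>h \<noteq> 0\<close> by (simp only: norm_scaleR) simp
      qed
    qed
    then show ?thesis by (simp add: tendsto_norm_zero_iff LIM_zero_iff)
  qed
  have "continuous_on {-(L/2)..L/2} g"
  proof (intro continuous_at_imp_continuous_on ballI)
    fix h :: real
    show "isCont g h"
    proof (cases "h = 0")
      case True
      have "((\<lambda>h. norm ((\<gamma> (t + h) - \<gamma> t) /\<^sub>R h)) \<longlongrightarrow> speed t) (at 0)"
        unfolding speed_def by (intro tendsto_norm d)
      then have "(g \<longlongrightarrow> speed t) (at 0)"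
        by (rule Lim_transform_eventually) (auto simp: g_def eventually_at_filter divide_inverse mult.commute)
      then show ?thesis using True by (simp add: isCont_def g_def)
    next
      case False
      have "\<forall>\<^sub>F x in nhds h. x \<noteq> 0" using False by (rule t1_space_nhds)
      then have "\<forall>\<^sub>F x in nhds h. norm (\<gamma> (t + x) - \<gamma> t) / \<bar>x\<bar> = g x"
        by eventually_elim (simp add: g_def)
      moreover have "isCont (\<lambda>x. norm (\<gamma> (t + x) - \<gamma> t) / \<bar>x\<bar>) h"
        using False has_vector_derivative_continuous[OF shifted_vector_derivative[OF curve_derivs(1)]]
        by (intro continuous_intros) auto
      ultimately show ?thesis by (simp add: isCont_cong)
    qed
  qed
  then obtain x where x: "x \<in> {-(L/2)..L/2}" "\<And>h. h \<in> {-(L/2)..L/2} \<Longrightarrow> g x \<le> g h"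
    using continuous_attains_inf[of "{-(L/2)..L/2}" g] L_pos by auto
  have "g x > 0" using chord_nonzero[OF assms, of x] x(1) speed_pos by (auto simp: g_def)
  moreover have "g x * \<bar>h\<bar> \<le> norm (\<gamma> (t + h) - \<gamma> t)" if "\<bar>h\<bar> \<le> L/2" for h
    using x(2)[of h] that by (cases "h = 0") (auto simp: g_def field_simps abs_if split: if_splits)
  ultimately show ?thesis by (rule that)
qed

end

section \<open>Differentiating the perturbed integral\<close>

text \<open>With the cut-off moved into the integrand G, G is periodic on the whole line and the
  window can be recentred at t. F has to agree with the integrand only off 0, because for \<delta> >
  0 the point h = 0 is always cut out.\<close>

lemma truncated_integral_shift:
  fixes g :: "real \<Rightarrow> real^2" and f F :: "real \<Rightarrow> complex"
  assumes t: "t \<in> {0..L}"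
    and per: "\<And>s. g (s + L) = g s" "\<And>s. f (s + L) = f s" "\<And>s. ddt g (s + L) = ddt g s"
    and g: "continuous_on UNIV g" and F: "continuous_on ({-(L/2)..L/2} - {0}) F"
    and eq: "\<And>h. h \<in> {-(L/2)..L/2} - {0} \<Longrightarrow> f (t + h) * of_real (norm (ddt g (t + h))) = F h"
    and "\<delta> > 0"
  shows "truncated_integral g L t f \<delta> = (LINT h:{h\<in>{-(L/2)..L/2}. \<delta> < norm (g (t + h) - g t)}|lborel. F h)"
proof -
  let ?r = "\<lambda>h. norm (g (t + h) - g t)"
  let ?S = "{h\<in>{-(L/2)..L/2}. \<delta> < ?r h}"
  define G where "G s = indicator {s. \<delta> < dist (g t) (g s)} s *\<^sub>R (f s * of_real (norm (ddt g s)))" for s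
  have "truncated_integral g L t f \<delta> = (LINT s:{0..L}|lborel. G s)"
    unfolding truncated_integral_def set_lebesgue_integral_def G_def
    by (rule Bochner_Integration.integral_cong) (auto split: split_indicator)
  moreover have GF: "indicator {-(L/2)..L/2} h *\<^sub>R G (t + h) = indicator ?S h *\<^sub>R F h" for h
    using eq[of h] \<open>\<delta> > 0\<close> by (cases "h = 0") (auto simp: G_def dist_norm norm_minus_commute split: split_indicator)
  have "continuous_on UNIV ?r" by (intro continuous_intros continuous_on_compose2[OF g]) auto
  then have "set_integrable lborel ?S F"
    by (intro truncated_integrable F \<open>\<delta> > 0\<close>) auto
  then have "set_integrable lborel {-(L/2)..L/2} (\<lambda>h. G (t + h))"
    unfolding set_integrable_def GF .
  moreover have "G (s + L) = G s" for s by (simp add: G_def per indicator_def)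
  ultimately have "truncated_integral g L t f \<delta> = (LINT h:{-(L/2)..L/2}|lborel. G (t + h))"
    using set_integral_period[of G L t] t by simp
  also have "\<dots> = (LINT h:?S|lborel. F h)" unfolding set_lebesgue_integral_def GF ..
  finally show ?thesis .
qed

lemma pv_integral_shift:
  fixes g :: "real \<Rightarrow> real^2" and f F :: "real \<Rightarrow> complex"
  assumes t: "t \<in> {0..L}"
    and per: "\<And>s. g (s + L) = g s" "\<And>s. f (s + L) = f s" "\<And>s. ddt g (s + L) = ddt g s"
    and g: "continuous_on UNIV g" and F: "continuous_on ({-(L/2)..L/2} - {0}) F"
    and eq: "\<And>h. h \<in> {-(L/2)..L/2} - {0} \<Longrightarrow> f (t + h) * of_real (norm (ddt g (t + h))) = F h"
    and inj: "\<And>h. h \<in> {-(L/2)..L/2} - {0} \<Longrightarrow> g (t + h) \<noteq> g t"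
    and int: "set_integrable lborel {-(L/2)..L/2} F"
  shows "(truncated_integral g L t f \<longlongrightarrow> (LINT h:{-(L/2)..L/2}|lborel. F h)) (at_right 0)"
    and "pv_integral g L t f = (LINT h:{-(L/2)..L/2}|lborel. F h)"
proof -
  let ?r = "\<lambda>h. norm (g (t + h) - g t)"
  have "continuous_on UNIV ?r" by (intro continuous_intros continuous_on_compose2[OF g]) auto
  then have "((\<lambda>\<delta>. LINT h:{h\<in>{-(L/2)..L/2}. \<delta> < ?r h}|lborel. F h) \<longlongrightarrow> (LINT h:{-(L/2)..L/2}|lborel. F h)) (at_right 0)"
    by (intro truncated_tendsto int borel_measurable_continuous_onI) (use inj in auto)
  then show lim: "(truncated_integral g L t f \<longlongrightarrow> (LINT h:{-(L/2)..L/2}|lborel. F h)) (at_right 0)"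
  proof (rule Lim_transform_eventually)
    show "\<forall>\<^sub>F \<delta> in at_right 0. (LINT h:{h\<in>{-(L/2)..L/2}. \<delta> < ?r h}|lborel. F h) = truncated_integral g L t f \<delta>"
      using eventually_at_right_less[of "0::real"]
    proof eventually_elim
      case (elim \<delta>)
      show ?case by (rule truncated_integral_shift[symmetric, OF t per g F eq elim])
    qed
  qed
  show "pv_integral g L t f = (LINT h:{-(L/2)..L/2}|lborel. F h)"
    unfolding pv_integral_def by (rule tendsto_Lim[OF _ lim]) simp
qed

text \<open>Two expansions have the same divergent coefficient: \<delta> times their difference is
  the constant c - d up to terms tending to 0. Only with this uniqueness does the definite
  description denote the limit.\<close>

lemma fp_integral_eqI:
  assumes "((\<lambda>\<delta>. truncated_integral \<gamma> L t f \<delta> - c / of_real \<delta>) \<longlongrightarrow> v) (at_right 0)"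
  shows "fp_integral \<gamma> L t f = v"
  unfolding fp_integral_def
proof (rule the_equality)
  show "\<exists>c. ((\<lambda>\<delta>. truncated_integral \<gamma> L t f \<delta> - c / of_real \<delta>) \<longlongrightarrow> v) (at_right 0)"
    using assms by blast
  fix w assume "\<exists>c. ((\<lambda>\<delta>. truncated_integral \<gamma> L t f \<delta> - c / of_real \<delta>) \<longlongrightarrow> w) (at_right 0)"
  then obtain d where d: "((\<lambda>\<delta>. truncated_integral \<gamma> L t f \<delta> - d / of_real \<delta>) \<longlongrightarrow> w) (at_right 0)" by blast
  have z: "((\<lambda>\<delta>. complex_of_real \<delta>) \<longlongrightarrow> 0) (at_right 0)"
    using tendsto_of_real[OF tendsto_ident_at, of 0 "{0<..}"] by simp
  have "((\<lambda>\<delta>. of_real \<delta> * ((truncated_integral \<gamma> L t f \<delta> - d / of_real \<delta>) - (truncated_integral \<gamma> L t f \<delta> - c / of_real \<delta>))) \<longlongrightarrow> 0 * (w - v)) (at_right 0)"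
    by (intro tendsto_mult z tendsto_diff d assms)
  moreover have "\<forall>\<^sub>F \<delta> in at_right (0::real). of_real \<delta> * ((truncated_integral \<gamma> L t f \<delta> - d / of_real \<delta>) - (truncated_integral \<gamma> L t f \<delta> - c / of_real \<delta>)) = c - d"
    using eventually_at_right_less[of "0::real"]
  proof eventually_elim
    case (elim \<delta>)
    have "x * ((y - d / x) - (y - c / x)) = c - d" if "x \<noteq> 0" for x y :: complex
      using that by (simp add: right_diff_distrib)
    from this[of "of_real \<delta>"] show ?case using elim by simp
  qed
  ultimately have "((\<lambda>\<delta>. c - d) \<longlongrightarrow> 0 * (w - v)) (at_right (0::real))"
    by (rule Lim_transform_eventually)
  then have "c = d" by (simp add: tendsto_const_iff)
  then show "w = v" using tendsto_unique[OF _ d] assms by simp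
qed

lemma continuous_on_shift:
  fixes f :: "real \<Rightarrow> 'a::topological_space"
  assumes "continuous_on UNIV f"
  shows "continuous_on S (\<lambda>h. f (t + h))"
  by (rule continuous_on_compose2[OF assms]) (auto intro: continuous_intros)

lemma continuous_on_G:
  assumes "k > 0"
  shows "continuous_on {0<..} (G1 k)" "continuous_on {0<..} (G2 k)"
proof -
  show "continuous_on {0<..} (G1 k)"
    by (intro continuous_at_imp_continuous_on ballI has_vector_derivative_continuous[OF G1_deriv]) (use assms in auto)
  have p: "continuous_on {0<..} psi" "continuous_on {0<..} psi'"
    by (intro continuous_at_imp_continuous_on ballI has_vector_derivative_continuous[OF psi_deriv]
        has_vector_derivative_continuous[OF psi'_deriv]; simp)+
  have "continuous_on {0<..} psi''"
    unfolding psi''_def[abs_def] by (intro continuous_intros p) auto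
  then have "continuous_on {0<..} (\<lambda>u. psi'' (k\<^sup>2 * u))"
    by (rule continuous_on_compose2) (use assms in \<open>auto intro: continuous_on_mult_left continuous_on_id\<close>)
  then show "continuous_on {0<..} (G2 k)"
    unfolding G2_def[abs_def] by (rule continuous_on_mult_left)
qed

section \<open>Uniform bounds for the perturbed integrand\<close>

locale density_on_curve = closed_curve +
  fixes k :: real and \<nu> :: "real \<Rightarrow> real" and \<sigma> :: "real \<Rightarrow> complex" and t :: real
  assumes k_pos: "0 < k" and smooth_\<nu>: "smooth \<nu>" and \<nu>_periodic: "\<And>s. \<nu> (s + L) = \<nu> s"
    and hoelder: "C1_hoelder \<sigma>" and \<sigma>_periodic: "\<And>s. \<sigma> (s + L) = \<sigma> s"
    and t_mem: "t \<in> {0..L}"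
begin

text \<open>The displacement field of the perturbation; the form of its derivative rests on the
  Frenet formula \<open>normal_C2\<close>.\<close>

definition "q s = \<nu> s *\<^sub>R normal \<gamma> s"
definition "q1 s = \<nu> s *\<^sub>R (curvature \<gamma> s *\<^sub>R ddt \<gamma> s) + ddt \<nu> s *\<^sub>R normal \<gamma> s"

text \<open>In the chord coordinate \<open>h = s - t\<close>, the perturbed curve has chord \<open>\<Delta>\<close>, and the integrand of
  \<^const>\<open>S_prime\<close> is \<open>F\<close>, with \<open>F'\<close> its derivative in \<open>\<epsilon>\<close>.\<close>

definition "\<Delta> e h = (\<gamma> (t + h) - \<gamma> t) + e *\<^sub>R (q (t + h) - q t)"
definition "U e h = \<Delta> e h \<bullet> \<Delta> e h"
text \<open>\<open>N e\<close> is the unit normal of the perturbed curve times its speed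
  \<open>V e\<close>. The normalisation is deferred to \<open>P\<close>, which also carries the
  arc-length factor \<open>W\<close>. The minus sign in \<open>M\<close> is there because the chord
  \<open>\<Delta>\<close> points from x to y, whereas the gradient involves x - y.\<close>

definition "N e = rot (ddt \<gamma> t + e *\<^sub>R q1 t)"
definition "M e h = - (\<Delta> e h \<bullet> N e)"
definition "M' e h = - ((q (t + h) - q t) \<bullet> N e + \<Delta> e h \<bullet> rot (q1 t))"
definition "V e = norm (ddt \<gamma> t + e *\<^sub>R q1 t)"
definition "V' e = ((ddt \<gamma> t + e *\<^sub>R q1 t) \<bullet> q1 t) / V e"
definition "W e h = norm (ddt \<gamma> (t + h) + e *\<^sub>R q1 (t + h))"
definition "W' e h = ((ddt \<gamma> (t + h) + e *\<^sub>R q1 (t + h)) \<bullet> q1 (t + h)) / W e h"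
definition "P e h = M e h * W e h / V e"
definition "P' e h = (M' e h * W e h + M e h * W' e h) / V e - M e h * W e h * V' e / (V e)\<^sup>2"
definition "F \<kappa> e h = 2 * (G1 \<kappa> (U e h) * of_real (P e h)) * \<sigma> (t + h)"
definition "F' e h = 2 * (of_real (2 * (\<Delta> e h \<bullet> (q (t + h) - q t))) * G2 k (U e h) * of_real (P e h)
    + G1 k (U e h) * of_real (P' e h)) * \<sigma> (t + h)"

lemma q_C2: "C2_with_deriv q q1"
  using C2_with_deriv_scaleR[OF smooth_C2[OF smooth_\<nu>] normal_C2] by (simp add: q_def[abs_def] q1_def[abs_def])

lemma \<sigma>_cont: "continuous_on S \<sigma>"
  using hoelder unfolding C1_hoelder_def
  by (meson continuous_at_imp_continuous_on differentiable_imp_continuous_within)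

lemma cont_basic [continuous_intros]:
  "continuous_on S (\<Delta> e)" "continuous_on S (\<lambda>h. q (t + h))" "continuous_on S (\<lambda>h. q1 (t + h))"
  "continuous_on S (\<lambda>h. \<gamma> (t + h))" "continuous_on S (\<lambda>h. ddt \<gamma> (t + h))"
  "continuous_on S (\<lambda>h. \<sigma> (t + h))" "continuous_on S (U e)" "continuous_on S (M e)" "continuous_on S (W e)"
  "continuous_on S (M' e)"
proof -
  show c1: "continuous_on S (\<lambda>h. q (t + h))" for S
    by (rule continuous_on_shift[OF C2_with_derivD(2)[OF q_C2]])
  show c2: "continuous_on S (\<lambda>h. q1 (t + h))" for S
    by (rule continuous_on_shift[OF C2_with_derivD(3)[OF q_C2]])
  show c3: "continuous_on S (\<lambda>h. \<gamma> (t + h))" for S by (rule continuous_on_shift[OF curve_derivs(4)])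
  show c4: "continuous_on S (\<lambda>h. ddt \<gamma> (t + h))" for S by (rule continuous_on_shift[OF curve_derivs(5)])
  show "continuous_on S (\<lambda>h. \<sigma> (t + h))" by (rule continuous_on_shift[OF \<sigma>_cont])
  show c5: "continuous_on S (\<Delta> e)" for S
    unfolding \<Delta>_def[abs_def] by (intro continuous_intros c1 c3)
  show "continuous_on S (U e)" "continuous_on S (M e)" "continuous_on S (M' e)" "continuous_on S (W e)"
    unfolding U_def[abs_def] M_def[abs_def] M'_def[abs_def] W_def[abs_def]
    by (intro continuous_intros c5 c1 c2 c4)+
qed

text \<open>The linear part h (\<gamma>' + e q1) of the chord is orthogonal to its own rotation, so
  \<open>M\<close> is O(h^2) by Taylor's formula. For \<open>M'\<close> the linear parts of the two
  summands cancel each other.\<close>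

lemma local_bounds:
  obtains e0 c K where "e0 > 0" "c > 0" "K > 0"
    "\<And>e h. \<bar>e\<bar> < e0 \<Longrightarrow> \<bar>h\<bar> \<le> L/2 \<Longrightarrow> c * \<bar>h\<bar> \<le> norm (\<Delta> e h) \<and> norm (\<Delta> e h) \<le> K * \<bar>h\<bar>"
    "\<And>e h. \<bar>e\<bar> < e0 \<Longrightarrow> \<bar>h\<bar> \<le> L/2 \<Longrightarrow> c \<le> V e \<and> c \<le> W e h \<and> W e h \<le> K \<and> \<bar>V' e\<bar> \<le> K \<and> \<bar>W' e h\<bar> \<le> K"
    "\<And>e h. \<bar>e\<bar> < e0 \<Longrightarrow> \<bar>h\<bar> \<le> L/2 \<Longrightarrow> norm (q (t + h) - q t) \<le> K * \<bar>h\<bar> \<and> \<bar>M e h\<bar> \<le> K * h\<^sup>2 \<and> \<bar>M' e h\<bar> \<le> K * h\<^sup>2"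
proof -
  obtain c0 where c0: "c0 > 0" "\<And>h. \<bar>h\<bar> \<le> L/2 \<Longrightarrow> c0 * \<bar>h\<bar> \<le> norm (\<gamma> (t + h) - \<gamma> t)"
    using chord_lower_bound[OF t_mem] by metis
  obtain s0 where s0: "s0 > 0" "\<And>h. \<bar>h\<bar> \<le> L/2 \<Longrightarrow> s0 \<le> norm (ddt \<gamma> (t + h))"
  proof -
    have "continuous_on {-(L/2)..L/2} (\<lambda>h. norm (ddt \<gamma> (t + h)))" by (intro continuous_intros)
    then obtain x where x: "x \<in> {-(L/2)..L/2}" "\<And>h. h \<in> {-(L/2)..L/2} \<Longrightarrow> norm (ddt \<gamma> (t + x)) \<le> norm (ddt \<gamma> (t + h))"
      using continuous_attains_inf[of "{-(L/2)..L/2}" "\<lambda>h. norm (ddt \<gamma> (t + h))"] L_pos by auto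
    show ?thesis
    proof (rule that)
      show "norm (ddt \<gamma> (t + x)) > 0" using regular by simp
      fix h assume "\<bar>h\<bar> \<le> L/2"
      then show "norm (ddt \<gamma> (t + x)) \<le> norm (ddt \<gamma> (t + h))" by (intro x(2)) auto
    qed
  qed
  obtain A where A: "A \<ge> 0" "\<And>h. \<bar>h\<bar> \<le> L/2 \<Longrightarrow> norm (ddt \<gamma> (t + h)) \<le> A"
    "\<And>h. \<bar>h\<bar> \<le> L/2 \<Longrightarrow> norm (\<gamma> (t + h) - \<gamma> t) \<le> A * \<bar>h\<bar>"
    "\<And>h. \<bar>h\<bar> \<le> L/2 \<Longrightarrow> norm (\<gamma> (t + h) - \<gamma> t - h *\<^sub>R ddt \<gamma> t) \<le> A * h\<^sup>2"
    using C2_taylor[OF curve_C2, of "L/2" t] by metis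
  obtain B where B: "B \<ge> 0" "\<And>h. \<bar>h\<bar> \<le> L/2 \<Longrightarrow> norm (q1 (t + h)) \<le> B"
    "\<And>h. \<bar>h\<bar> \<le> L/2 \<Longrightarrow> norm (q (t + h) - q t) \<le> B * \<bar>h\<bar>"
    "\<And>h. \<bar>h\<bar> \<le> L/2 \<Longrightarrow> norm (q (t + h) - q t - h *\<^sub>R q1 t) \<le> B * h\<^sup>2"
    using C2_taylor[OF q_C2, of "L/2" t] by metis
  have A0: "norm (ddt \<gamma> t) \<le> A" and B0: "norm (q1 t) \<le> B" and s00: "s0 \<le> norm (ddt \<gamma> t)"
    using A(2)[of 0] B(2)[of 0] s0(2)[of 0] L_pos by auto
  define c1 where "c1 = min c0 s0"
  \<comment> \<open>With this choice |e| B <= c1/2, so the perturbation consumes at most half of the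
    lower bounds for chord and speed; the 1 keeps the upper bounds at A + B.\<close>
  define e0 where "e0 = min 1 (c1 / (2 * (B + 1)))"
  have c1: "c1 > 0" "c1 \<le> c0" "c1 \<le> s0" using c0 s0 by (auto simp: c1_def)
  have e0: "e0 > 0" using c1 B by (simp add: e0_def)
  have eB: "\<bar>e\<bar> * B \<le> c1 / 2" "\<bar>e\<bar> \<le> 1" if "\<bar>e\<bar> < e0" for e
  proof -
    have "\<bar>e\<bar> * B \<le> c1 / (2 * (B + 1)) * (B + 1)"
      using that B c1 by (intro mult_mono) (auto simp: e0_def)
    also have "\<dots> = c1 / 2" using B(1) by (simp add: divide_simps)
    finally show "\<bar>e\<bar> * B \<le> c1 / 2" .
    show "\<bar>e\<bar> \<le> 1" using that by (simp add: e0_def)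
  qed
  have low: "c1 / 2 * x \<le> norm (y + e *\<^sub>R z)" if "\<bar>e\<bar> < e0" "c1 * x \<le> norm y" "norm z \<le> B * x" "0 \<le> x" for e x :: real and y z :: "real^2"
  proof -
    have "\<bar>e\<bar> * norm z \<le> \<bar>e\<bar> * (B * x)" using that by (intro mult_left_mono) auto
    also have "\<dots> \<le> c1 / 2 * x" using mult_right_mono[OF eB(1)[OF that(1)] that(4)] by (simp add: mult.assoc)
    finally have "norm (e *\<^sub>R z) \<le> c1 / 2 * x" by simp
    then show ?thesis using norm_diff_ineq[of y "e *\<^sub>R z"] that(2) by linarith
  qed
  have up: "norm (y + e *\<^sub>R z) \<le> (A + B) * x" if "\<bar>e\<bar> < e0" "norm y \<le> A * x" "norm z \<le> B * x" for e x :: real and y z :: "real^2"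
  proof -
    have "norm (e *\<^sub>R z) \<le> 1 * norm z" unfolding norm_scaleR using eB(2)[OF that(1)] by (intro mult_right_mono) auto
    then show ?thesis using norm_triangle_ineq[of y "e *\<^sub>R z"] that by (simp add: distrib_right)
  qed
  define K where "K = (A + B) + B + 2 * (A + B) * (A + B) + 1"
  have AB: "A + B \<le> K" "B \<le> K" "2 * (A + B) * (A + B) \<le> K" "K > 0" using A(1) B(1) by (auto simp: K_def intro: add_nonneg_pos)
  have quot: "\<bar>(y \<bullet> z) / norm y\<bar> \<le> B" if "norm z \<le> B" for y z :: "real^2"
  proof -
    have "\<bar>y \<bullet> z\<bar> \<le> norm y * norm z" by (rule Cauchy_Schwarz_ineq2)
    also have "\<dots> \<le> norm y * B" using that by (intro mult_left_mono) auto
    finally show ?thesis using B(1) by (cases "y = 0") (auto simp: abs_divide divide_le_eq mult.commute)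
  qed
  show ?thesis
  proof (rule that[of e0 "c1/2" K])
    fix e h :: real assume e: "\<bar>e\<bar> < e0" and h: "\<bar>h\<bar> \<le> L/2"
    have "c1 * \<bar>h\<bar> \<le> norm (\<gamma> (t + h) - \<gamma> t)" using c0(2)[OF h] mult_right_mono[OF c1(2), of "\<bar>h\<bar>"] by simp
    then have "c1 / 2 * \<bar>h\<bar> \<le> norm (\<Delta> e h)"
      unfolding \<Delta>_def using e B(3)[OF h] by (intro low) auto
    moreover have "norm (\<Delta> e h) \<le> K * \<bar>h\<bar>"
      unfolding \<Delta>_def using up[OF e A(3)[OF h] B(3)[OF h]] mult_right_mono[OF AB(1), of "\<bar>h\<bar>"] by simp
    ultimately show "c1 / 2 * \<bar>h\<bar> \<le> norm (\<Delta> e h) \<and> norm (\<Delta> e h) \<le> K * \<bar>h\<bar>" by simp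
    have "c1 / 2 \<le> V e" unfolding V_def using low[of e 1 "ddt \<gamma> t" "q1 t"] e s00 c1 B0 by simp
    moreover have "c1 / 2 \<le> W e h" unfolding W_def using low[of e 1 "ddt \<gamma> (t + h)" "q1 (t + h)"] e s0(2)[OF h] c1 B(2)[OF h] by simp
    moreover have "W e h \<le> K" unfolding W_def using up[of e "ddt \<gamma> (t + h)" 1 "q1 (t + h)"] e A(2)[OF h] B(2)[OF h] AB by simp
    moreover have "\<bar>V' e\<bar> \<le> K" "\<bar>W' e h\<bar> \<le> K"
      unfolding V'_def V_def W'_def W_def using quot[OF B0, of "ddt \<gamma> t + e *\<^sub>R q1 t"] quot[OF B(2)[OF h], of "ddt \<gamma> (t + h) + e *\<^sub>R q1 (t + h)"] AB by linarith+
    ultimately show "c1 / 2 \<le> V e \<and> c1 / 2 \<le> W e h \<and> W e h \<le> K \<and> \<bar>V' e\<bar> \<le> K \<and> \<bar>W' e h\<bar> \<le> K" by simp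
    define \<alpha> \<beta> where "\<alpha> = \<gamma> (t + h) - \<gamma> t - h *\<^sub>R ddt \<gamma> t" and "\<beta> = q (t + h) - q t - h *\<^sub>R q1 t"
    have \<Delta>: "\<Delta> e h = h *\<^sub>R (ddt \<gamma> t + e *\<^sub>R q1 t) + (\<alpha> + e *\<^sub>R \<beta>)"
      by (simp add: \<Delta>_def \<alpha>_def \<beta>_def algebra_simps)
    have b: "q (t + h) - q t = h *\<^sub>R q1 t + \<beta>" by (simp add: \<beta>_def)
    have nN: "norm (N e) \<le> A + B" using up[of e "ddt \<gamma> t" 1 "q1 t"] e A0 B0 by (simp add: N_def)
    have n\<alpha>\<beta>: "norm (\<alpha> + e *\<^sub>R \<beta>) \<le> (A + B) * h\<^sup>2"
      using A(4)[OF h] B(4)[OF h] by (intro up e) (auto simp: \<alpha>_def \<beta>_def)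
    have M: "M e h = - ((\<alpha> + e *\<^sub>R \<beta>) \<bullet> N e)"
      unfolding M_def \<Delta> inner_add_left[of "h *\<^sub>R (ddt \<gamma> t + e *\<^sub>R q1 t)"] by (simp add: N_def)
    have "\<bar>M e h\<bar> \<le> norm (\<alpha> + e *\<^sub>R \<beta>) * norm (N e)"
      unfolding M abs_minus_cancel by (rule Cauchy_Schwarz_ineq2)
    also have "\<dots> \<le> ((A + B) * h\<^sup>2) * (A + B)" using n\<alpha>\<beta> nN A B by (intro mult_mono) auto
    finally have bM: "\<bar>M e h\<bar> \<le> ((A + B) * (A + B)) * h\<^sup>2" by (simp add: mult_ac)
    \<comment> \<open>By antisymmetry of \<open>rot\<close> and q1 \<bullet> rot q1 = 0, the term
      from the moving chord is the negative of the term from the moving normal.\<close>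
    have anti: "h *\<^sub>R q1 t \<bullet> N e + h *\<^sub>R (ddt \<gamma> t + e *\<^sub>R q1 t) \<bullet> rot (q1 t) = 0"
      unfolding N_def by (simp add: inner_real2 algebra_simps)
    have M': "M' e h = - (\<beta> \<bullet> N e + (\<alpha> + e *\<^sub>R \<beta>) \<bullet> rot (q1 t))"
      unfolding M'_def \<Delta> b inner_add_left[of "h *\<^sub>R q1 t" \<beta>] inner_add_left[of "h *\<^sub>R (ddt \<gamma> t + e *\<^sub>R q1 t)"]
      using anti by simp
    have "\<bar>\<beta> \<bullet> N e\<bar> \<le> norm \<beta> * norm (N e)" by (rule Cauchy_Schwarz_ineq2)
    also have "\<dots> \<le> (B * h\<^sup>2) * (A + B)" using B(4)[OF h] nN A B by (intro mult_mono) (auto simp: \<beta>_def)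
    finally have m1: "\<bar>\<beta> \<bullet> N e\<bar> \<le> (B * h\<^sup>2) * (A + B)" .
    have "\<bar>(\<alpha> + e *\<^sub>R \<beta>) \<bullet> rot (q1 t)\<bar> \<le> norm (\<alpha> + e *\<^sub>R \<beta>) * norm (rot (q1 t))" by (rule Cauchy_Schwarz_ineq2)
    also have "\<dots> \<le> ((A + B) * h\<^sup>2) * B" using n\<alpha>\<beta> B0 A B by (intro mult_mono) auto
    finally have "\<bar>M' e h\<bar> \<le> (B * h\<^sup>2) * (A + B) + ((A + B) * h\<^sup>2) * B"
      unfolding M' using m1 by linarith
    also have "\<dots> = (2 * B * (A + B)) * h\<^sup>2" by (simp add: algebra_simps)
    also have "\<dots> \<le> (2 * (A + B) * (A + B)) * h\<^sup>2" using A B by (intro mult_right_mono) auto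
    also have "\<dots> \<le> K * h\<^sup>2" using AB by (intro mult_right_mono) auto
    finally have bM': "\<bar>M' e h\<bar> \<le> K * h\<^sup>2" .
    have "(A + B) * (A + B) \<le> K" using AB(3) zero_le_square[of "A + B"] unfolding mult.assoc by linarith
    then have "\<bar>M e h\<bar> \<le> K * h\<^sup>2" using bM mult_right_mono[of "(A + B) * (A + B)" K "h\<^sup>2"] by simp
    moreover have "norm (q (t + h) - q t) \<le> K * \<bar>h\<bar>" using B(3)[OF h] mult_right_mono[OF AB(2), of "\<bar>h\<bar>"] by simp
    ultimately show "norm (q (t + h) - q t) \<le> K * \<bar>h\<bar> \<and> \<bar>M e h\<bar> \<le> K * h\<^sup>2 \<and> \<bar>M' e h\<bar> \<le> K * h\<^sup>2" using bM' by simp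
  qed (use e0 c1 AB in auto)
qed


lemma cont_G:
  assumes "\<kappa> > 0" "\<And>h. h \<in> S \<Longrightarrow> U e h > 0"
  shows "continuous_on S (\<lambda>h. G1 \<kappa> (U e h))" "continuous_on S (\<lambda>h. G2 \<kappa> (U e h))"
  by (rule continuous_on_compose2[OF continuous_on_G(1)[OF assms(1)]] continuous_on_compose2[OF continuous_on_G(2)[OF assms(1)]];
      use assms(2) in \<open>auto intro: cont_basic\<close>)+

lemma \<sigma>_bound:
  obtains C where "C > 0" "\<And>h. \<bar>h\<bar> \<le> L/2 \<Longrightarrow> norm (\<sigma> (t + h)) \<le> C"
proof -
  obtain C where C: "C \<ge> 0" "\<And>h. \<bar>h\<bar> \<le> L/2 \<Longrightarrow> norm (\<sigma> (t + h)) \<le> C"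
    using continuous_bound_interval[OF \<sigma>_cont, of "L/2" t] by metis
  show ?thesis
  proof (rule that)
    show "norm (\<sigma> (t + h)) \<le> C + 1" if "\<bar>h\<bar> \<le> L/2" for h using C(2)[OF that] by simp
  qed (use C in simp)
qed

text \<open>A count of orders: U is bounded below by a multiple of h^2, hence G1 = O(h^-2) and G2 =
  O(h^-4), while P, P' and the \<epsilon>-derivative of U are O(h^2). Every product in F and F' is
  therefore O(1), uniformly in e.\<close>

lemma kernel_bounds:
  obtains e0 where "e0 > 0"
    and "\<And>e h. \<bar>e\<bar> < e0 \<Longrightarrow> h \<in> {-(L/2)..L/2} - {0} \<Longrightarrow> U e h > 0 \<and> V e > 0 \<and> W e h > 0"
    and "\<And>\<kappa>. \<kappa> > 0 \<Longrightarrow> \<exists>C. \<forall>e h. \<bar>e\<bar> < e0 \<longrightarrow> h \<in> {-(L/2)..L/2} - {0} \<longrightarrow> norm (F \<kappa> e h) \<le> C"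
    and "\<exists>C. \<forall>e h. \<bar>e\<bar> < e0 \<longrightarrow> h \<in> {-(L/2)..L/2} - {0} \<longrightarrow> norm (F' e h) \<le> C"
proof -
  obtain e0 c K where e0: "e0 > 0" and c: "c > 0" and K: "K > 0" and
    b1: "\<And>e h. \<bar>e\<bar> < e0 \<Longrightarrow> \<bar>h\<bar> \<le> L/2 \<Longrightarrow> c * \<bar>h\<bar> \<le> norm (\<Delta> e h) \<and> norm (\<Delta> e h) \<le> K * \<bar>h\<bar>" and
    b2: "\<And>e h. \<bar>e\<bar> < e0 \<Longrightarrow> \<bar>h\<bar> \<le> L/2 \<Longrightarrow> c \<le> V e \<and> c \<le> W e h \<and> W e h \<le> K \<and> \<bar>V' e\<bar> \<le> K \<and> \<bar>W' e h\<bar> \<le> K" and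
    b3: "\<And>e h. \<bar>e\<bar> < e0 \<Longrightarrow> \<bar>h\<bar> \<le> L/2 \<Longrightarrow> norm (q (t + h) - q t) \<le> K * \<bar>h\<bar> \<and> \<bar>M e h\<bar> \<le> K * h\<^sup>2 \<and> \<bar>M' e h\<bar> \<le> K * h\<^sup>2"
    by (rule local_bounds) blast
  obtain S where S: "S > 0" "\<And>h. \<bar>h\<bar> \<le> L/2 \<Longrightarrow> norm (\<sigma> (t + h)) \<le> S" by (rule \<sigma>_bound) blast
  define Um where "Um = (K * (L/2))\<^sup>2"
  have Um: "Um > 0" using K L_pos by (simp add: Um_def)
  have U: "c\<^sup>2 * h\<^sup>2 \<le> U e h \<and> U e h \<le> Um \<and> U e h > 0" if e: "\<bar>e\<bar> < e0" and h: "\<bar>h\<bar> \<le> L/2" "h \<noteq> 0" for e h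
  proof -
    have u: "U e h = (norm (\<Delta> e h))\<^sup>2" by (simp add: U_def power2_norm_eq_inner)
    have "(c * \<bar>h\<bar>)\<^sup>2 \<le> (norm (\<Delta> e h))\<^sup>2" using b1[OF e h(1)] c by (intro power_mono) auto
    moreover have "norm (\<Delta> e h) \<le> K * (L/2)" using b1[OF e h(1)] mult_left_mono[OF h(1), of K] K by linarith
    then have "(norm (\<Delta> e h))\<^sup>2 \<le> Um" unfolding Um_def by (intro power_mono) auto
    moreover have "0 < (c * \<bar>h\<bar>)\<^sup>2" using c h by simp
    ultimately show ?thesis unfolding u by (auto simp: power_mult_distrib)
  qed
  have VW: "\<bar>W e h / V e\<bar> \<le> K / c" if e: "\<bar>e\<bar> < e0" and h: "\<bar>h\<bar> \<le> L/2" for e h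
    using b2[OF e h] c K by (simp add: abs_divide frac_le)
  have bP: "\<bar>P e h\<bar> \<le> (K * K / c) * h\<^sup>2" if e: "\<bar>e\<bar> < e0" and h: "\<bar>h\<bar> \<le> L/2" for e h
  proof -
    have "\<bar>P e h\<bar> = \<bar>M e h\<bar> * \<bar>W e h / V e\<bar>" by (simp add: P_def abs_mult)
    also have "\<dots> \<le> (K * h\<^sup>2) * (K / c)" using b3[OF e h] VW[OF e h] K by (intro mult_mono) auto
    finally show ?thesis by (simp add: mult_ac)
  qed
  \<comment> \<open>The two summands bound the two terms of the quotient rule in
    \<open>P'\<close>.\<close>
  define KP where "KP = (K * K + K * K) / c + K * K * K / c\<^sup>2"
  have KP: "KP > 0" using K c by (auto simp: KP_def intro!: add_pos_pos)
  have bP': "\<bar>P' e h\<bar> \<le> KP * h\<^sup>2" if e: "\<bar>e\<bar> < e0" and h: "\<bar>h\<bar> \<le> L/2" for e h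
  proof -
    note B = b2[OF e h] b3[OF e h]
    have "\<bar>M' e h * W e h\<bar> \<le> (K * h\<^sup>2) * K" "\<bar>M e h * W' e h\<bar> \<le> (K * h\<^sup>2) * K"
      unfolding abs_mult using B K c by (intro mult_mono; simp)+
    then have "\<bar>M' e h * W e h + M e h * W' e h\<bar> \<le> (K * K + K * K) * h\<^sup>2" by (simp add: algebra_simps)
    then have "\<bar>(M' e h * W e h + M e h * W' e h) / V e\<bar> \<le> ((K * K + K * K) * h\<^sup>2) / c"
      unfolding abs_divide using B K c by (intro frac_le) auto
    moreover have "\<bar>M e h * W e h * V' e\<bar> \<le> (K * h\<^sup>2) * K * K"
      unfolding abs_mult using B K c by (intro mult_mono) auto
    then have "\<bar>M e h * W e h * V' e / (V e)\<^sup>2\<bar> \<le> ((K * h\<^sup>2) * K * K) / c\<^sup>2"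
      unfolding abs_divide using B K c by (intro frac_le) (auto intro: power_mono)
    ultimately have "\<bar>P' e h\<bar> \<le> ((K * K + K * K) * h\<^sup>2) / c + ((K * h\<^sup>2) * K * K) / c\<^sup>2"
      unfolding P'_def by linarith
    also have "\<dots> = KP * h\<^sup>2" by (simp add: KP_def algebra_simps add_divide_distrib)
    finally show ?thesis .
  qed
  have G1U: "norm (G1 \<kappa> (U e h)) * h\<^sup>2 \<le> C / c\<^sup>2" if C: "C \<ge> 0" "\<And>u. 0 < u \<Longrightarrow> u \<le> Um \<Longrightarrow> norm (G1 \<kappa> u) \<le> C / u"
    and e: "\<bar>e\<bar> < e0" and h: "\<bar>h\<bar> \<le> L/2" "h \<noteq> 0" for \<kappa> C e h
  proof -
    have "norm (G1 \<kappa> (U e h)) \<le> C / U e h" using U[OF e h] by (intro C(2)) auto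
    also have "\<dots> \<le> C / (c\<^sup>2 * h\<^sup>2)" using U[OF e h] C(1) c h by (intro divide_left_mono mult_pos_pos) auto
    finally show ?thesis using h c by (simp add: field_simps)
  qed
  have fin: "norm (G * of_real p) \<le> a * b" if "norm G * h\<^sup>2 \<le> a" "\<bar>p\<bar> \<le> b * h\<^sup>2" "b \<ge> 0" for G :: complex and p h a b :: real
  proof -
    have "norm (G * of_real p) \<le> norm G * (b * h\<^sup>2)" unfolding norm_mult norm_of_real using that by (intro mult_left_mono) auto
    also have "\<dots> = (norm G * h\<^sup>2) * b" by simp
    also have "\<dots> \<le> a * b" using that by (intro mult_right_mono) auto
    finally show ?thesis .
  qed
  show ?thesis
  proof (rule that[OF e0])
    show "U e h > 0 \<and> V e > 0 \<and> W e h > 0" if "\<bar>e\<bar> < e0" "h \<in> {-(L/2)..L/2} - {0}" for e h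
    proof -
      have "\<bar>h\<bar> \<le> L/2" "h \<noteq> 0" using that by auto
      then show ?thesis using U[OF that(1)] b2[OF that(1)] c by force
    qed
    show "\<exists>C. \<forall>e h. \<bar>e\<bar> < e0 \<longrightarrow> h \<in> {-(L/2)..L/2} - {0} \<longrightarrow> norm (F \<kappa> e h) \<le> C" if \<kappa>: "\<kappa> > 0" for \<kappa>
    proof -
      obtain C where C: "C \<ge> 0" "\<And>u. 0 < u \<Longrightarrow> u \<le> Um \<Longrightarrow> norm (G1 \<kappa> u) \<le> C / u"
        using G_bounds[OF \<kappa> Um] by metis
      show ?thesis
      proof (intro exI allI impI)
        fix e h assume e: "\<bar>e\<bar> < e0" and "h \<in> {-(L/2)..L/2} - {0}"
        then have h: "\<bar>h\<bar> \<le> L/2" "h \<noteq> 0" by auto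
        have "norm (G1 \<kappa> (U e h) * of_real (P e h)) \<le> C / c\<^sup>2 * (K * K / c)"
          by (rule fin[OF G1U[OF C e h] bP[OF e h(1)]]) (use K c in auto)
        then have "norm (2 * (G1 \<kappa> (U e h) * of_real (P e h))) * norm (\<sigma> (t + h)) \<le> (2 * (C / c\<^sup>2 * (K * K / c))) * S"
          using S C K c h by (intro mult_mono) (auto simp: norm_mult)
        then show "norm (F \<kappa> e h) \<le> (2 * (C / c\<^sup>2 * (K * K / c))) * S" unfolding F_def norm_mult[of _ "\<sigma> (t + h)"] .
      qed
    qed
    obtain C where C: "C \<ge> 0" "\<And>u. 0 < u \<Longrightarrow> u \<le> Um \<Longrightarrow> norm (G1 k u) \<le> C / u"
      "\<And>u. 0 < u \<Longrightarrow> u \<le> Um \<Longrightarrow> norm (G2 k u) \<le> C / u\<^sup>2"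
      using G_bounds[OF k_pos Um] by metis
    show "\<exists>C. \<forall>e h. \<bar>e\<bar> < e0 \<longrightarrow> h \<in> {-(L/2)..L/2} - {0} \<longrightarrow> norm (F' e h) \<le> C"
    proof (intro exI allI impI)
      fix e h assume e: "\<bar>e\<bar> < e0" and "h \<in> {-(L/2)..L/2} - {0}"
      then have h: "\<bar>h\<bar> \<le> L/2" "h \<noteq> 0" by auto
      have 1: "norm (G1 k (U e h) * of_real (P' e h)) \<le> C / c\<^sup>2 * KP"
        by (rule fin[OF G1U[OF C(1,2) e h] bP'[OF e h(1)]]) (use KP in auto)
      let ?d = "2 * (\<Delta> e h \<bullet> (q (t + h) - q t))"
      have d: "\<bar>?d\<bar> \<le> 2 * K * K * h\<^sup>2"
      proof -
        have "\<bar>\<Delta> e h \<bullet> (q (t + h) - q t)\<bar> \<le> norm (\<Delta> e h) * norm (q (t + h) - q t)" by (rule Cauchy_Schwarz_ineq2)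
        also have "\<dots> \<le> (K * \<bar>h\<bar>) * (K * \<bar>h\<bar>)" using b1[OF e h(1)] b3[OF e h(1)] K by (intro mult_mono) auto
        also have "\<dots> = K * K * h\<^sup>2" by (simp add: power2_eq_square)
        finally show ?thesis by simp
      qed
      have "norm (of_real ?d * G2 k (U e h)) * h\<^sup>2 \<le> 2 * K * K * (C / c ^ 4)"
      proof -
        have "norm (G2 k (U e h)) \<le> C / (U e h)\<^sup>2" using U[OF e h] by (intro C(3)) auto
        also have "\<dots> \<le> C / (c\<^sup>2 * h\<^sup>2)\<^sup>2" using U[OF e h] C(1) c h by (intro divide_left_mono mult_pos_pos power_mono) auto
        finally have g: "norm (G2 k (U e h)) \<le> C / (c\<^sup>2 * h\<^sup>2)\<^sup>2" .
        have "norm (of_real ?d * G2 k (U e h)) * h\<^sup>2 = \<bar>?d\<bar> * norm (G2 k (U e h)) * h\<^sup>2"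
          unfolding norm_mult norm_of_real by (rule refl)
        also have "\<dots> \<le> (2 * K * K * h\<^sup>2) * (C / (c\<^sup>2 * h\<^sup>2)\<^sup>2) * h\<^sup>2"
          using d g K by (intro mult_right_mono mult_mono) auto
        also have "\<dots> = 2 * K * K * (C / c ^ 4)" using h c by (simp add: power_mult_distrib flip: power_mult) (simp add: field_simps power_numeral_reduce)
        finally show ?thesis .
      qed
      from fin[OF this bP[OF e h(1)]] have 2: "norm (of_real ?d * G2 k (U e h) * of_real (P e h)) \<le> 2 * K * K * (C / c ^ 4) * (K * K / c)"
        using K c by simp
      have "norm (of_real ?d * G2 k (U e h) * of_real (P e h) + G1 k (U e h) * of_real (P' e h))
         \<le> 2 * K * K * (C / c ^ 4) * (K * K / c) + C / c\<^sup>2 * KP"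
        using 1 2 by (rule order_trans[OF norm_triangle_ineq add_mono, rotated])
      then have "norm (2 * (of_real ?d * G2 k (U e h) * of_real (P e h) + G1 k (U e h) * of_real (P' e h))) * norm (\<sigma> (t + h))
         \<le> (2 * (2 * K * K * (C / c ^ 4) * (K * K / c) + C / c\<^sup>2 * KP)) * S"
        using S C K c h KP unfolding norm_mult[of 2] by (intro mult_mono mult_nonneg_nonneg add_nonneg_nonneg) auto
      then show "norm (F' e h) \<le> (2 * (2 * K * K * (C / c ^ 4) * (K * K / c) + C / c\<^sup>2 * KP)) * S"
        unfolding F'_def norm_mult[of _ "\<sigma> (t + h)"] .
    qed
  qed
qed


section \<open>The perturbed curve and the derivative of its integral\<close>

lemma perturb_eq: "perturb \<gamma> \<nu> e = (\<lambda>s. \<gamma> s + e *\<^sub>R q s)"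
  by (simp add: perturb_def q_def fun_eq_iff)

lemma perturb_deriv: "(perturb \<gamma> \<nu> e has_vector_derivative ddt \<gamma> s + e *\<^sub>R q1 s) (at s)"
  unfolding perturb_eq
  by (intro has_vector_derivative_add curve_derivs
      bounded_linear.has_vector_derivative[OF bounded_linear_scaleR_right] C2_with_derivD(1)[OF q_C2])

lemma ddt_perturb: "ddt (perturb \<gamma> \<nu> e) s = ddt \<gamma> s + e *\<^sub>R q1 s"
  by (rule ddt_eqI[OF perturb_deriv])

lemma perturb_periodic: "perturb \<gamma> \<nu> e (s + L) = perturb \<gamma> \<nu> e s"
  by (simp add: perturb_def periodic \<nu>_periodic normal_periodic)

lemma F_deriv:
  assumes "U e h > 0" "V e > 0" "W e h > 0"
  shows "((\<lambda>e. F k e h) has_vector_derivative F' e h) (at e)"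
proof -
  have \<Delta>: "((\<lambda>e. \<Delta> e h) has_vector_derivative (q (t + h) - q t)) (at e)"
    and n: "((\<lambda>e. x + e *\<^sub>R y) has_vector_derivative y) (at e)" for x y :: "real^2"
  proof -
    show n: "((\<lambda>e. x + e *\<^sub>R y) has_vector_derivative y) (at e)" for x y :: "real^2"
      using has_vector_derivative_add[OF has_vector_derivative_const[of x "at e"]
          has_vector_derivative_scaleR[OF DERIV_ident has_vector_derivative_const[of y "at e"]]] by simp
    show "((\<lambda>e. \<Delta> e h) has_vector_derivative (q (t + h) - q t)) (at e)"
      unfolding \<Delta>_def by (rule n)
  qed
  have nN: "(N has_vector_derivative rot (q1 t)) (at e)"
    unfolding N_def[abs_def] by (rule bounded_linear.has_vector_derivative[OF bounded_linear_rot n])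
  have dU: "((\<lambda>e. U e h) has_real_derivative 2 * (\<Delta> e h \<bullet> (q (t + h) - q t))) (at e)"
    unfolding U_def using inner_vector_derivative[OF \<Delta> \<Delta>] by (simp add: inner_commute)
  have dM: "((\<lambda>e. M e h) has_real_derivative M' e h) (at e)"
    unfolding M_def M'_def using DERIV_minus[OF inner_vector_derivative[OF \<Delta> nN]] by (simp add: add.commute)
  have dV: "(V has_real_derivative V' e) (at e)"
    unfolding V_def[abs_def] V'_def by (rule norm_vector_derivative[OF n]) (use assms(2) in \<open>auto simp: V_def\<close>)
  have dW: "((\<lambda>e. W e h) has_real_derivative W' e h) (at e)"
    unfolding W_def W'_def by (rule norm_vector_derivative[OF n]) (use assms(3) in \<open>auto simp: W_def\<close>)
  have dP: "((\<lambda>e. P e h) has_real_derivative P' e h) (at e)"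
  proof -
    have "((\<lambda>e. P e h) has_real_derivative ((M e h * W' e h + M' e h * W e h) * V e - M e h * W e h * V' e) / (V e * V e)) (at e)"
      unfolding P_def using DERIV_divide[OF DERIV_mult'[OF dM dW] dV] assms(2) by simp
    moreover have "((M e h * W' e h + M' e h * W e h) * V e - M e h * W e h * V' e) / (V e * V e) = P' e h"
      unfolding P'_def using assms(2) by (simp add: diff_divide_distrib power2_eq_square add.commute)
    ultimately show ?thesis by simp
  qed
  have dG: "((\<lambda>e. G1 k (U e h)) has_vector_derivative of_real (2 * (\<Delta> e h \<bullet> (q (t + h) - q t))) * G2 k (U e h)) (at e)"
    using vector_diff_chain_at[OF dU[unfolded has_real_derivative_iff_has_vector_derivative] G1_deriv[OF k_pos assms(1)]]
    by (simp add: o_def scaleR_conv_of_real)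
  have "((\<lambda>e. G1 k (U e h) * of_real (P e h)) has_vector_derivative
      G1 k (U e h) * of_real (P' e h) + of_real (2 * (\<Delta> e h \<bullet> (q (t + h) - q t))) * G2 k (U e h) * of_real (P e h)) (at e)"
    by (rule has_vector_derivative_mult[OF dG has_vector_derivative_of_real[OF dP]])
  from has_vector_derivative_mult_left[OF has_vector_derivative_mult_right[OF this, of 2], of "\<sigma> (t + h)"]
  show ?thesis unfolding F_def F'_def by (simp add: add.commute)
qed

lemma F_cont:
  assumes "\<kappa> > 0" "\<And>h. h \<in> S \<Longrightarrow> U e h > 0" "V e > 0"
  shows "continuous_on S (F \<kappa> e)"
  unfolding F_def[abs_def] P_def using assms by (intro continuous_intros cont_G) auto

lemma F'_cont:
  assumes "\<And>h. h \<in> S \<Longrightarrow> U e h > 0 \<and> W e h > 0" "V e > 0"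
  shows "continuous_on S (F' e)"
proof -
  have "continuous_on S (W' e)"
    unfolding W'_def[abs_def] by (intro continuous_intros ballI) (use assms(1) in \<open>simp add: less_imp_neq[symmetric]\<close>)
  then show ?thesis
    unfolding F'_def[abs_def] P_def P'_def using assms by (intro continuous_intros cont_G k_pos) auto
qed

text \<open>Positivity of U says that the perturbed curve does not return to its base point within
  the window, so the kernel formula applies off h = 0; integrability of F then removes the
  cut-off.\<close>

lemma S_prime_perturb:
  assumes "\<kappa> > 0" and pos: "\<And>h. h \<in> {-(L/2)..L/2} - {0} \<Longrightarrow> U e h > 0" and "V e > 0"
    and int: "set_integrable lborel {-(L/2)..L/2} (F \<kappa> e)"
  shows "S_prime \<kappa> (perturb \<gamma> \<nu> e) L \<sigma> t = (LINT h:{-(L/2)..L/2}|lborel. F \<kappa> e h)"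
  unfolding S_prime_def
proof (rule pv_integral_shift(2)[OF t_mem])
  let ?g = "perturb \<gamma> \<nu> e"
  show "ddt ?g (s + L) = ddt ?g s" for s
    by (rule ddt_periodic[OF perturb_periodic perturb_deriv])
  show "continuous_on UNIV ?g" by (rule continuous_on_of_vector_derivative[OF perturb_deriv])
  show "continuous_on ({-(L/2)..L/2} - {0}) (F \<kappa> e)" by (intro F_cont assms)
  have chord: "?g (t + h) - ?g t = \<Delta> e h" for h by (simp add: perturb_eq \<Delta>_def algebra_simps)
  show inj: "?g (t + h) \<noteq> ?g t" if "h \<in> {-(L/2)..L/2} - {0}" for h
    using pos[OF that] chord[of h] by (auto simp: U_def)
  show "dot_grad (normal ?g t) (\<lambda>x. green \<kappa> x (?g (t + h))) (?g t) * \<sigma> (t + h) * of_real (norm (ddt ?g (t + h))) = F \<kappa> e h"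
    if h: "h \<in> {-(L/2)..L/2} - {0}" for h
  proof -
    have d: "?g t - ?g (t + h) = - \<Delta> e h" using chord[of h] by (metis minus_diff_eq)
    have n: "normal ?g t = (1 / V e) *\<^sub>R N e" by (simp add: normal_eq_rot ddt_perturb V_def N_def)
    have "dot_grad (normal ?g t) (\<lambda>x. green \<kappa> x (?g (t + h))) (?g t) = of_real (2 * (M e h / V e)) * G1 \<kappa> (U e h)"
      using inj[OF h] by (subst dot_grad_green[OF assms(1)]) (auto simp: d n M_def U_def)
    then show ?thesis by (simp add: F_def P_def ddt_perturb W_def)
  qed
qed (use perturb_periodic \<sigma>_periodic int in auto)

lemma perturb_0: "perturb \<gamma> \<nu> 0 = \<gamma>"
  by (simp add: perturb_eq)

lemma F_integrable:
  obtains e0 where "e0 > 0"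
    "\<And>e h. \<bar>e\<bar> < e0 \<Longrightarrow> h \<in> {-(L/2)..L/2} - {0} \<Longrightarrow> U e h > 0 \<and> V e > 0 \<and> W e h > 0"
    "\<And>\<kappa> e. \<kappa> > 0 \<Longrightarrow> \<bar>e\<bar> < e0 \<Longrightarrow> set_integrable lborel {-(L/2)..L/2} (F \<kappa> e)"
    "set_integrable lborel {-(L/2)..L/2} (F' 0)"
    "\<exists>C. \<forall>e h. \<bar>e\<bar> < e0 \<longrightarrow> h \<in> {-(L/2)..L/2} - {0} \<longrightarrow> norm (F' e h) \<le> C"
proof -
  obtain e0 where e0: "e0 > 0"
    and p: "\<And>e h. \<bar>e\<bar> < e0 \<Longrightarrow> h \<in> {-(L/2)..L/2} - {0} \<Longrightarrow> U e h > 0 \<and> V e > 0 \<and> W e h > 0"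
    and b: "\<And>\<kappa>. \<kappa> > 0 \<Longrightarrow> \<exists>C. \<forall>e h. \<bar>e\<bar> < e0 \<longrightarrow> h \<in> {-(L/2)..L/2} - {0} \<longrightarrow> norm (F \<kappa> e h) \<le> C"
    and b': "\<exists>C. \<forall>e h. \<bar>e\<bar> < e0 \<longrightarrow> h \<in> {-(L/2)..L/2} - {0} \<longrightarrow> norm (F' e h) \<le> C"
    by (rule kernel_bounds) blast
  \<comment> \<open>\<open>V e\<close> does not involve h, so any admissible h, here L/2, extracts
    its positivity.\<close>
  have V: "V e > 0" if "\<bar>e\<bar> < e0" for e using p[OF that, of "L/2"] L_pos by auto
  show ?thesis
  proof (rule that[OF e0 p])
    show "set_integrable lborel {-(L/2)..L/2} (F \<kappa> e)" if \<kappa>: "\<kappa> > 0" and e: "\<bar>e\<bar> < e0" for \<kappa> e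
    proof -
      obtain C where "\<forall>e h. \<bar>e\<bar> < e0 \<longrightarrow> h \<in> {-(L/2)..L/2} - {0} \<longrightarrow> norm (F \<kappa> e h) \<le> C" using b[OF \<kappa>] by blast
      then show ?thesis
        using \<kappa> e p V L_pos by (intro set_integrable_of_bounded[where C=C] F_cont) auto
    qed
    obtain C where "\<forall>e h. \<bar>e\<bar> < e0 \<longrightarrow> h \<in> {-(L/2)..L/2} - {0} \<longrightarrow> norm (F' e h) \<le> C" using b' by blast
    then show "set_integrable lborel {-(L/2)..L/2} (F' 0)"
      using p V L_pos e0 by (intro set_integrable_of_bounded[where C=C] F'_cont) auto
  qed (use b' in auto)
qed

lemma S_prime_perturb_derivative:
  "((\<lambda>e. S_prime k (perturb \<gamma> \<nu> e) L \<sigma> t) has_vector_derivative (LINT h:{-(L/2)..L/2}|lborel. F' 0 h)) (at 0)"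
proof -
  obtain e0 where e0: "e0 > 0" and
    p: "\<And>e h. \<bar>e\<bar> < e0 \<Longrightarrow> h \<in> {-(L/2)..L/2} - {0} \<Longrightarrow> U e h > 0 \<and> V e > 0 \<and> W e h > 0" and
    i: "\<And>\<kappa> e. \<kappa> > 0 \<Longrightarrow> \<bar>e\<bar> < e0 \<Longrightarrow> set_integrable lborel {-(L/2)..L/2} (F \<kappa> e)" and
    i': "set_integrable lborel {-(L/2)..L/2} (F' 0)" and
    b: "\<exists>C. \<forall>e h. \<bar>e\<bar> < e0 \<longrightarrow> h \<in> {-(L/2)..L/2} - {0} \<longrightarrow> norm (F' e h) \<le> C"
    by (rule F_integrable) blast
  obtain C where C: "\<forall>e h. \<bar>e\<bar> < e0 \<longrightarrow> h \<in> {-(L/2)..L/2} - {0} \<longrightarrow> norm (F' e h) \<le> C" using b by blast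
  have "((\<lambda>e. LINT h:{-(L/2)..L/2}|lborel. F k e h) has_vector_derivative (LINT h:{-(L/2)..L/2}|lborel. F' 0 h)) (at 0)"
    by (rule has_vector_derivative_set_integral[where e=e0 and C=C])
       (use e0 L_pos i k_pos i' C p F_deriv in auto)
  then show ?thesis
  proof (rule has_vector_derivative_transform_within_open[where S="{-e0<..<e0}"])
    fix e assume "e \<in> {-e0<..<e0}"
    then have e: "\<bar>e\<bar> < e0" by auto
    have "V e > 0" using p[OF e, of "L/2"] L_pos by auto
    then show "(LINT h:{-(L/2)..L/2}|lborel. F k e h) = S_prime k (perturb \<gamma> \<nu> e) L \<sigma> t"
      using S_prime_perturb[OF k_pos _ _ i[OF k_pos e]] p[OF e] by simp
  qed (use e0 in auto)
qed

end

section \<open>Finite parts of the kernels\<close>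

text \<open>The order 1 + \<alpha> of the remainder is what a density with an \<alpha>-Hoelder
  derivative provides; after division by h^2 it is still integrable.\<close>

definition expands :: "real \<Rightarrow> real \<Rightarrow> (real \<Rightarrow> complex) \<Rightarrow> complex \<Rightarrow> complex \<Rightarrow> bool" where
  "expands l \<alpha> f f0 f1 \<longleftrightarrow>
     (\<exists>C\<ge>0. \<forall>h. \<bar>h\<bar> \<le> l \<longrightarrow> norm (f h - f0 - of_real h * f1) \<le> C * \<bar>h\<bar> powr (1 + \<alpha>))"

lemma square_le_powr:
  fixes h l \<alpha> :: real
  assumes "\<bar>h\<bar> \<le> l" "\<alpha> \<le> 1"
  shows "h\<^sup>2 \<le> l powr (1 - \<alpha>) * \<bar>h\<bar> powr (1 + \<alpha>)"
proof (cases "h = 0")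
  case False
  have "h\<^sup>2 = \<bar>h\<bar> powr ((1 - \<alpha>) + (1 + \<alpha>))" using False by simp
  also have "\<dots> = \<bar>h\<bar> powr (1 - \<alpha>) * \<bar>h\<bar> powr (1 + \<alpha>)" by (rule powr_add)
  also have "\<dots> \<le> l powr (1 - \<alpha>) * \<bar>h\<bar> powr (1 + \<alpha>)"
    using assms False by (intro mult_right_mono powr_mono2) auto
  finally show ?thesis .
qed simp

lemma expands_of_quadratic:
  assumes "\<alpha> \<le> 1" "C \<ge> 0" "\<And>h. \<bar>h\<bar> \<le> l \<Longrightarrow> norm (f h - f0 - of_real h * f1) \<le> C * h\<^sup>2"
  shows "expands l \<alpha> f f0 f1"
  unfolding expands_def
proof (intro exI[of _ "C * l powr (1 - \<alpha>)"] conjI allI impI)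
  fix h assume h: "\<bar>h\<bar> \<le> l"
  have "norm (f h - f0 - of_real h * f1) \<le> C * (l powr (1 - \<alpha>) * \<bar>h\<bar> powr (1 + \<alpha>))"
    using assms(3)[OF h] mult_left_mono[OF square_le_powr[OF h assms(1)] assms(2)] by linarith
  then show "norm (f h - f0 - of_real h * f1) \<le> C * l powr (1 - \<alpha>) * \<bar>h\<bar> powr (1 + \<alpha>)" by (simp add: mult.assoc)
qed (use assms in auto)

lemma expands_bounded:
  assumes "expands l \<alpha> f f0 f1" "\<alpha> > 0" "l > 0"
  obtains B where "B \<ge> 0" "\<And>h. \<bar>h\<bar> \<le> l \<Longrightarrow> norm (f h) \<le> B"
proof -
  obtain C where C: "C \<ge> 0" "\<And>h. \<bar>h\<bar> \<le> l \<Longrightarrow> norm (f h - f0 - of_real h * f1) \<le> C * \<bar>h\<bar> powr (1 + \<alpha>)"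
    using assms(1) unfolding expands_def by blast
  show ?thesis
  proof (rule that)
    show "0 \<le> C * l powr (1 + \<alpha>) + norm f0 + l * norm f1" using C assms by (intro add_nonneg_nonneg) auto
    fix h assume h: "\<bar>h\<bar> \<le> l"
    have "f h = (f h - f0 - of_real h * f1) + f0 + of_real h * f1" by simp
    then have "norm (f h) \<le> norm (f h - f0 - of_real h * f1) + norm f0 + norm (of_real h * f1)"
      by (metis norm_triangle_le norm_triangle_ineq add_mono order_refl)
    also have "\<dots> \<le> C * l powr (1 + \<alpha>) + norm f0 + l * norm f1"
    proof (intro add_mono order_refl)
      have "C * \<bar>h\<bar> powr (1 + \<alpha>) \<le> C * l powr (1 + \<alpha>)" using C h assms by (intro mult_left_mono powr_mono2) auto
      then show "norm (f h - f0 - of_real h * f1) \<le> C * l powr (1 + \<alpha>)" using C(2)[OF h] by linarith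
      show "norm (of_real h * f1) \<le> l * norm f1" unfolding norm_mult norm_of_real using h by (intro mult_right_mono) auto
    qed
    finally show "norm (f h) \<le> C * l powr (1 + \<alpha>) + norm f0 + l * norm f1" .
  qed
qed

lemma expands_mult:
  assumes f: "expands l \<alpha> f f0 f1" and g: "expands l \<alpha> g g0 g1" and "\<alpha> > 0" "\<alpha> \<le> 1" "l > 0"
  shows "expands l \<alpha> (\<lambda>h. f h * g h) (f0 * g0) (f0 * g1 + f1 * g0)"
proof -
  obtain C where C: "C \<ge> 0" "\<And>h. \<bar>h\<bar> \<le> l \<Longrightarrow> norm (f h - f0 - of_real h * f1) \<le> C * \<bar>h\<bar> powr (1 + \<alpha>)"
    using f unfolding expands_def by blast
  obtain D where D: "D \<ge> 0" "\<And>h. \<bar>h\<bar> \<le> l \<Longrightarrow> norm (g h - g0 - of_real h * g1) \<le> D * \<bar>h\<bar> powr (1 + \<alpha>)"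
    using g unfolding expands_def by blast
  obtain B where B: "B \<ge> 0" "\<And>h. \<bar>h\<bar> \<le> l \<Longrightarrow> norm (g h) \<le> B"
    using expands_bounded[OF g assms(3,5)] by blast
  define E where "E = C * B + (norm f0 + l * norm f1) * D + norm (f1 * g1) * l powr (1 - \<alpha>)"
  have "norm (f h * g h - f0 * g0 - of_real h * (f0 * g1 + f1 * g0)) \<le> E * \<bar>h\<bar> powr (1 + \<alpha>)" if h: "\<bar>h\<bar> \<le> l" for h
  proof -
    define p where "p = \<bar>h\<bar> powr (1 + \<alpha>)"
    have "p \<ge> 0" by (simp add: p_def)
    \<comment> \<open>The product of the two linear terms is left over as h^2 f1 g1; it is of order
      |h|^(1 + \<alpha>) because \<alpha> <= 1.\<close>
    have eq: "f h * g h - f0 * g0 - of_real h * (f0 * g1 + f1 * g0)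
        = (f h - f0 - of_real h * f1) * g h + (f0 + of_real h * f1) * (g h - g0 - of_real h * g1) + of_real (h\<^sup>2) * (f1 * g1)"
      by (simp add: algebra_simps power2_eq_square)
    have 1: "norm ((f h - f0 - of_real h * f1) * g h) \<le> (C * p) * B"
      unfolding norm_mult using C B h \<open>p \<ge> 0\<close> by (intro mult_mono) (auto simp: p_def)
    have "norm (f0 + of_real h * f1) \<le> norm f0 + \<bar>h\<bar> * norm f1"
      using norm_triangle_ineq[of f0 "of_real h * f1"] by (simp add: norm_mult)
    also have "\<dots> \<le> norm f0 + l * norm f1" using h by (intro add_left_mono mult_right_mono) auto
    finally have 2: "norm ((f0 + of_real h * f1) * (g h - g0 - of_real h * g1)) \<le> (norm f0 + l * norm f1) * (D * p)"
      unfolding norm_mult[of "f0 + of_real h * f1"] using D(2)[OF h] h assms by (intro mult_mono add_nonneg_nonneg) (auto simp: p_def)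
    have 3: "norm (of_real (h\<^sup>2) * (f1 * g1)) \<le> (l powr (1 - \<alpha>) * p) * norm (f1 * g1)"
      unfolding norm_mult[of "of_real (h\<^sup>2)"] norm_of_real using square_le_powr[OF h assms(4)]
      by (intro mult_right_mono) (auto simp: p_def)
    have "norm (f h * g h - f0 * g0 - of_real h * (f0 * g1 + f1 * g0))
       \<le> (C * p) * B + (norm f0 + l * norm f1) * (D * p) + (l powr (1 - \<alpha>) * p) * norm (f1 * g1)"
      unfolding eq by (rule norm_triangle_le, rule add_mono[OF norm_triangle_le 3], rule add_mono[OF 1 2])
    also have "\<dots> = E * p" by (simp add: E_def algebra_simps)
    finally show ?thesis by (simp add: p_def)
  qed
  moreover have "E \<ge> 0" unfolding E_def using C B D assms by (intro add_nonneg_nonneg mult_nonneg_nonneg) auto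
  ultimately show ?thesis unfolding expands_def by blast
qed

text \<open>A and B are found by matching (A + B h) u with X h^2 up to order h^3: A v^2 = x0 and A m
  + B v^2 = x1. What is left is O(|h|^(3 + \<alpha>)), to be divided by u h^2 >= c h^4.\<close>

lemma quotient_pole:
  fixes u :: "real \<Rightarrow> real"
  assumes X: "expands l \<alpha> X x0 x1" and \<alpha>: "0 < \<alpha>" "\<alpha> \<le> 1" and l: "l > 0" and v: "v > 0" and c: "c > 0"
    and low: "\<And>h. \<bar>h\<bar> \<le> l \<Longrightarrow> c * h\<^sup>2 \<le> u h"
    and exp: "\<And>h. \<bar>h\<bar> \<le> l \<Longrightarrow> \<bar>u h - v\<^sup>2 * h\<^sup>2 - m * h ^ 3\<bar> \<le> C * h ^ 4"
  obtains B K where "\<And>h. h \<in> {-l..l} - {0} \<Longrightarrow>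
      norm (X h / of_real (u h) - ((x0 / of_real (v\<^sup>2)) / of_real (h\<^sup>2) + B / of_real h)) \<le> K * \<bar>h\<bar> powr (\<alpha> - 1)"
proof -
  obtain D where D: "D \<ge> 0" "\<And>h. \<bar>h\<bar> \<le> l \<Longrightarrow> norm (X h - x0 - of_real h * x1) \<le> D * \<bar>h\<bar> powr (1 + \<alpha>)"
    using X unfolding expands_def by blast
  define A where "A = x0 / of_real (v\<^sup>2)"
  define B where "B = (x1 - A * of_real m) / of_real (v\<^sup>2)"
  have C: "C \<ge> 0"
  proof -
    have "0 \<le> C * l ^ 4" using order_trans[OF abs_ge_zero exp[of l]] l by simp
    then show ?thesis using l by (simp add: zero_le_mult_iff)
  qed
  have Av: "A * of_real (v\<^sup>2) = x0" using v by (simp add: A_def)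
  have Bv: "B * of_real (v\<^sup>2) = x1 - A * of_real m" using v by (simp add: B_def)
  define E where "E = norm (B * of_real m) + (norm A + norm B * l) * C"
  have E: "E \<ge> 0" using C l by (simp add: E_def)
  define K where "K = (D + E * l powr (1 - \<alpha>)) / c"
  show ?thesis
  proof (rule that[of B K])
    fix h assume "h \<in> {-l..l} - {0}"
    then have h: "\<bar>h\<bar> \<le> l" "h \<noteq> 0" by auto
    have up0: "h\<^sup>2 > 0" "c * h\<^sup>2 > 0" using c h by simp_all
    then have up: "c * h\<^sup>2 \<le> u h" "u h > 0" "h\<^sup>2 > 0" using low[OF h(1)] by linarith+
    define \<rho> where "\<rho> = u h - v\<^sup>2 * h\<^sup>2 - m * h ^ 3"
    define R where "R = (X h - x0 - of_real h * x1) * of_real (h\<^sup>2) - B * of_real m * of_real (h ^ 4) - (A + B * of_real h) * of_real \<rho>"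
    have "(A + B * of_real h) * of_real (u h) = (A + B * of_real h) * of_real (v\<^sup>2 * h\<^sup>2 + m * h ^ 3 + \<rho>)" by (simp add: \<rho>_def)
    also have "\<dots> = (A * of_real (v\<^sup>2)) * of_real (h\<^sup>2) + (B * of_real (v\<^sup>2)) * of_real (h ^ 3) + A * of_real m * of_real (h ^ 3)
        + B * of_real m * of_real (h ^ 4) + (A + B * of_real h) * of_real \<rho>"
      by (simp add: algebra_simps power_numeral_reduce)
    also have "\<dots> = x0 * of_real (h\<^sup>2) + x1 * of_real (h ^ 3) + B * of_real m * of_real (h ^ 4) + (A + B * of_real h) * of_real \<rho>"
      unfolding Av Bv by (simp add: algebra_simps)
    finally have R: "X h * of_real (h\<^sup>2) - (A + B * of_real h) * of_real (u h) = R"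
      by (simp add: R_def algebra_simps power_numeral_reduce)
    have "X h / of_real (u h) - (A / of_real (h\<^sup>2) + B / of_real h) = R / of_real (u h * h\<^sup>2)"
      unfolding R[symmetric] using up(2) h(2) by (simp add: divide_simps) (simp add: algebra_simps power2_eq_square)
    also have "norm \<dots> \<le> (D * \<bar>h\<bar> powr (1 + \<alpha>) * h\<^sup>2 + E * h ^ 4) / (c * h\<^sup>2 * h\<^sup>2)"
      unfolding norm_divide norm_of_real
    proof (rule frac_le)
      have "norm R \<le> norm ((X h - x0 - of_real h * x1) * of_real (h\<^sup>2)) + norm (B * of_real m * of_real (h ^ 4)) + norm ((A + B * of_real h) * of_real \<rho>)"
        unfolding R_def by (intro order_trans[OF norm_triangle_ineq4] add_right_mono norm_triangle_ineq4)
      also have "\<dots> \<le> (D * \<bar>h\<bar> powr (1 + \<alpha>)) * h\<^sup>2 + norm (B * of_real m) * h ^ 4 + (norm A + norm B * l) * (C * h ^ 4)"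
      proof (intro add_mono)
        show "norm ((X h - x0 - of_real h * x1) * of_real (h\<^sup>2)) \<le> (D * \<bar>h\<bar> powr (1 + \<alpha>)) * h\<^sup>2"
          unfolding norm_mult[of _ "of_real (h\<^sup>2)"] norm_of_real using D(2)[OF h(1)] by (simp add: mult_right_mono)
        show "norm (B * of_real m * of_real (h ^ 4)) \<le> norm (B * of_real m) * h ^ 4"
          unfolding norm_mult[of _ "of_real (h ^ 4)"] norm_of_real by simp
        have "norm (A + B * of_real h) \<le> norm A + norm B * \<bar>h\<bar>"
          using norm_triangle_ineq[of A "B * of_real h"] by (simp add: norm_mult)
        also have "\<dots> \<le> norm A + norm B * l" using h by (intro add_left_mono mult_left_mono) auto
        finally show "norm ((A + B * of_real h) * of_real \<rho>) \<le> (norm A + norm B * l) * (C * h ^ 4)"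
          unfolding norm_mult[of _ "of_real \<rho>"] norm_of_real using exp[OF h(1)] l by (intro mult_mono) (auto simp: \<rho>_def)
      qed
      also have "\<dots> = D * \<bar>h\<bar> powr (1 + \<alpha>) * h\<^sup>2 + E * h ^ 4" by (simp add: E_def algebra_simps)
      finally show "norm R \<le> D * \<bar>h\<bar> powr (1 + \<alpha>) * h\<^sup>2 + E * h ^ 4" .
      show "0 \<le> D * \<bar>h\<bar> powr (1 + \<alpha>) * h\<^sup>2 + E * h ^ 4" using D E by simp
      show "0 < c * h\<^sup>2 * h\<^sup>2" using up c by simp
      show "c * h\<^sup>2 * h\<^sup>2 \<le> \<bar>u h * h\<^sup>2\<bar>" using up by (simp add: abs_mult)
    qed
    also have "\<dots> = (D * \<bar>h\<bar> powr (1 + \<alpha>) + E * h\<^sup>2) / (c * h\<^sup>2)"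
    proof -
      have "D * \<bar>h\<bar> powr (1 + \<alpha>) * h\<^sup>2 + E * h ^ 4 = (D * \<bar>h\<bar> powr (1 + \<alpha>) + E * h\<^sup>2) * h\<^sup>2"
        by (simp add: algebra_simps power_numeral_reduce)
      then show ?thesis using up by simp
    qed
    also have "\<dots> \<le> (D * \<bar>h\<bar> powr (1 + \<alpha>) + E * (l powr (1 - \<alpha>) * \<bar>h\<bar> powr (1 + \<alpha>))) / (c * h\<^sup>2)"
      using up c E square_le_powr[OF h(1) \<alpha>(2)] by (intro divide_right_mono add_left_mono mult_left_mono) auto
    also have "\<dots> = K * (\<bar>h\<bar> powr (1 + \<alpha>) / h\<^sup>2)"
    proof -
      have "(D * p + E * (y * p)) / (c * z) = (D + E * y) / c * (p / z)" for p y z :: real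
        by (simp add: distrib_right mult.assoc)
      then show ?thesis unfolding K_def .
    qed
    also have "\<bar>h\<bar> powr (1 + \<alpha>) / h\<^sup>2 = \<bar>h\<bar> powr (\<alpha> - 1)"
    proof -
      have "h\<^sup>2 = \<bar>h\<bar> powr 2" using h by simp
      then have "\<bar>h\<bar> powr (1 + \<alpha>) / h\<^sup>2 = \<bar>h\<bar> powr (1 + \<alpha> - 2)" by (simp only: powr_diff)
      then show ?thesis by simp
    qed
    finally show "norm (X h / of_real (u h) - ((x0 / of_real (v\<^sup>2)) / of_real (h\<^sup>2) + B / of_real h)) \<le> K * \<bar>h\<bar> powr (\<alpha> - 1)"
      by (simp add: A_def)
  qed
qed

context density_on_curve
begin

section \<open>Expansion and monotonicity of the squared chord\<close>

lemma \<Delta>_0: "\<Delta> 0 h = \<gamma> (t + h) - \<gamma> t"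
  by (simp add: \<Delta>_def)

lemma U_0: "U 0 h = (norm (\<gamma> (t + h) - \<gamma> t))\<^sup>2"
  by (simp add: U_def \<Delta>_0 power2_norm_eq_inner)

lemma W_0: "W 0 h = speed (t + h)"
  by (simp add: W_def speed_def)

lemma U_lower:
  obtains c where "c > 0" "\<And>h. \<bar>h\<bar> \<le> L/2 \<Longrightarrow> c * h\<^sup>2 \<le> U 0 h"
proof -
  obtain c where c: "c > 0" "\<And>h. \<bar>h\<bar> \<le> L/2 \<Longrightarrow> c * \<bar>h\<bar> \<le> norm (\<gamma> (t + h) - \<gamma> t)"
    using chord_lower_bound[OF t_mem] by blast
  show ?thesis
  proof (rule that)
    show "c\<^sup>2 > 0" using c by simp
    fix h assume "\<bar>h\<bar> \<le> L/2"
    then have "(c * \<bar>h\<bar>)\<^sup>2 \<le> (norm (\<gamma> (t + h) - \<gamma> t))\<^sup>2" using c by (intro power_mono) auto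
    then show "c\<^sup>2 * h\<^sup>2 \<le> U 0 h" by (simp add: U_0 power_mult_distrib)
  qed
qed

lemma U_upper:
  obtains C where "C > 0" "\<And>h. \<bar>h\<bar> \<le> L/2 \<Longrightarrow> U 0 h \<le> C"
proof -
  have "continuous_on UNIV (U 0)" by (rule cont_basic)
  from continuous_bound_interval[OF this, of "L/2" 0] obtain C where
    C: "C \<ge> 0" "\<And>h. \<bar>h\<bar> \<le> L/2 \<Longrightarrow> norm (U 0 (0 + h)) \<le> C" by blast
  show ?thesis
  proof (rule that)
    show "U 0 h \<le> C + 1" if "\<bar>h\<bar> \<le> L/2" for h using C(2)[OF that] by simp
  qed (use C in simp)
qed

lemma U_pos: "h \<in> {-(L/2)..L/2} - {0} \<Longrightarrow> U 0 h > 0"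
  using chord_nonzero[OF t_mem, of h] by (simp add: U_0)

text \<open>The square of h \<gamma>' + (h^2/2) \<gamma>'' + O(h^3). The cubic coefficient \<gamma>'
  \<bullet> \<gamma>'' is half the derivative of the squared speed: it measures the deviation from a
  parametrisation by arc length and makes the excised interval asymmetric.\<close>

lemma U_expansion:
  obtains C where "\<And>h. \<bar>h\<bar> \<le> L/2 \<Longrightarrow>
    \<bar>U 0 h - (speed t)\<^sup>2 * h\<^sup>2 - (ddt \<gamma> t \<bullet> ddt (ddt \<gamma>) t) * h ^ 3\<bar> \<le> C * h ^ 4"
proof -
  let ?l = "L/2" let ?g1 = "ddt \<gamma> t" let ?g2 = "ddt (ddt \<gamma>) t"
  obtain B where B: "B \<ge> 0" "\<And>h. \<bar>h\<bar> \<le> ?l \<Longrightarrow> norm (ddt \<gamma> (t + h) - ?g1 - h *\<^sub>R ?g2) \<le> B * h\<^sup>2"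
    using C2_taylor[OF tangent_C2, of ?l t] by metis
  have rem: "norm (\<gamma> (t + h) - \<gamma> t - h *\<^sub>R ?g1 - (h\<^sup>2 / 2) *\<^sub>R ?g2) \<le> B * h\<^sup>2 * \<bar>h\<bar>" if h: "\<bar>h\<bar> \<le> ?l" for h
  proof -
    have "norm ((\<gamma> (t + h) - h *\<^sub>R ?g1 - (h\<^sup>2 / 2) *\<^sub>R ?g2) - (\<gamma> (t + 0) - 0 *\<^sub>R ?g1 - (0\<^sup>2 / 2) *\<^sub>R ?g2)) \<le> (B * h\<^sup>2) * \<bar>h\<bar>"
    proof (rule mvt_bound[where f'="\<lambda>z. ddt \<gamma> (t + z) - ?g1 - z *\<^sub>R ?g2"])
      fix z assume z: "\<bar>z\<bar> \<le> \<bar>h\<bar>"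
      have "((\<lambda>z. z *\<^sub>R ?g1) has_vector_derivative ?g1) (at z)"
        using has_vector_derivative_scaleR[OF DERIV_ident has_vector_derivative_const[of ?g1 "at z"]] by simp
      moreover have "((\<lambda>z. (z\<^sup>2 / 2) *\<^sub>R ?g2) has_vector_derivative z *\<^sub>R ?g2) (at z)"
      proof -
        have "((\<lambda>z. z\<^sup>2 / 2) has_real_derivative z) (at z)"
          by (auto intro!: derivative_eq_intros)
        then show ?thesis using has_vector_derivative_scaleR[OF _ has_vector_derivative_const[of ?g2 "at z"]] by simp
      qed
      ultimately show "((\<lambda>z. \<gamma> (t + z) - z *\<^sub>R ?g1 - (z\<^sup>2 / 2) *\<^sub>R ?g2) has_vector_derivative ddt \<gamma> (t + z) - ?g1 - z *\<^sub>R ?g2) (at z)"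
        by (intro has_vector_derivative_diff shifted_vector_derivative[OF curve_derivs(1)])
      have "z\<^sup>2 \<le> h\<^sup>2" using z by (simp add: abs_le_square_iff)
      then show "norm (ddt \<gamma> (t + z) - ?g1 - z *\<^sub>R ?g2) \<le> B * h\<^sup>2"
        using B(2)[of z] z h mult_left_mono[of "z\<^sup>2" "h\<^sup>2" B] B(1) by linarith
    qed
    then show ?thesis by (simp add: algebra_simps)
  qed
  define X where "X = norm ?g1 + ?l * norm ?g2"
  have X: "X \<ge> 0" using L_pos by (simp add: X_def)
  define C where "C = (norm ?g2)\<^sup>2 / 4 + 2 * X * B + B\<^sup>2 * ?l\<^sup>2"
  show ?thesis
  proof (rule that[of C])
    fix h assume h: "\<bar>h\<bar> \<le> ?l"
    define x where "x = h *\<^sub>R ?g1 + (h\<^sup>2 / 2) *\<^sub>R ?g2"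
    define \<rho> where "\<rho> = \<gamma> (t + h) - \<gamma> t - h *\<^sub>R ?g1 - (h\<^sup>2 / 2) *\<^sub>R ?g2"
    have nr: "norm \<rho> \<le> B * h\<^sup>2 * \<bar>h\<bar>" using rem[OF h] by (simp add: \<rho>_def)
    have U: "U 0 h = (x + \<rho>) \<bullet> (x + \<rho>)" by (simp add: U_def \<Delta>_0 x_def \<rho>_def)
    have xx: "x \<bullet> x = (speed t)\<^sup>2 * h\<^sup>2 + (?g1 \<bullet> ?g2) * h ^ 3 + (norm ?g2)\<^sup>2 / 4 * h ^ 4"
    proof -
      have "x \<bullet> x = h * h * (?g1 \<bullet> ?g1) + 2 * (h * (h\<^sup>2 / 2) * (?g1 \<bullet> ?g2)) + (h\<^sup>2 / 2) * (h\<^sup>2 / 2) * (?g2 \<bullet> ?g2)"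
        unfolding x_def inner_add_left inner_add_right inner_scaleR_left inner_scaleR_right inner_commute[of ?g2 ?g1]
        by (simp add: algebra_simps power2_eq_square power4_eq_xxxx)
      then show ?thesis
        unfolding speed_def power2_norm_eq_inner
        by (simp add: power2_eq_square power3_eq_cube power4_eq_xxxx mult_ac)
    qed
    have eq: "U 0 h - (speed t)\<^sup>2 * h\<^sup>2 - (?g1 \<bullet> ?g2) * h ^ 3 = (norm ?g2)\<^sup>2 / 4 * h ^ 4 + 2 * (x \<bullet> \<rho>) + \<rho> \<bullet> \<rho>"
      unfolding U using xx by (simp add: inner_add_left inner_add_right inner_commute)
    have nx: "norm x \<le> X * \<bar>h\<bar>"
    proof -
      have "norm x \<le> \<bar>h\<bar> * norm ?g1 + h\<^sup>2 / 2 * norm ?g2"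
        unfolding x_def using norm_triangle_ineq[of "h *\<^sub>R ?g1" "(h\<^sup>2 / 2) *\<^sub>R ?g2"] by simp
      also have "h\<^sup>2 / 2 * norm ?g2 \<le> (?l * \<bar>h\<bar>) * norm ?g2"
      proof (rule mult_right_mono)
        have "h\<^sup>2 = \<bar>h\<bar> * \<bar>h\<bar>" by (simp add: power2_eq_square)
        also have "\<dots> \<le> ?l * \<bar>h\<bar>" using h by (intro mult_right_mono) auto
        finally show "h\<^sup>2 / 2 \<le> ?l * \<bar>h\<bar>" using zero_le_power2[of h] by linarith
      qed simp
      finally show ?thesis by (simp add: X_def algebra_simps)
    qed
    have "\<bar>x \<bullet> \<rho>\<bar> \<le> norm x * norm \<rho>" by (rule Cauchy_Schwarz_ineq2)
    also have "\<dots> \<le> (X * \<bar>h\<bar>) * (B * h\<^sup>2 * \<bar>h\<bar>)" using nx nr X by (intro mult_mono) auto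
    also have "\<dots> = X * B * h ^ 4" by (simp add: power_numeral_reduce abs_mult_self_eq mult_ac)
    finally have 1: "\<bar>x \<bullet> \<rho>\<bar> \<le> X * B * h ^ 4" .
    have "\<rho> \<bullet> \<rho> = (norm \<rho>)\<^sup>2" by (simp add: power2_norm_eq_inner)
    also have "\<dots> \<le> (B * h\<^sup>2 * \<bar>h\<bar>)\<^sup>2" using nr by (intro power_mono) auto
    also have "\<dots> = B\<^sup>2 * h\<^sup>2 * h ^ 4" by (simp add: power_mult_distrib flip: power_mult)
    also have "\<dots> \<le> B\<^sup>2 * ?l\<^sup>2 * h ^ 4"
      using h L_pos by (intro mult_right_mono mult_left_mono) (auto simp: abs_le_square_iff[symmetric])
    finally have 2: "\<rho> \<bullet> \<rho> \<le> B\<^sup>2 * ?l\<^sup>2 * h ^ 4" .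
    have "\<bar>(norm ?g2)\<^sup>2 / 4 * h ^ 4 + 2 * (x \<bullet> \<rho>) + \<rho> \<bullet> \<rho>\<bar> \<le> (norm ?g2)\<^sup>2 / 4 * h ^ 4 + 2 * (X * B * h ^ 4) + B\<^sup>2 * ?l\<^sup>2 * h ^ 4"
    proof -
      have "(norm ?g2)\<^sup>2 / 4 * h ^ 4 \<ge> 0" "\<rho> \<bullet> \<rho> \<ge> 0" by simp_all
      then show ?thesis using 1 2 by linarith
    qed
    then show "\<bar>U 0 h - (speed t)\<^sup>2 * h\<^sup>2 - (?g1 \<bullet> ?g2) * h ^ 3\<bar> \<le> C * h ^ 4"
      unfolding eq by (simp add: C_def algebra_simps)
  qed
qed

text \<open>The derivative of the squared chord is 2 h |\<gamma>'|^2 + O(h^2), so near 0 it has the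
  sign of h.\<close>

lemma chord_monotone:
  obtains \<eta> where "0 < \<eta>" "\<eta> \<le> L/2"
    "\<And>x y. 0 \<le> x \<Longrightarrow> x < y \<Longrightarrow> y \<le> \<eta> \<Longrightarrow> U 0 x < U 0 y \<and> U 0 (-x) < U 0 (-y)"
proof -
  let ?g1 = "ddt \<gamma> t"
  obtain C where C: "C \<ge> 0" "\<And>h. \<bar>h\<bar> \<le> L/2 \<Longrightarrow> norm (ddt \<gamma> (t + h)) \<le> C"
    "\<And>h. \<bar>h\<bar> \<le> L/2 \<Longrightarrow> norm (ddt \<gamma> (t + h) - ?g1) \<le> C * \<bar>h\<bar>"
    "\<And>h. \<bar>h\<bar> \<le> L/2 \<Longrightarrow> norm (\<gamma> (t + h) - \<gamma> t - h *\<^sub>R ?g1) \<le> C * h\<^sup>2"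
  proof -
    obtain A where A: "A \<ge> 0" "\<And>h. \<bar>h\<bar> \<le> L/2 \<Longrightarrow> norm (ddt \<gamma> (t + h)) \<le> A"
      "\<And>h. \<bar>h\<bar> \<le> L/2 \<Longrightarrow> norm (ddt \<gamma> (t + h) - ?g1) \<le> A * \<bar>h\<bar>"
      "\<And>h. \<bar>h\<bar> \<le> L/2 \<Longrightarrow> norm (\<gamma> (t + h) - \<gamma> t - h *\<^sub>R ?g1) \<le> A * h\<^sup>2"
      using C2_taylor[OF curve_C2, of "L/2" t] by metis
    then show ?thesis by (rule that)
  qed
  have g1C: "norm ?g1 \<le> C" using C(2)[of 0] L_pos by simp
  define d where "d h = (\<gamma> (t + h) - \<gamma> t) \<bullet> ddt \<gamma> (t + h)" for h
  have dU: "(U 0 has_real_derivative 2 * d h) (at h)" for h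
  proof -
    have "((\<lambda>h. \<gamma> (t + h) - \<gamma> t) has_vector_derivative ddt \<gamma> (t + h) - 0) (at h)"
      by (rule has_vector_derivative_diff[OF shifted_vector_derivative[OF curve_derivs(1)] has_vector_derivative_const])
    from inner_vector_derivative[OF this this] show ?thesis
      unfolding U_def[abs_def] \<Delta>_0 by (simp add: d_def inner_commute)
  qed
  have dd: "\<bar>d h - h * (speed t)\<^sup>2\<bar> \<le> 2 * C\<^sup>2 * h\<^sup>2" if h: "\<bar>h\<bar> \<le> L/2" for h
  proof -
    have "d h - h * (speed t)\<^sup>2 = (\<gamma> (t + h) - \<gamma> t - h *\<^sub>R ?g1) \<bullet> ddt \<gamma> (t + h) + h * (?g1 \<bullet> (ddt \<gamma> (t + h) - ?g1))"
      by (simp add: d_def speed_def power2_norm_eq_inner inner_diff_left inner_diff_right algebra_simps)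
    also have "\<bar>\<dots>\<bar> \<le> (C * h\<^sup>2) * C + \<bar>h\<bar> * (C * (C * \<bar>h\<bar>))"
    proof (rule order_trans[OF abs_triangle_ineq], rule add_mono)
      show "\<bar>(\<gamma> (t + h) - \<gamma> t - h *\<^sub>R ?g1) \<bullet> ddt \<gamma> (t + h)\<bar> \<le> (C * h\<^sup>2) * C"
        by (rule order_trans[OF Cauchy_Schwarz_ineq2], rule mult_mono) (use C h in auto)
      show "\<bar>h * (?g1 \<bullet> (ddt \<gamma> (t + h) - ?g1))\<bar> \<le> \<bar>h\<bar> * (C * (C * \<bar>h\<bar>))"
        unfolding abs_mult
        by (rule mult_left_mono, rule order_trans[OF Cauchy_Schwarz_ineq2], rule mult_mono) (use C g1C h in auto)
    qed
    also have "\<dots> = 2 * C\<^sup>2 * h\<^sup>2" by (simp add: power2_eq_square)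
    finally show ?thesis .
  qed
  \<comment> \<open>Chosen so that the error 2 C^2 h^2 of \<open>dd\<close> stays below the main
    term |h| |\<gamma>'|^2; the + 1 makes the inequality strict and the denominator
    positive.\<close>
  define \<eta> where "\<eta> = min (L/2) ((speed t)\<^sup>2 / (2 * C\<^sup>2 + 1))"
  have den: "2 * C\<^sup>2 + 1 > 0" by (simp add: add_nonneg_pos)
  have \<eta>: "0 < \<eta>" using L_pos speed_pos[of t] den by (auto simp: \<eta>_def)
  have \<eta>': "\<eta> \<le> L/2" unfolding \<eta>_def by (rule min.cobounded1)
  have strict: "2 * C\<^sup>2 * h\<^sup>2 < \<bar>h\<bar> * (speed t)\<^sup>2" if h: "\<bar>h\<bar> \<le> \<eta>" "h \<noteq> 0" for h
  proof -
    have "\<bar>h\<bar> * (2 * C\<^sup>2 + 1) \<le> (speed t)\<^sup>2" using h(1) den by (simp add: \<eta>_def pos_le_divide_eq)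
    then have "\<bar>h\<bar> * (2 * C\<^sup>2) < (speed t)\<^sup>2" using h(2) by (simp add: distrib_left)
    then have "\<bar>h\<bar> * (\<bar>h\<bar> * (2 * C\<^sup>2)) < \<bar>h\<bar> * (speed t)\<^sup>2" using h(2) by simp
    moreover have "\<bar>h\<bar> * (\<bar>h\<bar> * (2 * C\<^sup>2)) = 2 * C\<^sup>2 * h\<^sup>2"
      by (simp add: power2_eq_square mult_ac flip: abs_mult)
    ultimately show ?thesis by simp
  qed
  have contU: "continuous_on S (U 0)" for S by (rule cont_basic)
  show ?thesis
  proof (rule that[OF \<eta> \<eta>'])
    fix x y :: real assume xy: "0 \<le> x" "x < y" "y \<le> \<eta>"
    have 1: "U 0 x < U 0 y"
    proof (rule DERIV_pos_imp_increasing_open[OF xy(2)])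
      fix z assume z: "x < z" "z < y"
      then have "\<bar>z\<bar> \<le> \<eta>" "z \<noteq> 0" "z > 0" using xy by auto
      then have "2 * d z > 0" using dd[of z] strict[of z] \<eta>' by (simp add: abs_le_iff)
      then show "\<exists>y. (U 0 has_real_derivative y) (at z) \<and> y > 0" using dU by blast
    qed (rule contU)
    have 2: "U 0 (-x) < U 0 (-y)"
    proof -
      have "- U 0 (-y) < - U 0 (-x)"
      proof (rule DERIV_pos_imp_increasing_open[where f="\<lambda>z. - U 0 z"])
        show "-y < -x" using xy by simp
        fix z assume z: "-y < z" "z < -x"
        then have "\<bar>z\<bar> \<le> \<eta>" "z \<noteq> 0" "z < 0" using xy by auto
        then have "- (2 * d z) > 0" using dd[of z] strict[of z] \<eta>' by (simp add: abs_le_iff)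
        then show "\<exists>y. ((\<lambda>z. - U 0 z) has_real_derivative y) (at z) \<and> y > 0" using DERIV_minus[OF dU] by blast
      qed (intro continuous_intros contU)
      then show ?thesis by simp
    qed
    show "U 0 x < U 0 y \<and> U 0 (-x) < U 0 (-y)" using 1 2 by simp
  qed
qed

text \<open>\<open>-1/(4\<pi>u)\<close> is the leading singularity of \<^const>\<open>G1\<close>.\<close>

lemma G1_pole:
  assumes X: "expands (L/2) \<alpha> X x0 x1" and \<alpha>: "0 < \<alpha>" "\<alpha> \<le> 1" and Xc: "continuous_on UNIV X"
  obtains B where "set_integrable lborel {-(L/2)..L/2}
    (\<lambda>h. 2 * G1 k (U 0 h) * X h - ((- x0 / of_real (2 * pi * (speed t)\<^sup>2)) / of_real (h\<^sup>2) + B / of_real h))"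
proof -
  let ?l = "L/2"
  have l: "?l > 0" using L_pos by simp
  obtain c where c: "c > 0" "\<And>h. \<bar>h\<bar> \<le> ?l \<Longrightarrow> c * h\<^sup>2 \<le> U 0 h" by (rule U_lower) blast
  obtain Um where Um: "Um > 0" "\<And>h. \<bar>h\<bar> \<le> ?l \<Longrightarrow> U 0 h \<le> Um" by (rule U_upper) blast
  obtain C where C: "\<And>h. \<bar>h\<bar> \<le> ?l \<Longrightarrow> \<bar>U 0 h - (speed t)\<^sup>2 * h\<^sup>2 - (ddt \<gamma> t \<bullet> ddt (ddt \<gamma>) t) * h ^ 3\<bar> \<le> C * h ^ 4"
    by (rule U_expansion) blast
  obtain B K where BK: "\<And>h. h \<in> {-?l..?l} - {0} \<Longrightarrow>
      norm (X h / of_real (U 0 h) - ((x0 / of_real ((speed t)\<^sup>2)) / of_real (h\<^sup>2) + B / of_real h)) \<le> K * \<bar>h\<bar> powr (\<alpha> - 1)"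
    using quotient_pole[OF X \<alpha> l speed_pos c C] by blast
  obtain S where S: "S \<ge> 0" "\<And>h. \<bar>h\<bar> \<le> ?l \<Longrightarrow> norm (X h) \<le> S"
    using expands_bounded[OF X \<alpha>(1) l] by blast
  obtain D where D: "D \<ge> 0" "\<And>u. 0 < u \<Longrightarrow> u \<le> Um \<Longrightarrow> norm (G1 k u + of_real (1 / (4 * pi * u))) \<le> D * u powr (-1/4)"
    using G_bounds[OF k_pos Um(1)] by metis
  have contU: "continuous_on S (U 0)" for S by (rule cont_basic)
  have Xc': "continuous_on S X" for S using Xc by (rule continuous_on_subset) simp
  have Uc: "continuous_on ({-?l..?l} - {0}) (\<lambda>h. G1 k (U 0 h))"
    by (rule cont_G(1)[OF k_pos]) (use U_pos in auto)
  have Un: "U 0 h \<noteq> 0" if "h \<in> {-?l..?l} - {0}" for h using U_pos[OF that] by simp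
  \<comment> \<open>The remainder has two sources: E1 is the error of replacing G1 by its pole, of
    order U^(-1/4) and hence |h|^(-1/2); E2 is the error of expanding X/U. They are combined with
    the factor -1/(2 pi) = -2/(4 pi).\<close>
  define E1 where "E1 h = 2 * (G1 k (U 0 h) + of_real (1 / (4 * pi * U 0 h))) * X h" for h
  define E2 where "E2 h = X h / of_real (U 0 h) - ((x0 / of_real ((speed t)\<^sup>2)) / of_real (h\<^sup>2) + B / of_real h)" for h
  have "set_integrable lborel {-?l..?l} E1"
  proof (rule set_integrable_of_powr_bound[where b="1/2" and C="2 * (D * c powr (-1/4)) * S"])
    show "continuous_on ({-?l..?l} - {0}) E1"
      unfolding E1_def[abs_def] using Un by (intro continuous_intros Uc contU Xc') auto
    fix h assume hh: "h \<in> {-?l..?l} - {0}"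
    then have h: "\<bar>h\<bar> \<le> ?l" "h \<noteq> 0" by auto
    have "norm (G1 k (U 0 h) + of_real (1 / (4 * pi * U 0 h))) \<le> D * U 0 h powr (-1/4)"
      using U_pos[OF hh] Um(2)[OF h(1)] by (intro D(2)) auto
    also have "\<dots> \<le> D * (c * h\<^sup>2) powr (-1/4)"
      using c h D(1) by (intro mult_left_mono powr_mono2') auto
    also have "(c * h\<^sup>2) powr (-1/4) = c powr (-1/4) * \<bar>h\<bar> powr (1/2 - 1)"
    proof -
      have "h\<^sup>2 = \<bar>h\<bar> powr 2" using h by simp
      then have "(h\<^sup>2) powr (-1/4) = \<bar>h\<bar> powr (1/2 - 1)" by (simp only: powr_powr) simp
      then show ?thesis using c by (simp add: powr_mult)
    qed
    finally have g: "norm (G1 k (U 0 h) + of_real (1 / (4 * pi * U 0 h))) \<le> D * (c powr (-1/4) * \<bar>h\<bar> powr (1/2 - 1))" .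
    have "norm (E1 h) = 2 * norm (G1 k (U 0 h) + of_real (1 / (4 * pi * U 0 h))) * norm (X h)"
      unfolding E1_def norm_mult by (simp only: norm_numeral)
    also have "\<dots> \<le> 2 * (D * (c powr (-1/4) * \<bar>h\<bar> powr (1/2 - 1))) * S"
      using g S(2)[OF h(1)] D(1) by (intro mult_mono) auto
    finally show "norm (E1 h) \<le> 2 * (D * c powr (-1/4)) * S * \<bar>h\<bar> powr (1/2 - 1)" by (simp add: mult_ac)
  qed (use l in auto)
  moreover have "set_integrable lborel {-?l..?l} E2"
  proof (rule set_integrable_of_powr_bound[where b=\<alpha> and C=K])
    show "continuous_on ({-?l..?l} - {0}) E2"
      unfolding E2_def[abs_def] using Un by (intro continuous_intros contU Xc') auto
  qed (use l \<alpha> BK in \<open>auto simp: E2_def\<close>)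
  ultimately have "set_integrable lborel {-?l..?l} (\<lambda>h. E1 h - of_real (1 / (2 * pi)) * E2 h)"
    by (intro set_integral_diff set_integrable_mult_right)
  also have "(\<lambda>h. E1 h - of_real (1 / (2 * pi)) * E2 h)
      = (\<lambda>h. 2 * G1 k (U 0 h) * X h - ((- x0 / of_real (2 * pi * (speed t)\<^sup>2)) / of_real (h\<^sup>2) + (- B / of_real (2 * pi)) / of_real h))"
  proof
    fix h
    have inv: "of_real (1 / (4 * pi * u)) = of_real (1 / (4 * pi)) * (1 / complex_of_real u)" for u by simp
    show "E1 h - of_real (1 / (2 * pi)) * E2 h
      = 2 * G1 k (U 0 h) * X h - ((- x0 / of_real (2 * pi * (speed t)\<^sup>2)) / of_real (h\<^sup>2) + (- B / of_real (2 * pi)) / of_real h)"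
      unfolding E1_def E2_def inv by (simp add: algebra_simps)
  qed
  finally show ?thesis by (rule that)
qed

lemma truncated_fp:
  fixes f :: "real \<Rightarrow> complex"
  assumes "set_integrable lborel {-(L/2)..L/2} (\<lambda>h. f h - (A / of_real (h\<^sup>2) + B / of_real h))"
  obtains w where "((\<lambda>\<delta>. (LINT h:{h\<in>{-(L/2)..L/2}. \<delta> < norm (\<gamma> (t + h) - \<gamma> t)}|lborel. f h)
      - (2 * A * of_real (speed t)) / of_real \<delta>) \<longlongrightarrow> w) (at_right 0)"
proof -
  let ?l = "L/2"
  obtain c where c: "c > 0" "\<And>h. \<bar>h\<bar> \<le> ?l \<Longrightarrow> c * h\<^sup>2 \<le> U 0 h" by (rule U_lower) blast
  obtain C where C: "\<And>h. \<bar>h\<bar> \<le> ?l \<Longrightarrow> \<bar>U 0 h - (speed t)\<^sup>2 * h\<^sup>2 - (ddt \<gamma> t \<bullet> ddt (ddt \<gamma>) t) * h ^ 3\<bar> \<le> C * h ^ 4"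
    by (rule U_expansion) blast
  obtain \<eta> where \<eta>: "0 < \<eta>" "\<eta> \<le> ?l"
    "\<And>x y. 0 \<le> x \<Longrightarrow> x < y \<Longrightarrow> y \<le> \<eta> \<Longrightarrow> U 0 x < U 0 y \<and> U 0 (-x) < U 0 (-y)" by (rule chord_monotone) blast
  have cont: "continuous_on UNIV (\<lambda>h. norm (\<gamma> (t + h) - \<gamma> t))" by (intro continuous_intros)
  let ?r = "\<lambda>h. norm (\<gamma> (t + h) - \<gamma> t)"
  show ?thesis
  proof (rule finite_part_expansion[where r="?r" and f=f and A=A and B=B and \<eta>=\<eta> and l="?l" and v="speed t" and c=c
        and m="ddt \<gamma> t \<bullet> ddt (ddt \<gamma>) t" and C=C])
    show "(?r x)\<^sup>2 < (?r y)\<^sup>2 \<and> (?r (-x))\<^sup>2 < (?r (-y))\<^sup>2" if "0 \<le> x" "x < y" "y \<le> \<eta>" for x y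
      using \<eta>(3)[OF that] unfolding U_0 .
    show "c * h\<^sup>2 \<le> (?r h)\<^sup>2" if "\<bar>h\<bar> \<le> ?l" for h using c(2)[OF that] unfolding U_0 .
    show "\<bar>(?r h)\<^sup>2 - (speed t)\<^sup>2 * h\<^sup>2 - (ddt \<gamma> t \<bullet> ddt (ddt \<gamma>) t) * h ^ 3\<bar> \<le> C * h ^ 4" if "\<bar>h\<bar> \<le> ?l" for h
      using C[OF that] unfolding U_0 .
  qed (use \<eta> c speed_pos cont assms that in simp_all)
qed


section \<open>The four kernels as parts of the derivative at \<epsilon> = 0\<close>

lemma norm_normal: "normal \<gamma> s \<bullet> normal \<gamma> s = 1"
  using speed_pos[of s] by (simp add: normal_eq_rot speed_def power2_norm_eq_inner[symmetric] power2_eq_square)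

text \<open>x - y in the orientation of the Green's function derivatives, opposite to
  \<open>\<Delta> 0 h\<close>.\<close>

definition "D h = \<gamma> t - \<gamma> (t + h)"

definition "hess_kernel h = (2 * G1 k (U 0 h) + of_real (4 * (D h \<bullet> normal \<gamma> t)\<^sup>2) * G2 k (U 0 h))
    * \<sigma> (t + h) * of_real (speed (t + h))"

definition "mixed_kernel h = (- of_real (2 * (normal \<gamma> t \<bullet> normal \<gamma> (t + h))) * G1 k (U 0 h)
      - of_real (4 * (D h \<bullet> normal \<gamma> (t + h)) * (D h \<bullet> normal \<gamma> t)) * G2 k (U 0 h))
    * (of_real (\<nu> (t + h)) * \<sigma> (t + h)) * of_real (speed (t + h))"

definition "tangent_kernel h = of_real (2 * (D h \<bullet> tangent \<gamma> t)) * G1 k (U 0 h) * \<sigma> (t + h) * of_real (speed (t + h))"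

definition "curvature_kernel h = of_real (2 * (D h \<bullet> normal \<gamma> t)) * G1 k (U 0 h)
    * (of_real (curvature \<gamma> (t + h) * \<nu> (t + h)) * \<sigma> (t + h)) * of_real (speed (t + h))"

lemma \<Delta>_D: "\<Delta> 0 h = - D h"
  by (simp add: \<Delta>_0 D_def)

lemma V_0: "V 0 = speed t"
  by (simp add: V_def speed_def)

lemma N_0: "N 0 = speed t *\<^sub>R normal \<gamma> t"
  using speed_pos[of t] by (simp add: N_def normal_eq_rot speed_def)

lemma M_0: "M 0 h = speed t * (D h \<bullet> normal \<gamma> t)"
  by (simp add: M_def \<Delta>_D N_0)

lemma P_0: "P 0 h = (D h \<bullet> normal \<gamma> t) * speed (t + h)"
  using speed_pos[of t] by (simp add: P_def M_0 V_0 W_0)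

lemma ddt_inner_normal: "ddt \<gamma> s \<bullet> normal \<gamma> s = 0"
  by (simp add: normal_eq_rot)

text \<open>The motion of the unnormalised normal. Its normal component only rescales and is undone
  by the normalisation; its tangential component is the tilt of the normal and produces the term
  with \<open>S_tau\<close>.\<close>

lemma rot_q1: "rot (q1 t) = (\<nu> t * curvature \<gamma> t * speed t) *\<^sub>R normal \<gamma> t - ddt \<nu> t *\<^sub>R tangent \<gamma> t"
proof -
  interpret bounded_linear rot by (rule bounded_linear_rot)
  have 1: "rot (ddt \<gamma> t) = speed t *\<^sub>R normal \<gamma> t" using N_0 by (simp add: N_def)
  have 2: "rot (normal \<gamma> t) = - tangent \<gamma> t"
    unfolding normal_eq_rot tangent_def scaleR by (simp add: divide_inverse)
  show ?thesis unfolding q1_def add scaleR 1 2 by simp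
qed

text \<open>The change of speed at t, from \<open>V'\<close>, cancels the normal component of
  \<open>rot_q1\<close>. The change of arc length at t + h, from \<open>W'\<close>, survives as the
  curvature term.\<close>

lemma P'_0: "P' 0 h = speed (t + h) * (\<nu> t - \<nu> (t + h) * (normal \<gamma> t \<bullet> normal \<gamma> (t + h))
    - ddt \<nu> t / speed t * (D h \<bullet> tangent \<gamma> t) + curvature \<gamma> (t + h) * \<nu> (t + h) * (D h \<bullet> normal \<gamma> t))"
proof -
  define v w where "v = speed t" and "w = speed (t + h)"
  have vw: "v > 0" "w > 0" using speed_pos by (auto simp: v_def w_def)
  define dn where "dn = D h \<bullet> normal \<gamma> t"
  define dt where "dt = D h \<bullet> tangent \<gamma> t"
  define nn where "nn = normal \<gamma> t \<bullet> normal \<gamma> (t + h)"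
  define \<kappa>0 where "\<kappa>0 = curvature \<gamma> t"
  define \<kappa>1 where "\<kappa>1 = curvature \<gamma> (t + h)"
  have W': "W' 0 h = \<nu> (t + h) * \<kappa>1 * w"
    using vw(2) unfolding W'_def W_0 q1_def
    by (simp add: inner_add_right ddt_inner_normal power2_norm_eq_inner[symmetric] w_def speed_def power2_eq_square \<kappa>1_def)
  have V': "V' 0 = \<nu> t * \<kappa>0 * v"
    using vw(1) unfolding V'_def V_0 q1_def
    by (simp add: inner_add_right ddt_inner_normal power2_norm_eq_inner[symmetric] v_def speed_def power2_eq_square \<kappa>0_def)
  have b: "(q (t + h) - q t) \<bullet> N 0 = v * (\<nu> (t + h) * nn - \<nu> t)"
    unfolding N_0 q_def by (simp add: inner_diff_left norm_normal nn_def inner_commute v_def algebra_simps)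
  have M': "M' 0 h = v * (\<nu> t - \<nu> (t + h) * nn) + \<nu> t * \<kappa>0 * v * dn - ddt \<nu> t * dt"
    unfolding M'_def b \<Delta>_D rot_q1
    by (simp add: inner_diff_right dn_def dt_def v_def \<kappa>0_def algebra_simps)
  have "P' 0 h = ((v * (\<nu> t - \<nu> (t + h) * nn) + \<nu> t * \<kappa>0 * v * dn - ddt \<nu> t * dt) * w + v * dn * (\<nu> (t + h) * \<kappa>1 * w)) / v
      - v * dn * w * (\<nu> t * \<kappa>0 * v) / v\<^sup>2"
    unfolding P'_def M' W' V' M_0 W_0 V_0 v_def w_def dn_def by (rule refl)
  also have "\<dots> = w * (\<nu> t - \<nu> (t + h) * nn - ddt \<nu> t / v * dt + \<kappa>1 * \<nu> (t + h) * dn)"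
    using vw(1) by (simp add: field_simps power2_eq_square)
  finally show ?thesis by (simp add: v_def w_def dn_def dt_def nn_def \<kappa>1_def)
qed

text \<open>A purely algebraic identity. The \<epsilon>-derivative of U splits into a contribution
  of n(t) and one of n(t + h), which give the G2 parts of the Hessian and mixed kernels; the
  summands of \<open>P'_0\<close> give the G1 parts and the two remaining kernels.\<close>

lemma F'_eq_kernels:
  "F' 0 h = of_real (\<nu> t) * hess_kernel h + mixed_kernel h
     - of_real (ddt \<nu> t / speed t) * tangent_kernel h + curvature_kernel h"
proof -
  have db: "\<Delta> 0 h \<bullet> (q (t + h) - q t) = \<nu> t * (D h \<bullet> normal \<gamma> t) - \<nu> (t + h) * (D h \<bullet> normal \<gamma> (t + h))"
    unfolding \<Delta>_D q_def by (simp add: inner_diff_right)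
  show ?thesis
    unfolding F'_def db P_0 P'_0 hess_kernel_def mixed_kernel_def tangent_kernel_def curvature_kernel_def
    by (simp add: algebra_simps power2_eq_square)
qed

lemma D_cont: "continuous_on S D"
  unfolding D_def[abs_def] by (intro continuous_intros)

lemma shift_cont:
  "continuous_on S (\<lambda>h. speed (t + h))" "continuous_on S (\<lambda>h. \<nu> (t + h))"
  "continuous_on S (\<lambda>h. normal \<gamma> (t + h))" "continuous_on S (\<lambda>h. curvature \<gamma> (t + h))"
proof -
  show "continuous_on S (\<lambda>h. speed (t + h))" by (rule continuous_on_shift[OF cont_speed_inv_speed(1)])
  show "continuous_on S (\<lambda>h. \<nu> (t + h))" by (rule continuous_on_shift[OF smooth_continuous[OF smooth_\<nu>]])
  show "continuous_on S (\<lambda>h. normal \<gamma> (t + h))" by (rule continuous_on_shift[OF C2_with_derivD(2)[OF normal_C2]])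
  have "continuous_on UNIV (curvature \<gamma>)"
    unfolding curvature_def[abs_def] by (intro continuous_intros curve_derivs) (use regular in auto)
  then show "continuous_on S (\<lambda>h. curvature \<gamma> (t + h))" by (rule continuous_on_shift)
qed

lemma kernel_cont:
  "continuous_on ({-(L/2)..L/2} - {0}) hess_kernel" "continuous_on ({-(L/2)..L/2} - {0}) mixed_kernel"
  "continuous_on ({-(L/2)..L/2} - {0}) tangent_kernel" "continuous_on ({-(L/2)..L/2} - {0}) curvature_kernel"
proof -
  have G: "continuous_on ({-(L/2)..L/2} - {0}) (\<lambda>h. G1 k (U 0 h))" "continuous_on ({-(L/2)..L/2} - {0}) (\<lambda>h. G2 k (U 0 h))"
    by (rule cont_G[OF k_pos]; use U_pos in auto)+
  show "continuous_on ({-(L/2)..L/2} - {0}) hess_kernel" "continuous_on ({-(L/2)..L/2} - {0}) mixed_kernel"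
    "continuous_on ({-(L/2)..L/2} - {0}) tangent_kernel" "continuous_on ({-(L/2)..L/2} - {0}) curvature_kernel"
    unfolding hess_kernel_def[abs_def] mixed_kernel_def[abs_def] tangent_kernel_def[abs_def] curvature_kernel_def[abs_def]
    by (intro continuous_intros G D_cont shift_cont)+
qed

section \<open>Poles of the kernels\<close>

text \<open>The mean value inequality, applied to \<sigma> minus its linear part, gains one power of
  |h| over the Hoelder bound for the derivative. The arc-length factor is smooth and is expanded
  with it.\<close>

lemma density_expansion:
  obtains \<alpha> x0 x1 where "0 < \<alpha>" "\<alpha> \<le> 1" "expands (L/2) \<alpha> (\<lambda>h. \<sigma> (t + h) * of_real (speed (t + h))) x0 x1"
proof -
  obtain \<alpha> C where \<alpha>: "0 < \<alpha>" "\<alpha> \<le> 1" and C: "\<And>s t. norm (ddt \<sigma> s - ddt \<sigma> t) \<le> C * \<bar>s - t\<bar> powr \<alpha>"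
    and diff: "\<And>t. \<sigma> differentiable (at t)"
    using hoelder unfolding C1_hoelder_def by blast
  have C0: "C \<ge> 0" using order_trans[OF norm_ge_zero C[of 1 0]] by simp
  have d: "(\<sigma> has_vector_derivative ddt \<sigma> s) (at s)" for s
    using diff unfolding ddt_def by (simp add: vector_derivative_works)
  have 1: "expands (L/2) \<alpha> (\<lambda>h. \<sigma> (t + h)) (\<sigma> t) (ddt \<sigma> t)"
    unfolding expands_def
  proof (intro exI[of _ C] conjI C0 allI impI)
    fix h :: real
    have "norm ((\<sigma> (t + h) - h *\<^sub>R ddt \<sigma> t) - (\<sigma> (t + 0) - 0 *\<^sub>R ddt \<sigma> t)) \<le> (C * \<bar>h\<bar> powr \<alpha>) * \<bar>h\<bar>"
    proof (rule mvt_bound[where f'="\<lambda>z. ddt \<sigma> (t + z) - ddt \<sigma> t"])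
      fix z assume z: "\<bar>z\<bar> \<le> \<bar>h\<bar>"
      have "((\<lambda>z. z *\<^sub>R ddt \<sigma> t) has_vector_derivative ddt \<sigma> t) (at z)"
        using has_vector_derivative_scaleR[OF DERIV_ident has_vector_derivative_const[of "ddt \<sigma> t" "at z"]] by simp
      then show "((\<lambda>h. \<sigma> (t + h) - h *\<^sub>R ddt \<sigma> t) has_vector_derivative ddt \<sigma> (t + z) - ddt \<sigma> t) (at z)"
        by (intro has_vector_derivative_diff shifted_vector_derivative[OF d])
      have "C * \<bar>z\<bar> powr \<alpha> \<le> C * \<bar>h\<bar> powr \<alpha>" using z C0 \<alpha> by (intro mult_left_mono powr_mono2) auto
      then show "norm (ddt \<sigma> (t + z) - ddt \<sigma> t) \<le> C * \<bar>h\<bar> powr \<alpha>" using C[of "t + z" t] by simp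
    qed
    moreover have "\<bar>h\<bar> powr \<alpha> * \<bar>h\<bar> = \<bar>h\<bar> powr (1 + \<alpha>)" by (cases "h = 0") (auto simp: powr_add)
    ultimately show "norm (\<sigma> (t + h) - \<sigma> t - of_real h * ddt \<sigma> t) \<le> C * \<bar>h\<bar> powr (1 + \<alpha>)"
      by (simp add: scaleR_conv_of_real mult.assoc algebra_simps)
  qed
  obtain B where B: "B \<ge> 0" "\<And>h. \<bar>h\<bar> \<le> L/2 \<Longrightarrow> norm (speed (t + h) - speed t - h *\<^sub>R speed1 t) \<le> B * h\<^sup>2"
    using C2_taylor[OF speed_C2, of "L/2" t] by metis
  have 2: "expands (L/2) \<alpha> (\<lambda>h. of_real (speed (t + h))) (of_real (speed t)) (of_real (speed1 t))"
  proof (rule expands_of_quadratic[OF \<alpha>(2) B(1)])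
    fix h assume "\<bar>h\<bar> \<le> L/2"
    moreover have "complex_of_real (speed (t + h)) - of_real (speed t) - of_real h * of_real (speed1 t) = of_real (speed (t + h) - speed t - h * speed1 t)"
      by simp
    ultimately show "norm (complex_of_real (speed (t + h)) - of_real (speed t) - of_real h * of_real (speed1 t)) \<le> B * h\<^sup>2"
      using B(2)[of h] by (simp only: norm_of_real) simp
  qed
  show ?thesis by (rule that[OF \<alpha> expands_mult[OF 1 2 \<alpha>]]) (use L_pos in simp)
qed

text \<open>The constant term is 0, so the numerator of the tangential kernel cancels one order of
  the singularity and only a simple pole remains.\<close>

lemma tangential_chord_expansion:
  assumes "\<alpha> \<le> 1"
  shows "expands (L/2) \<alpha> (\<lambda>h. of_real (D h \<bullet> tangent \<gamma> t)) 0 (- of_real (speed t))"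
proof -
  obtain B where B: "B \<ge> 0" "\<And>h. \<bar>h\<bar> \<le> L/2 \<Longrightarrow> norm (\<gamma> (t + h) - \<gamma> t - h *\<^sub>R ddt \<gamma> t) \<le> B * h\<^sup>2"
    using C2_taylor[OF curve_C2, of "L/2" t] by metis
  show ?thesis
  proof (rule expands_of_quadratic[OF assms B(1)])
    fix h assume h: "\<bar>h\<bar> \<le> L/2"
    let ?\<rho> = "\<gamma> (t + h) - \<gamma> t - h *\<^sub>R ddt \<gamma> t"
    have nt: "norm (tangent \<gamma> t) = 1" using regular[of t] by (simp add: tangent_def)
    have "ddt \<gamma> t \<bullet> tangent \<gamma> t = speed t"
      using speed_pos[of t] by (simp add: tangent_def speed_def power2_norm_eq_inner[symmetric] power2_eq_square)
    then have e: "D h \<bullet> tangent \<gamma> t + h * speed t = - (?\<rho> \<bullet> tangent \<gamma> t)"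
      by (simp add: D_def inner_diff_left)
    have "complex_of_real (D h \<bullet> tangent \<gamma> t) - 0 - of_real h * (- of_real (speed t)) = of_real (D h \<bullet> tangent \<gamma> t + h * speed t)"
      by simp
    moreover have "\<bar>D h \<bullet> tangent \<gamma> t + h * speed t\<bar> \<le> B * h\<^sup>2"
      unfolding e using Cauchy_Schwarz_ineq2[of ?\<rho> "tangent \<gamma> t"] B(2)[OF h] by (simp add: nt)
    ultimately show "norm (complex_of_real (D h \<bullet> tangent \<gamma> t) - 0 - of_real h * (- of_real (speed t))) \<le> B * h\<^sup>2"
      by (simp only: norm_of_real)
  qed
qed

text \<open>The pole comes entirely from the term 2 G1: in the other term the squared normal
  component of the chord is O(h^4) and compensates G2 = O(h^-4).\<close>

lemma hess_kernel_pole: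
  obtains A B where "set_integrable lborel {-(L/2)..L/2} (\<lambda>h. hess_kernel h - (A / of_real (h\<^sup>2) + B / of_real h))"
proof -
  obtain \<alpha> x0 x1 where \<alpha>: "0 < \<alpha>" "\<alpha> \<le> 1" and X: "expands (L/2) \<alpha> (\<lambda>h. \<sigma> (t + h) * of_real (speed (t + h))) x0 x1"
    by (rule density_expansion) blast
  have Xc: "continuous_on UNIV (\<lambda>h. \<sigma> (t + h) * complex_of_real (speed (t + h)))"
    by (intro continuous_intros shift_cont)
  define A where "A = - x0 / of_real (2 * pi * (speed t)\<^sup>2)"
  obtain B where i1: "set_integrable lborel {-(L/2)..L/2}
      (\<lambda>h. 2 * G1 k (U 0 h) * (\<sigma> (t + h) * of_real (speed (t + h))) - (A / of_real (h\<^sup>2) + B / of_real h))"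
    using G1_pole[OF X \<alpha> Xc] unfolding A_def by blast
  define R where "R h = of_real (4 * (D h \<bullet> normal \<gamma> t)\<^sup>2) * G2 k (U 0 h) * (\<sigma> (t + h) * of_real (speed (t + h)))" for h
  have "set_integrable lborel {-(L/2)..L/2} R"
  proof -
    obtain e0 c K where e0: "e0 > 0" and c: "c > 0" and K: "K > 0" and
      b1: "\<And>e h. \<bar>e\<bar> < e0 \<Longrightarrow> \<bar>h\<bar> \<le> L/2 \<Longrightarrow> c * \<bar>h\<bar> \<le> norm (\<Delta> e h) \<and> norm (\<Delta> e h) \<le> K * \<bar>h\<bar>" and
      b3: "\<And>e h. \<bar>e\<bar> < e0 \<Longrightarrow> \<bar>h\<bar> \<le> L/2 \<Longrightarrow> norm (q (t + h) - q t) \<le> K * \<bar>h\<bar> \<and> \<bar>M e h\<bar> \<le> K * h\<^sup>2 \<and> \<bar>M' e h\<bar> \<le> K * h\<^sup>2"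
      by (rule local_bounds) blast
    obtain c' where c': "c' > 0" "\<And>h. \<bar>h\<bar> \<le> L/2 \<Longrightarrow> c' * h\<^sup>2 \<le> U 0 h" by (rule U_lower) blast
    obtain Um where Um: "Um > 0" "\<And>h. \<bar>h\<bar> \<le> L/2 \<Longrightarrow> U 0 h \<le> Um" by (rule U_upper) blast
    obtain C where C: "C \<ge> 0" "\<And>u. 0 < u \<Longrightarrow> u \<le> Um \<Longrightarrow> norm (G2 k u) \<le> C / u\<^sup>2"
      using G_bounds[OF k_pos Um(1)] by metis
    obtain S where S: "S \<ge> 0" "\<And>h. \<bar>h\<bar> \<le> L/2 \<Longrightarrow> norm (\<sigma> (t + h) * of_real (speed (t + h))) \<le> S"
      using expands_bounded[OF X \<alpha>(1)] L_pos by auto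
    define K' where "K' = K / speed t"
    have K': "K' > 0" using K speed_pos by (simp add: K'_def)
    show ?thesis
    proof (rule set_integrable_of_bounded[where C="4 * K'\<^sup>2 * (C / c'\<^sup>2) * S"])
      have G: "continuous_on ({-(L/2)..L/2} - {0}) (\<lambda>h. G2 k (U 0 h))"
        by (rule cont_G(2)[OF k_pos]) (use U_pos in auto)
      show "continuous_on ({-(L/2)..L/2} - {0}) R"
        unfolding R_def[abs_def] by (intro continuous_intros G D_cont shift_cont)
      fix h assume hh: "h \<in> {-(L/2)..L/2} - {0}"
      then have h: "\<bar>h\<bar> \<le> L/2" "h \<noteq> 0" by auto
      \<comment> \<open>At e = 0 the numerator \<open>M\<close> is the normal component of the chord
        times the speed, so the bound of \<open>local_bounds\<close> can be reused.\<close>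
      have "speed t * \<bar>D h \<bullet> normal \<gamma> t\<bar> \<le> K * h\<^sup>2"
        using b3[of 0 h] e0 h(1) speed_pos[of t] by (simp add: M_0 abs_mult)
      then have "\<bar>D h \<bullet> normal \<gamma> t\<bar> \<le> K' * h\<^sup>2" using speed_pos[of t] by (simp add: K'_def pos_le_divide_eq mult.commute)
      then have "\<bar>D h \<bullet> normal \<gamma> t\<bar>\<^sup>2 \<le> (K' * h\<^sup>2)\<^sup>2" by (intro power_mono) auto
      then have 1: "\<bar>4 * (D h \<bullet> normal \<gamma> t)\<^sup>2\<bar> \<le> 4 * (K' * h\<^sup>2)\<^sup>2" by simp
      have "norm (G2 k (U 0 h)) \<le> C / (U 0 h)\<^sup>2" using U_pos[OF hh] Um(2)[OF h(1)] by (intro C) auto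
      also have "\<dots> \<le> C / (c' * h\<^sup>2)\<^sup>2"
        using C(1) c' h U_pos[OF hh] by (intro divide_left_mono power_mono mult_pos_pos) auto
      finally have 2: "norm (G2 k (U 0 h)) \<le> C / (c' * h\<^sup>2)\<^sup>2" .
      have "norm (R h) \<le> (4 * (K' * h\<^sup>2)\<^sup>2) * (C / (c' * h\<^sup>2)\<^sup>2) * S"
        unfolding R_def norm_mult[of _ "\<sigma> (t + h) * of_real (speed (t + h))"] norm_mult[of _ "G2 k (U 0 h)"] norm_of_real
        using 1 2 S(2)[OF h(1)] C(1) by (intro mult_mono) auto
      also have "\<dots> = 4 * K'\<^sup>2 * (C / c'\<^sup>2) * S" using h by (simp add: power_mult_distrib)
      finally show "norm (R h) \<le> 4 * K'\<^sup>2 * (C / c'\<^sup>2) * S" .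
    qed (use L_pos in simp)
  qed
  from set_integral_add(1)[OF i1 this] show ?thesis
    by (intro that[of A B]) (simp add: hess_kernel_def R_def algebra_simps)
qed

lemma tangent_kernel_pole:
  obtains B where "set_integrable lborel {-(L/2)..L/2} (\<lambda>h. tangent_kernel h - (0 / of_real (h\<^sup>2) + B / of_real h))"
proof -
  obtain \<alpha> x0 x1 where \<alpha>: "0 < \<alpha>" "\<alpha> \<le> 1" and X: "expands (L/2) \<alpha> (\<lambda>h. \<sigma> (t + h) * of_real (speed (t + h))) x0 x1"
    by (rule density_expansion) blast
  let ?X = "\<lambda>h. of_real (D h \<bullet> tangent \<gamma> t) * (\<sigma> (t + h) * complex_of_real (speed (t + h)))"
  have "\<exists>x1. expands (L/2) \<alpha> ?X 0 x1"
    using expands_mult[OF tangential_chord_expansion[OF \<alpha>(2)] X \<alpha>] L_pos by auto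
  then obtain y1 where Y: "expands (L/2) \<alpha> ?X 0 y1" by blast
  have Yc: "continuous_on UNIV ?X" by (intro continuous_intros shift_cont D_cont)
  obtain B where "set_integrable lborel {-(L/2)..L/2}
      (\<lambda>h. 2 * G1 k (U 0 h) * ?X h - ((- 0 / of_real (2 * pi * (speed t)\<^sup>2)) / of_real (h\<^sup>2) + B / of_real h))"
    using G1_pole[OF Y \<alpha> Yc] by blast
  then show ?thesis
    by (intro that[of B]) (simp add: tangent_kernel_def mult_ac)
qed

text \<open>The kernel is the unperturbed integrand \<open>F k 0\<close>, already known to be
  bounded, times the continuous function \<kappa> \<nu>.\<close>

lemma curvature_kernel_integrable: "set_integrable lborel {-(L/2)..L/2} curvature_kernel"
proof -
  obtain e0 where e0: "e0 > 0" and
    b: "\<And>\<kappa>. \<kappa> > 0 \<Longrightarrow> \<exists>C. \<forall>e h. \<bar>e\<bar> < e0 \<longrightarrow> h \<in> {-(L/2)..L/2} - {0} \<longrightarrow> norm (F \<kappa> e h) \<le> C"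
    by (rule kernel_bounds) blast
  obtain C where C: "\<forall>e h. \<bar>e\<bar> < e0 \<longrightarrow> h \<in> {-(L/2)..L/2} - {0} \<longrightarrow> norm (F k e h) \<le> C" using b[OF k_pos] by blast
  have eq: "curvature_kernel h = F k 0 h * of_real (curvature \<gamma> (t + h) * \<nu> (t + h))" for h
    by (simp add: curvature_kernel_def F_def P_0 mult_ac)
  have "continuous_on UNIV (\<lambda>h. curvature \<gamma> (t + h) * \<nu> (t + h))" by (intro continuous_intros shift_cont)
  from continuous_bound_interval[OF this, of "L/2" 0] obtain B where
    B: "B \<ge> 0" "\<And>h. \<bar>h\<bar> \<le> L/2 \<Longrightarrow> norm (curvature \<gamma> (t + (0 + h)) * \<nu> (t + (0 + h))) \<le> B" by blast
  show ?thesis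
  proof (rule set_integrable_of_bounded[where C="\<bar>C\<bar> * B"])
    fix h assume hh: "h \<in> {-(L/2)..L/2} - {0}"
    then have h: "\<bar>h\<bar> \<le> L/2" by auto
    have "norm (F k 0 h) \<le> C" using C[rule_format, of 0 h] e0 hh by simp
    then have "norm (F k 0 h) \<le> \<bar>C\<bar>" by linarith
    then show "norm (curvature_kernel h) \<le> \<bar>C\<bar> * B"
      unfolding eq norm_mult[of "F k 0 h"] norm_of_real using B(2)[OF h] by (intro mult_mono) auto
  qed (use kernel_cont L_pos in auto)
qed


section \<open>Limits of the truncated integrals\<close>

lemma D_inner_self: "D h \<bullet> D h = U 0 h"
  by (simp add: U_def \<Delta>_D)

lemma curvature_periodic: "curvature \<gamma> (s + L) = curvature \<gamma> s"
  using ddt_periodic[OF ddt_curve_periodic curve_derivs(2)] by (simp add: curvature_def ddt_curve_periodic)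

lemmas curve_periodic_simps = periodic \<sigma>_periodic \<nu>_periodic normal_periodic curvature_periodic ddt_curve_periodic

definition "trunc K \<delta> = (LINT h:{h\<in>{-(L/2)..L/2}. \<delta> < norm (\<gamma> (t + h) - \<gamma> t)}|lborel. K h)"

lemma truncated_integral_eq_trunc:
  assumes "\<And>s. f (s + L) = f s" "continuous_on ({-(L/2)..L/2} - {0}) K"
    and "\<And>h. h \<in> {-(L/2)..L/2} - {0} \<Longrightarrow> f (t + h) * of_real (speed (t + h)) = K h" and "\<delta> > 0"
  shows "truncated_integral \<gamma> L t f \<delta> = trunc K \<delta>"
  unfolding trunc_def
  by (rule truncated_integral_shift[where g=\<gamma> and f=f, OF t_mem periodic assms(1) ddt_curve_periodic curve_derivs(4) assms(2)])
     (use assms(3,4) in \<open>simp_all add: speed_def\<close>)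

lemma trunc_transform:
  assumes "\<And>\<delta>. \<delta> > 0 \<Longrightarrow> f \<delta> = g \<delta>" "((\<lambda>\<delta>. g \<delta> - c / of_real \<delta>) \<longlongrightarrow> (w :: complex)) (at_right 0)"
  shows "((\<lambda>\<delta>. f \<delta> - c / of_real \<delta>) \<longlongrightarrow> w) (at_right 0)"
  using assms(2)
  by (rule Lim_transform_eventually)
     (use eventually_at_right_less[of "0::real"] in \<open>eventually_elim, simp add: assms(1)\<close>)

text \<open>The value of c is left open: it reappears with the factor -\<nu>(t) as the divergent
  coefficient of the mixed kernel.\<close>

lemma S_second_limit:
  obtains c where "((\<lambda>\<delta>. trunc hess_kernel \<delta> - c / of_real \<delta>) \<longlongrightarrow> S_second k \<gamma> L \<sigma> t) (at_right 0)"
proof -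
  obtain A B where "set_integrable lborel {-(L/2)..L/2} (\<lambda>h. hess_kernel h - (A / of_real (h\<^sup>2) + B / of_real h))"
    by (rule hess_kernel_pole)
  then obtain w where w: "((\<lambda>\<delta>. trunc hess_kernel \<delta> - (2 * A * of_real (speed t)) / of_real \<delta>) \<longlongrightarrow> w) (at_right 0)"
    unfolding trunc_def by (rule truncated_fp)
  let ?f = "\<lambda>s. hess_form (normal \<gamma> t) (\<lambda>x. green k x (\<gamma> s)) (\<gamma> t) * \<sigma> s"
  have "truncated_integral \<gamma> L t ?f \<delta> = trunc hess_kernel \<delta>" if "\<delta> > 0" for \<delta>
  proof (rule truncated_integral_eq_trunc[OF _ kernel_cont(1) _ that])
    fix h assume "h \<in> {-(L/2)..L/2} - {0}"
    then have "\<gamma> t \<noteq> \<gamma> (t + h)" using chord_nonzero[OF t_mem] by metis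
    then show "?f (t + h) * of_real (speed (t + h)) = hess_kernel h"
      by (simp add: hess_form_green[OF k_pos] hess_kernel_def norm_normal D_inner_self flip: D_def)
  qed (simp add: curve_periodic_simps)
  from trunc_transform[OF this w] have "S_second k \<gamma> L \<sigma> t = w"
    unfolding S_second_def by (rule fp_integral_eqI)
  with w show ?thesis by (intro that) simp
qed

text \<open>The double-pole coefficient is 0, so the divergent term 2 A v / \<delta> is absent and
  the expansion is an ordinary limit, that is, the principal value exists.\<close>

lemma S_tau_limit: "(trunc tangent_kernel \<longlongrightarrow> S_tau k \<gamma> L \<sigma> t) (at_right 0)"
proof -
  obtain B where "set_integrable lborel {-(L/2)..L/2} (\<lambda>h. tangent_kernel h - (0 / of_real (h\<^sup>2) + B / of_real h))"
    by (rule tangent_kernel_pole)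
  then obtain w where "((\<lambda>\<delta>. trunc tangent_kernel \<delta> - (2 * 0 * of_real (speed t)) / of_real \<delta>) \<longlongrightarrow> w) (at_right 0)"
    unfolding trunc_def by (rule truncated_fp)
  then have w: "(trunc tangent_kernel \<longlongrightarrow> w) (at_right 0)" by simp
  let ?f = "\<lambda>s. dot_grad (tangent \<gamma> t) (\<lambda>x. green k x (\<gamma> s)) (\<gamma> t) * \<sigma> s"
  have "truncated_integral \<gamma> L t ?f \<delta> = trunc tangent_kernel \<delta>" if "\<delta> > 0" for \<delta>
  proof (rule truncated_integral_eq_trunc[OF _ kernel_cont(3) _ that])
    fix h assume "h \<in> {-(L/2)..L/2} - {0}"
    then have "\<gamma> t \<noteq> \<gamma> (t + h)" using chord_nonzero[OF t_mem] by metis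
    then show "?f (t + h) * of_real (speed (t + h)) = tangent_kernel h"
      by (simp add: dot_grad_green[OF k_pos] tangent_kernel_def D_inner_self flip: D_def)
  qed (simp add: curve_periodic_simps)
  from trunc_transform[OF this, of _ 0 w] w have "(truncated_integral \<gamma> L t ?f \<longlongrightarrow> w) (at_right 0)" by simp
  then have "S_tau k \<gamma> L \<sigma> t = w"
    unfolding S_tau_def pv_integral_def by (intro tendsto_Lim) auto
  with w show ?thesis by simp
qed

lemma S_prime_curvature_limit:
  "(trunc curvature_kernel \<longlongrightarrow> S_prime k \<gamma> L (\<lambda>s. of_real (curvature \<gamma> s * \<nu> s) * \<sigma> s) t) (at_right 0)"
proof -
  have w: "(trunc curvature_kernel \<longlongrightarrow> (LINT h:{-(L/2)..L/2}|lborel. curvature_kernel h)) (at_right 0)"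
    unfolding trunc_def
  proof (rule truncated_tendsto[OF curvature_kernel_integrable])
    show "(\<lambda>h. norm (\<gamma> (t + h) - \<gamma> t)) \<in> borel_measurable borel"
      by (intro borel_measurable_continuous_onI continuous_intros)
  qed (use chord_nonzero[OF t_mem] in auto)
  let ?w = "LINT h:{-(L/2)..L/2}|lborel. curvature_kernel h"
  let ?f = "\<lambda>s. dot_grad (normal \<gamma> t) (\<lambda>x. green k x (\<gamma> s)) (\<gamma> t) * (of_real (curvature \<gamma> s * \<nu> s) * \<sigma> s)"
  have "truncated_integral \<gamma> L t ?f \<delta> = trunc curvature_kernel \<delta>" if "\<delta> > 0" for \<delta>
  proof (rule truncated_integral_eq_trunc[OF _ kernel_cont(4) _ that])
    fix h assume "h \<in> {-(L/2)..L/2} - {0}"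
    then have "\<gamma> t \<noteq> \<gamma> (t + h)" using chord_nonzero[OF t_mem] by metis
    then show "?f (t + h) * of_real (speed (t + h)) = curvature_kernel h"
      by (simp add: dot_grad_green[OF k_pos] curvature_kernel_def D_inner_self flip: D_def)
  qed (simp add: curve_periodic_simps)
  from trunc_transform[OF this, of _ 0 ?w] w have "(truncated_integral \<gamma> L t ?f \<longlongrightarrow> ?w) (at_right 0)" by simp
  then have "S_prime k \<gamma> L (\<lambda>s. of_real (curvature \<gamma> s * \<nu> s) * \<sigma> s) t = ?w"
    unfolding S_prime_def pv_integral_def by (intro tendsto_Lim) auto
  with w show ?thesis by simp
qed

text \<open>The truncated integrals of \<open>F' 0\<close> converge, so the expansion of the mixed kernel follows from
  those of the other three; its divergent part cancels that of \<^const>\<open>S_second\<close>.\<close>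

lemma shape_derivative_value:
  "(LINT h:{-(L/2)..L/2}|lborel. F' 0 h) =
     of_real (\<nu> t) * S_second k \<gamma> L \<sigma> t + D_prime k \<gamma> L (\<lambda>s. of_real (\<nu> s) * \<sigma> s) t
     - of_real (ddt \<nu> t / norm (ddt \<gamma> t)) * S_tau k \<gamma> L \<sigma> t
     + S_prime k \<gamma> L (\<lambda>s. of_real (curvature \<gamma> s * \<nu> s) * \<sigma> s) t"
proof -
  let ?I = "LINT h:{-(L/2)..L/2}|lborel. F' 0 h"
  let ?S4 = "S_prime k \<gamma> L (\<lambda>s. of_real (curvature \<gamma> s * \<nu> s) * \<sigma> s) t"
  define n a where "n = complex_of_real (\<nu> t)" and "a = complex_of_real (ddt \<nu> t / speed t)"
  obtain c where c: "((\<lambda>\<delta>. trunc hess_kernel \<delta> - c / of_real \<delta>) \<longlongrightarrow> S_second k \<gamma> L \<sigma> t) (at_right 0)"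
    by (rule S_second_limit)
  have rcont: "continuous_on UNIV (\<lambda>h. norm (\<gamma> (t + h) - \<gamma> t))" by (intro continuous_intros)
  have I: "(trunc (F' 0) \<longlongrightarrow> ?I) (at_right 0)"
    unfolding trunc_def
  proof (rule truncated_tendsto)
    show "set_integrable lborel {-(L/2)..L/2} (F' 0)" by (rule F_integrable)
  qed (use chord_nonzero[OF t_mem] rcont in \<open>auto intro: borel_measurable_continuous_onI\<close>)
  have lin: "trunc mixed_kernel \<delta> = trunc (F' 0) \<delta> - n * trunc hess_kernel \<delta> + a * trunc tangent_kernel \<delta> - trunc curvature_kernel \<delta>"
    if "\<delta> > 0" for \<delta>
  proof -
    let ?S = "{h\<in>{-(L/2)..L/2}. \<delta> < norm (\<gamma> (t + h) - \<gamma> t)}"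
    have i1: "set_integrable lborel ?S hess_kernel" and i2: "set_integrable lborel ?S mixed_kernel"
      and i3: "set_integrable lborel ?S tangent_kernel" and i4: "set_integrable lborel ?S curvature_kernel"
      by (rule truncated_integrable[OF _ rcont _ that], rule kernel_cont, simp)+
    have "trunc (F' 0) \<delta> = (LINT h:?S|lborel. n * hess_kernel h + mixed_kernel h - a * tangent_kernel h + curvature_kernel h)"
      unfolding trunc_def n_def a_def F'_eq_kernels ..
    also have "\<dots> = n * trunc hess_kernel \<delta> + trunc mixed_kernel \<delta> - a * trunc tangent_kernel \<delta> + trunc curvature_kernel \<delta>"
      unfolding trunc_def using i1 i2 i3 i4 by simp
    finally show ?thesis by simp
  qed
  have "((\<lambda>\<delta>. trunc (F' 0) \<delta> - n * (trunc hess_kernel \<delta> - c / of_real \<delta>) + a * trunc tangent_kernel \<delta> - trunc curvature_kernel \<delta>)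
      \<longlongrightarrow> ?I - n * S_second k \<gamma> L \<sigma> t + a * S_tau k \<gamma> L \<sigma> t - ?S4) (at_right 0)"
    by (intro tendsto_intros I c S_tau_limit S_prime_curvature_limit)
  then have "((\<lambda>\<delta>. (trunc (F' 0) \<delta> - n * trunc hess_kernel \<delta> + a * trunc tangent_kernel \<delta> - trunc curvature_kernel \<delta>) - (- n * c) / of_real \<delta>)
      \<longlongrightarrow> ?I - n * S_second k \<gamma> L \<sigma> t + a * S_tau k \<gamma> L \<sigma> t - ?S4) (at_right 0)"
    by (rule Lim_transform_eventually) (simp add: algebra_simps)
  from trunc_transform[OF lin this]
  have lim: "((\<lambda>\<delta>. trunc mixed_kernel \<delta> - (- n * c) / of_real \<delta>)
      \<longlongrightarrow> ?I - n * S_second k \<gamma> L \<sigma> t + a * S_tau k \<gamma> L \<sigma> t - ?S4) (at_right 0)" .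
  let ?f = "\<lambda>s. dot_grad (normal \<gamma> t) (\<lambda>x. dot_grad (normal \<gamma> s) (\<lambda>y. green k x y) (\<gamma> s)) (\<gamma> t) * (of_real (\<nu> s) * \<sigma> s)"
  have "truncated_integral \<gamma> L t ?f \<delta> = trunc mixed_kernel \<delta>" if "\<delta> > 0" for \<delta>
  proof (rule truncated_integral_eq_trunc[OF _ kernel_cont(2) _ that])
    fix h assume "h \<in> {-(L/2)..L/2} - {0}"
    then have "\<gamma> t \<noteq> \<gamma> (t + h)" using chord_nonzero[OF t_mem] by metis
    then show "?f (t + h) * of_real (speed (t + h)) = mixed_kernel h"
      by (simp add: dot_grad_dot_grad_green[OF k_pos] mixed_kernel_def D_inner_self flip: D_def)
  qed (simp add: curve_periodic_simps)
  from trunc_transform[OF this lim]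
  have "D_prime k \<gamma> L (\<lambda>s. of_real (\<nu> s) * \<sigma> s) t = ?I - n * S_second k \<gamma> L \<sigma> t + a * S_tau k \<gamma> L \<sigma> t - ?S4"
    unfolding D_prime_def by (rule fp_integral_eqI)
  then show ?thesis by (simp add: n_def a_def speed_def)
qed

lemmas S_prime_shape_derivative = S_prime_perturb_derivative[unfolded shape_derivative_value]

section \<open>The wavenumber derivative\<close>

text \<open>By \<open>G1_wavenumber_deriv\<close> the differentiated kernel contains only
  \<open>psi\<close>, which is (i/4) H_0. The factor is 2 (-k/2) (i/4) = -i k/4, where the minus
  sign is the one in Bessel's equation (w psi')' = -psi/4. The numerator of order h^2 makes the
  integrand bounded.\<close>

lemma S_prime_wavenumber_derivative:
  "((\<lambda>\<kappa>. S_prime \<kappa> \<gamma> L \<sigma> t) has_vector_derivative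
     - (\<i> * of_real k / 4) * (LINT s:{0..L}|lborel. hankel1_0 (k * dist (\<gamma> t) (\<gamma> s))
        * of_real ((\<gamma> t - \<gamma> s) \<bullet> normal \<gamma> t) * \<sigma> s * of_real (norm (ddt \<gamma> s)))) (at k)"
proof -
  obtain e0 where e0: "e0 > 0" and
    p: "\<And>e h. \<bar>e\<bar> < e0 \<Longrightarrow> h \<in> {-(L/2)..L/2} - {0} \<Longrightarrow> U e h > 0 \<and> V e > 0 \<and> W e h > 0" and
    i: "\<And>\<kappa> e. \<kappa> > 0 \<Longrightarrow> \<bar>e\<bar> < e0 \<Longrightarrow> set_integrable lborel {-(L/2)..L/2} (F \<kappa> e)"
    by (rule F_integrable) blast
  have V: "V 0 > 0" using speed_pos by (simp add: V_0)
  define E where "E \<kappa> h = 2 * (- (of_real (\<kappa> / 2) * psi (\<kappa>\<^sup>2 * U 0 h)) * of_real (P 0 h)) * \<sigma> (t + h)" for \<kappa> h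
  obtain c where c: "c > 0" "\<And>h. \<bar>h\<bar> \<le> L/2 \<Longrightarrow> c * h\<^sup>2 \<le> U 0 h" by (rule U_lower) blast
  obtain Um where Um: "Um > 0" "\<And>h. \<bar>h\<bar> \<le> L/2 \<Longrightarrow> U 0 h \<le> Um" by (rule U_upper) blast
  obtain S where S: "S > 0" "\<And>h. \<bar>h\<bar> \<le> L/2 \<Longrightarrow> norm (\<sigma> (t + h)) \<le> S" by (rule \<sigma>_bound) blast
  obtain K where K: "K \<ge> 0" "\<And>h. \<bar>h\<bar> \<le> L/2 \<Longrightarrow> \<bar>P 0 h\<bar> \<le> K * h\<^sup>2"
  proof -
    obtain e1 c1 K1 where e1: "e1 > 0" and c1: "c1 > 0" and K1: "K1 > 0" and
      b2: "\<And>e h. \<bar>e\<bar> < e1 \<Longrightarrow> \<bar>h\<bar> \<le> L/2 \<Longrightarrow> c1 \<le> V e \<and> c1 \<le> W e h \<and> W e h \<le> K1 \<and> \<bar>V' e\<bar> \<le> K1 \<and> \<bar>W' e h\<bar> \<le> K1" and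
      b3: "\<And>e h. \<bar>e\<bar> < e1 \<Longrightarrow> \<bar>h\<bar> \<le> L/2 \<Longrightarrow> norm (q (t + h) - q t) \<le> K1 * \<bar>h\<bar> \<and> \<bar>M e h\<bar> \<le> K1 * h\<^sup>2 \<and> \<bar>M' e h\<bar> \<le> K1 * h\<^sup>2"
      by (rule local_bounds) blast
    show ?thesis
    proof (rule that[of "K1 * K1 / c1"])
      fix h assume h: "\<bar>h\<bar> \<le> L/2"
      have B: "c1 \<le> V 0" "c1 \<le> W 0 h" "W 0 h \<le> K1" "\<bar>M 0 h\<bar> \<le> K1 * h\<^sup>2" using b2[of 0 h] b3[of 0 h] h e1 by auto
      have "\<bar>P 0 h\<bar> = \<bar>M 0 h\<bar> * W 0 h / V 0" using B c1 by (simp add: P_def abs_mult abs_divide)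
      also have "\<dots> \<le> (K1 * h\<^sup>2) * K1 / c1" using B c1 K1 by (intro frac_le mult_mono) auto
      finally show "\<bar>P 0 h\<bar> \<le> K1 * K1 / c1 * h\<^sup>2" by (simp add: mult_ac)
    qed (use c1 K1 in simp)
  qed
  \<comment> \<open>Wavenumbers within k/2 of k lie between k/2 and 2 k, so (2 k)^2 Um bounds all
    arguments of \<open>psi\<close> that occur.\<close>
  define Wm where "Wm = (2 * k)\<^sup>2 * Um"
  have "Wm > 0" using k_pos Um by (simp add: Wm_def)
  then obtain C where C: "C \<ge> 0" "\<And>w. 0 < w \<Longrightarrow> w \<le> Wm \<Longrightarrow> norm (psi w) \<le> C / w"
    by (rule psi_inverse_bound) blast
  have near: "\<kappa> > 0" "k / 2 < \<kappa>" "\<kappa> < 2 * k" if "\<bar>\<kappa> - k\<bar> < k / 2" for \<kappa>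
    using that k_pos by (auto simp: abs_if split: if_splits)
  have bd: "norm (E \<kappa> h) \<le> 2 * (k * (C / ((k/2)\<^sup>2 * c)) * K) * S"
    if \<kappa>: "\<bar>\<kappa> - k\<bar> < k / 2" and hh: "h \<in> {-(L/2)..L/2} - {0}" for \<kappa> h
  proof -
    have h: "\<bar>h\<bar> \<le> L/2" "h \<noteq> 0" using hh by auto
    note \<kappa>' = near[OF \<kappa>]
    have "(k/2)\<^sup>2 * (c * h\<^sup>2) \<le> \<kappa>\<^sup>2 * U 0 h"
      using \<kappa>' k_pos c h by (intro mult_mono power_mono) auto
    moreover have "0 < (k/2)\<^sup>2 * (c * h\<^sup>2)" using k_pos c h by simp
    moreover have "\<kappa>\<^sup>2 * U 0 h \<le> Wm"
      unfolding Wm_def using \<kappa>' U_pos[OF hh] Um h by (intro mult_mono power_mono) auto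
    moreover have "0 < \<kappa>\<^sup>2 * U 0 h" using \<kappa>'(1) U_pos[OF hh] by simp
    ultimately have "norm (psi (\<kappa>\<^sup>2 * U 0 h)) \<le> C / ((k/2)\<^sup>2 * (c * h\<^sup>2))"
      using C(2)[of "\<kappa>\<^sup>2 * U 0 h"] divide_left_mono[of "(k/2)\<^sup>2 * (c * h\<^sup>2)" "\<kappa>\<^sup>2 * U 0 h" C] C(1) by (auto intro: order_trans)
    moreover have "norm (complex_of_real (\<kappa> / 2)) \<le> k" using \<kappa>' by (simp del: of_real_divide)
    ultimately have "norm (E \<kappa> h) \<le> 2 * (k * (C / ((k/2)\<^sup>2 * (c * h\<^sup>2))) * (K * h\<^sup>2)) * S"
      unfolding E_def norm_mult norm_minus_cancel norm_of_real
      using K(2)[OF h(1)] S(2)[OF h(1)] K(1) C(1) S(1) k_pos c by (intro mult_mono mult_nonneg_nonneg) auto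
    also have "\<dots> = 2 * (k * (C / ((k/2)\<^sup>2 * c)) * K) * S" using h by simp
    finally show ?thesis .
  qed
  have contE: "continuous_on ({-(L/2)..L/2} - {0}) (E k)"
  proof -
    have p: "continuous_on {0<..} psi"
      by (intro continuous_at_imp_continuous_on ballI has_vector_derivative_continuous[OF psi_deriv]) simp
    have cU: "continuous_on S (U 0)" for S by (rule cont_basic)
    have "continuous_on ({-(L/2)..L/2} - {0}) (\<lambda>h. k\<^sup>2 * U 0 h)" by (intro continuous_intros cU)
    then have "continuous_on ({-(L/2)..L/2} - {0}) (\<lambda>h. psi (k\<^sup>2 * U 0 h))"
    proof (rule continuous_on_compose2[OF p])
      have "k\<^sup>2 * U 0 h > 0" if "h \<in> {-(L/2)..L/2} - {0}" for h using U_pos[OF that] k_pos by simp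
      then show "(\<lambda>h. k\<^sup>2 * U 0 h) ` ({-(L/2)..L/2} - {0}) \<subseteq> {0<..}" by blast
    qed
    then show ?thesis
      unfolding E_def[abs_def] P_0 by (intro continuous_intros D_cont shift_cont)
  qed
  have intE: "set_integrable lborel {-(L/2)..L/2} (E k)"
    by (rule set_integrable_of_bounded[OF contE _ bd]) (use L_pos k_pos in auto)
  have S_F: "S_prime \<kappa> \<gamma> L \<sigma> t = (LINT h:{-(L/2)..L/2}|lborel. F \<kappa> 0 h)" if "\<kappa> > 0" for \<kappa>
    using S_prime_perturb[OF that U_pos V i[OF that]] e0 by (simp add: perturb_0)
  have "((\<lambda>\<kappa>. LINT h:{-(L/2)..L/2}|lborel. F \<kappa> 0 h) has_vector_derivative (LINT h:{-(L/2)..L/2}|lborel. E k h)) (at k)"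
  proof (rule has_vector_derivative_set_integral[where F="\<lambda>\<kappa>. F \<kappa> 0" and F'=E and e="k/2"])
    fix \<kappa> assume \<kappa>: "\<bar>\<kappa> - k\<bar> < k / 2"
    show "set_integrable lborel {-(L/2)..L/2} (F \<kappa> 0)" using i[OF near(1)[OF \<kappa>], of 0] e0 by simp
    fix h assume h: "h \<in> {-(L/2)..L/2} - {0}"
    from has_vector_derivative_mult_left[OF has_vector_derivative_mult_right[OF
        has_vector_derivative_mult_left[OF G1_wavenumber_deriv[OF near(1)[OF \<kappa>] U_pos[OF h]]]]]
    show "((\<lambda>\<kappa>. F \<kappa> 0 h) has_vector_derivative E \<kappa> h) (at \<kappa>)" unfolding F_def E_def .
    show "norm (E \<kappa> h) \<le> 2 * (k * (C / ((k/2)\<^sup>2 * c)) * K) * S" by (rule bd[OF \<kappa> h])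
  qed (use k_pos L_pos intE in auto)
  then have der: "((\<lambda>\<kappa>. S_prime \<kappa> \<gamma> L \<sigma> t) has_vector_derivative (LINT h:{-(L/2)..L/2}|lborel. E k h)) (at k)"
    by (rule has_vector_derivative_transform_within_open[where S="{0<..}"]) (use k_pos S_F in auto)
  define g where "g s = hankel1_0 (k * dist (\<gamma> t) (\<gamma> s)) * of_real ((\<gamma> t - \<gamma> s) \<bullet> normal \<gamma> t) * \<sigma> s * of_real (norm (ddt \<gamma> s))" for s
  \<comment> \<open>At h = 0 the values of \<open>psi\<close> and \<open>hankel1_0\<close> are
    meaningless, but both sides vanish because D 0 = 0.\<close>
  have Eg: "E k h = - (\<i> * of_real k / 4) * g (t + h)" if "h \<in> {-(L/2)..L/2}" for h
  proof (cases "h = 0")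
    case True
    then show ?thesis by (simp add: E_def g_def P_0 D_def)
  next
    case False
    then have "\<gamma> t \<noteq> \<gamma> (t + h)" using that chord_nonzero[OF t_mem, of h] by auto
    from green_eq_psi[OF k_pos this] have ps: "\<i> / 4 * hankel1_0 (k * dist (\<gamma> t) (\<gamma> (t + h))) = psi (k\<^sup>2 * U 0 h)"
      unfolding green_def D_def[symmetric] D_inner_self .
    show ?thesis
      unfolding E_def g_def ps[symmetric] P_0 D_def speed_def by simp
  qed
  have per: "g (s + L) = g s" for s by (simp add: g_def curve_periodic_simps)
  \<comment> \<open>4 i / k is the reciprocal of -i k / 4, so integrability passes from
    \<open>E k\<close> to g.\<close>
  have "set_integrable lborel {-(L/2)..L/2} (\<lambda>h. (4 * \<i> / of_real k) * E k h)"
    using intE by (rule set_integrable_mult_right)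
  also have "?this \<longleftrightarrow> set_integrable lborel {-(L/2)..L/2} (\<lambda>h. g (t + h))"
    by (rule set_integrable_cong) (use Eg k_pos in \<open>auto simp: field_simps\<close>)
  finally have gi: "set_integrable lborel {-(L/2)..L/2} (\<lambda>h. g (t + h))" .
  have "(LINT h:{-(L/2)..L/2}|lborel. E k h) = (LINT h:{-(L/2)..L/2}|lborel. - (\<i> * of_real k / 4) * g (t + h))"
    by (rule set_lebesgue_integral_cong) (use Eg in auto)
  also have "\<dots> = - (\<i> * of_real k / 4) * (LINT h:{-(L/2)..L/2}|lborel. g (t + h))"
    by (rule set_integral_mult_right)
  also have "\<dots> = - (\<i> * of_real k / 4) * (LINT s:{0..L}|lborel. g s)"
    unfolding set_integral_period[OF per t_mem gi] ..
  finally show ?thesis using der unfolding g_def by simp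
qed

end

text \<open>All estimates are made for one fixed parameter t, so both derivatives are pointwise in
  t; stated with \<open>has_vector_derivative\<close>, they include the existence of the
  derivative.\<close>

theorem lemma11:
  fixes \<Omega> :: "(real^2) set" and \<gamma> :: "real \<Rightarrow> real^2" and L k :: real
    and \<nu> :: "real \<Rightarrow> real" and \<sigma> :: "real \<Rightarrow> complex"
  assumes "bounded_C2_domain \<Omega>"
    and "parametrizes_boundary \<gamma> L \<Omega>"
    and "0 < k"
    and "smooth \<nu>" and "\<And>s. \<nu> (s + L) = \<nu> s"
    and "C1_hoelder \<sigma>" and "\<And>s. \<sigma> (s + L) = \<sigma> s"
  shows "(\<forall>t\<in>{0..L}.
      ((\<lambda>\<epsilon>. S_prime k (perturb \<gamma> \<nu> \<epsilon>) L \<sigma> t) has_vector_derivative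
         (of_real (\<nu> t) * S_second k \<gamma> L \<sigma> t
          + D_prime k \<gamma> L (\<lambda>s. of_real (\<nu> s) * \<sigma> s) t
          - of_real (ddt \<nu> t / norm (ddt \<gamma> t)) * S_tau k \<gamma> L \<sigma> t
          + S_prime k \<gamma> L (\<lambda>s. of_real (curvature \<gamma> s * \<nu> s) * \<sigma> s) t)) (at 0))
    \<and> (\<forall>t\<in>{0..L}.
      ((\<lambda>k'. S_prime k' \<gamma> L \<sigma> t) has_vector_derivative
         (- (\<i> * of_real k / 4) *
           (LINT s:{0..L}|lborel. hankel1_0 (k * dist (\<gamma> t) (\<gamma> s))
              * of_real ((\<gamma> t - \<gamma> s) \<bullet> normal \<gamma> t) * \<sigma> s * of_real (norm (ddt \<gamma> s))))) (at k))"
proof -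
  have loc: "density_on_curve \<gamma> L k \<nu> \<sigma> t" if "t \<in> {0..L}" for t
    using assms that unfolding parametrizes_boundary_def by unfold_locales auto
  show ?thesis
    using density_on_curve.S_prime_shape_derivative[OF loc]
      density_on_curve.S_prime_wavenumber_derivative[OF loc]
    by (intro conjI ballI)
qed

end
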